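(* Let $f\in \mathbb{R}[y_1,\dots,y_r]$ be a dually Lorentzian polynomial. Then, for $1\le m\le n$, $$f^{[m]}f^{[n]}-f^{[m-1]}f^{[n+1]}$$ is monomial-positive.
   Context: A homogeneous $f\in\mathbb{R}[x_1,\dots,x_n]$ of degree $k$ is Lorentzian if for all $v_1,\dots,v_k\in\mathbb{R}_{\ge0}^n\setminus\{0\}$ one has $D_{v_1}\cdots D_{v_k}f\ge0$ (directional derivatives) and, if $k\ge2$, the symmetric bilinear form $(x,y)\mapsto D_xD_yD_{v_3}\cdots D_{v_k}f$ on $\mathbb{R}^n$ has at most one positive eigenvalue. A homogeneous $f$ of degree at most $\kappa_i$ in $x_i$ is dually Lorentzian if $f^\vee=N\big(x_1^{\kappa_1}\cdots x_n^{\kappa_n}f(x_1^{-1},\dots,x_n^{-1})\big)$ is Lorentzian, where $N$ is the linear operator with $N(x^\alpha)=x^\alpha/\alpha!$, $\alpha!=\alpha_1!\cdots\alpha_n!$ (this is independent of the choice of $\kappa$). For a polynomial $f(y_1,\dots,y_r)$, $f^{[i]}$ is defined by $f(y_1+t,\dots,y_r+t)=\sum_{i\ge0}f^{[i]}(y_1,\dots,y_r)t^i$ (so $f^{[i]}=0$ for $i>\deg f$). A polynomial is monomial-positive if all its coefficients are nonnegative. *)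

theory Defs
  imports
    "HOL-Analysis.Analysis"
    "HOL-Computational_Algebra.Polynomial"
    "HOL-Library.Poly_Mapping"
begin

text \<open>
  Real polynomials in variables indexed by a type \<open>'v\<close>: a monomial is identified with its
  exponent vector, and the ring structure is the convolution product of \<^type>\<open>poly_mapping\<close>.
\<close>

type_synonym 'v monomial = "'v \<Rightarrow>\<^sub>0 nat"
type_synonym 'v rpoly = "'v monomial \<Rightarrow>\<^sub>0 real"

abbreviation coefficient :: "'v rpoly \<Rightarrow> 'v monomial \<Rightarrow> real" where
  "coefficient \<equiv> Poly_Mapping.lookup"

abbreviation monomials :: "'v rpoly \<Rightarrow> 'v monomial set" where
  "monomials \<equiv> Poly_Mapping.keys"

abbreviation exponent :: "'v monomial \<Rightarrow> 'v \<Rightarrow> nat" where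
  "exponent \<equiv> Poly_Mapping.lookup"

definition Const :: "real \<Rightarrow> 'v rpoly" where
  "Const c = Poly_Mapping.single 0 c"

definition Var :: "'v \<Rightarrow> 'v rpoly" where
  "Var i = Poly_Mapping.single (Poly_Mapping.single i 1) 1"

definition monomial_positive :: "'v rpoly \<Rightarrow> bool" where
  "monomial_positive f \<longleftrightarrow> (\<forall>\<alpha>. coefficient f \<alpha> \<ge> 0)"

definition homogeneous :: "nat \<Rightarrow> 'v::finite rpoly \<Rightarrow> bool" where
  "homogeneous k f \<longleftrightarrow> (\<forall>\<alpha>\<in>monomials f. (\<Sum>i\<in>UNIV. exponent \<alpha> i) = k)"

definition degree_bounded :: "'v monomial \<Rightarrow> 'v rpoly \<Rightarrow> bool" where
  "degree_bounded \<kappa> f \<longleftrightarrow> (\<forall>\<alpha>\<in>monomials f. \<forall>i. exponent \<alpha> i \<le> exponent \<kappa> i)"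


text \<open>The subtraction of exponents below truncates only where the coefficient is zero.\<close>

definition partial :: "'v \<Rightarrow> 'v rpoly \<Rightarrow> 'v rpoly" where
  "partial i f = (\<Sum>\<alpha>\<in>monomials f.
     Poly_Mapping.single (\<alpha> - Poly_Mapping.single i 1) (real (exponent \<alpha> i) * coefficient f \<alpha>))"

definition directional :: "real ^ 'v \<Rightarrow> 'v::finite rpoly \<Rightarrow> 'v rpoly" where
  "directional v f = (\<Sum>i\<in>UNIV. Const (v $ i) * partial i f)"

definition directionals :: "(real ^ 'v) list \<Rightarrow> 'v::finite rpoly \<Rightarrow> 'v rpoly" where
  "directionals vs f = foldr directional vs f"


text \<open>Positive eigenvalues are counted with multiplicity.\<close>

definition eigenspace :: "real ^ 'v ^ 'v \<Rightarrow> real \<Rightarrow> (real ^ 'v) set" where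
  "eigenspace A l = {x. A *v x = l *\<^sub>R x}"

definition positive_eigenvalues :: "real ^ 'v ^ 'v \<Rightarrow> real set" where
  "positive_eigenvalues A = {l. l > 0 \<and> (\<exists>x. x \<noteq> 0 \<and> x \<in> eigenspace A l)}"

definition num_positive_eigenvalues :: "real ^ 'v ^ 'v \<Rightarrow> nat" where
  "num_positive_eigenvalues A = (\<Sum>l\<in>positive_eigenvalues A. dim (eigenspace A l))"

lemma finite_positive_eigenvalues:
  fixes A :: "real ^ 'v ^ 'v"
  assumes sym: "transpose A = A"
  shows "finite (positive_eigenvalues A)"
proof -
  define L where "L = positive_eigenvalues A"
  define e where "e l = (SOME x. x \<noteq> 0 \<and> x \<in> eigenspace A l)" for l
  have e: "e l \<noteq> 0" "A *v e l = l *\<^sub>R e l" if "l \<in> L" for l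
  proof -
    have "\<exists>x. x \<noteq> 0 \<and> x \<in> eigenspace A l"
      using that by (simp add: L_def positive_eigenvalues_def)
    then have "e l \<noteq> 0 \<and> e l \<in> eigenspace A l"
      unfolding e_def by (rule someI_ex)
    then show "e l \<noteq> 0" "A *v e l = l *\<^sub>R e l"
      by (simp_all add: eigenspace_def)
  qed
  have orth: "e l \<bullet> e m = 0" if "l \<in> L" "m \<in> L" "l \<noteq> m" for l m
  proof -
    have "(A *v e l) \<bullet> e m = e l \<bullet> (A *v e m)"
      by (metis sym dot_lmul_matrix transpose_matrix_vector)
    then have "(l - m) * (e l \<bullet> e m) = 0"
      using e that by (simp add: algebra_simps)
    with that show ?thesis by simp
  qed
  have inj: "inj_on e L"
    by (rule inj_onI) (metis e(1) orth inner_eq_zero_iff)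
  have "pairwise orthogonal (e ` L)"
    unfolding pairwise_def orthogonal_def using orth by blast
  moreover have "0 \<notin> e ` L"
    using e(1) by force
  ultimately have "independent (e ` L)"
    by (rule pairwise_orthogonal_independent)
  then have "finite (e ` L)"
    by (rule independent_imp_finite)
  then show ?thesis
    using inj finite_imageD unfolding L_def by blast
qed

text \<open>
  The eigenvalues of a bilinear form on \<open>\<real>\<^sup>n\<close> are those of its Gram matrix in the standard basis.
\<close>

definition gram_matrix :: "(real ^ 'v \<Rightarrow> real ^ 'v \<Rightarrow> real) \<Rightarrow> real ^ 'v ^ 'v" where
  "gram_matrix B = (\<chi> i j. B (axis i 1) (axis j 1))"

definition nonneg_nonzero :: "(real ^ 'v) set" where
  "nonneg_nonzero = {v. v \<noteq> 0 \<and> (\<forall>i. v $ i \<ge> 0)}"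

text \<open>
  A \<open>k\<close>-fold derivative of a homogeneous polynomial of degree \<open>k\<close> is a constant polynomial;
  the corresponding real number is its coefficient at the exponent vector \<open>0\<close>.
  The zero polynomial is homogeneous of every degree.
\<close>

definition lorentzian_of_degree :: "nat \<Rightarrow> 'v::finite rpoly \<Rightarrow> bool" where
  "lorentzian_of_degree k f \<longleftrightarrow>
     homogeneous k f \<and>
     (\<forall>vs. length vs = k \<longrightarrow> set vs \<subseteq> nonneg_nonzero \<longrightarrow>
        coefficient (directionals vs f) 0 \<ge> 0) \<and>
     (k \<ge> 2 \<longrightarrow> (\<forall>vs. length vs = k - 2 \<longrightarrow> set vs \<subseteq> nonneg_nonzero \<longrightarrow>
        num_positive_eigenvalues
          (gram_matrix (\<lambda>x y. coefficient (directional x (directional y (directionals vs f))) 0)) \<le> 1))"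

definition lorentzian :: "'v::finite rpoly \<Rightarrow> bool" where
  "lorentzian f \<longleftrightarrow> (\<exists>k. lorentzian_of_degree k f)"


text \<open>\<open>reversal \<kappa> f\<close> is \<open>x\<^sup>\<kappa> f(x\<^sub>1\<^sup>-\<^sup>1, \<dots>, x\<^sub>n\<^sup>-\<^sup>1)\<close>; it is only meaningful for \<open>degree_bounded \<kappa> f\<close>.\<close>

definition reversal :: "'v monomial \<Rightarrow> 'v rpoly \<Rightarrow> 'v rpoly" where
  "reversal \<kappa> f = (\<Sum>\<alpha>\<in>monomials f. Poly_Mapping.single (\<kappa> - \<alpha>) (coefficient f \<alpha>))"

definition normalization_op :: "'v::finite rpoly \<Rightarrow> 'v rpoly" where
  "normalization_op f = (\<Sum>\<alpha>\<in>monomials f.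
     Poly_Mapping.single \<alpha> (coefficient f \<alpha> / (\<Prod>i\<in>UNIV. fact (exponent \<alpha> i))))"

definition dual :: "'v monomial \<Rightarrow> 'v::finite rpoly \<Rightarrow> 'v rpoly" where
  "dual \<kappa> f = normalization_op (reversal \<kappa> f)"

text \<open>
  Whether \<open>dual \<kappa> f\<close> is Lorentzian does not depend on the admissible \<open>\<kappa>\<close>; as this notion is used as
  a hypothesis, it is stated in the form that asks for least.
\<close>

definition dually_lorentzian :: "'v::finite rpoly \<Rightarrow> bool" where
  "dually_lorentzian f \<longleftrightarrow>
     (\<exists>k. homogeneous k f) \<and> (\<exists>\<kappa>. degree_bounded \<kappa> f \<and> lorentzian (dual \<kappa> f))"


text \<open>\<open>diagonal_shift f\<close> is \<open>f(y\<^sub>1 + t, \<dots>, y\<^sub>r + t)\<close> as a univariate polynomial in \<open>t\<close> over the \<open>y\<^sub>i\<close>.\<close>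

definition diagonal_shift :: "'v::finite rpoly \<Rightarrow> 'v rpoly poly" where
  "diagonal_shift f = (\<Sum>\<alpha>\<in>monomials f.
     [:Const (coefficient f \<alpha>):] * (\<Prod>i\<in>UNIV. [:Var i, 1:] ^ exponent \<alpha> i))"

definition derived :: "'v::finite rpoly \<Rightarrow> nat \<Rightarrow> 'v rpoly" where
  "derived f i = poly.coeff (diagonal_shift f) i"

end

(*
  Polarize the dual polynomial: give each variable i of a large number of slots and let
  G(T), for a set T of slots, be the derivative of f(y) f(y') at 0 along the variables whose slots are
  not in T.  The quadratic derivatives of this multiaffine polynomial are, up to a negative semidefinite
  summand, Hessians of derivatives of the Lorentzian dual of f, so a local-to-global argument (a Bochner
  inequality and a Perron-type eigenvalue argument) gives the Alexandrov-Fenchel inequality for G.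
  That inequality survives merging two slots p, q into one that stands for the sum of the two directions:
  the new polynomial is the derivative along e_p + e_q restricted to x_q = 0.  Merging leads to slots for
  the directions (1, 0), (0, 1) and (e_i, e_i), and the resulting binary form in the first two kinds has
  the coefficients [y^gamma] f^[a] f^[b] with a + b fixed.  They are log-concave and symmetric in a, b,
  hence unimodal.  Internal zeros are avoided by perturbing the dual polynomial and the two directions
  into strictly positive ones and passing to the limit.
*)
theory Submission
  imports Defs
begin

section \<open>Quadratic forms with at most one positive eigenvalue\<close>

text \<open>The hypothesis concerns the dual, whose derivative at 0 with exponent \<kappa> -
  \<alpha> is the plain coefficient of y^\<alpha> in f. Hence G is indexed by the slots that are not
  differentiated: differentiating G removes derivatives of f, that is, adds derivatives of the dual.
  The obstacle is that a slot for a sum such as (1, 0) or (e_i, e_i) does not correspond to a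
  directional derivative of the dual, so the local quadratic conditions are checked only for slots
  carrying a single variable. They are globalised there, and only the global inequality is carried
  through the merges. Two copies of f occur because the target is a product: a slot for (e_i, e_i)
  acts on f^[a](y) f^[b](y') as the product rule does on the diagonal y = y', and a slots for (1, 0)
  yield a! f^[a]. Doubling keeps at most one positive eigenvalue, since homogeneity leaves in each
  quadratic derivative at most one diagonal block or a product of two linear forms. Log-concavity
  alone does not compare terms across a gap of zeros, hence the strictly positive
  perturbation.\<close>

definition form :: "'e set \<Rightarrow> ('e \<Rightarrow> 'e \<Rightarrow> real) \<Rightarrow> ('e \<Rightarrow> real) \<Rightarrow> ('e \<Rightarrow> real) \<Rightarrow> real" where
  "form E H x y = (\<Sum>i\<in>E. \<Sum>j\<in>E. H i j * x i * y j)"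

definition symmetric_on :: "'e set \<Rightarrow> ('e \<Rightarrow> 'e \<Rightarrow> real) \<Rightarrow> bool" where
  "symmetric_on E H \<longleftrightarrow> (\<forall>i\<in>E. \<forall>j\<in>E. H i j = H j i)"

lemma form_sym: "symmetric_on E H \<Longrightarrow> form E H x y = form E H y x"
  unfolding form_def symmetric_on_def
  by (subst sum.swap) (auto intro!: sum.cong simp: mult_ac)

lemma form_lincomb_left:
  "form E H (\<lambda>i. a * x i + b * y i) z = a * form E H x z + b * form E H y z"
  by (simp add: form_def algebra_simps sum.distrib sum_distrib_left)

lemma form_lincomb_right:
  "form E H z (\<lambda>i. a * x i + b * y i) = a * form E H z x + b * form E H z y"
  by (simp add: form_def algebra_simps sum.distrib sum_distrib_left)

lemma form_lincomb_square:
  assumes "symmetric_on E H"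
  shows "form E H (\<lambda>i. a * x i + b * y i) (\<lambda>i. a * x i + b * y i)
    = a\<^sup>2 * form E H x x + 2 * a * b * form E H x y + b\<^sup>2 * form E H y y"
  using form_sym[OF assms, of y x]
  by (simp add: form_lincomb_left form_lincomb_right algebra_simps power2_eq_square)

lemma form_eq_sum_left: "form E H x y = (\<Sum>i\<in>E. x i * (\<Sum>j\<in>E. H i j * y j))"
  by (simp add: form_def sum_distrib_left mult_ac)

section \<open>Eigenvectors by constrained maximisation\<close>

lemma quadratic_nonneg_imp_linear_zero:
  fixes b c :: real
  assumes "\<And>t. 0 \<le> 2 * t * b + t\<^sup>2 * c"
  shows "b = 0"
proof (rule ccontr)
  assume b: "b \<noteq> 0"
  \<comment> \<open>Small enough for the linear term -2 b^2/(|c| + 1) to outweigh the quadratic one,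
    which is at most b^2/(|c| + 1); the + 1 covers c = 0.\<close>
  define t where "t = - b / (\<bar>c\<bar> + 1)"
  have "t\<^sup>2 * c \<le> t\<^sup>2 * (\<bar>c\<bar> + 1)" by (intro mult_left_mono) auto
  also have "\<dots> = b\<^sup>2 / (\<bar>c\<bar> + 1)"
    unfolding t_def by (simp add: power_divide power2_eq_square add_nonneg_pos)
  finally have "2 * t * b + t\<^sup>2 * c \<le> - (b\<^sup>2 / (\<bar>c\<bar> + 1))"
    unfolding t_def by (simp add: power2_eq_square)
  moreover have "b\<^sup>2 / (\<bar>c\<bar> + 1) > 0" using b by (simp add: add_nonneg_pos)
  ultimately show False using assms[of t] by linarith
qed

text \<open>Compactness of the ellipsoid sum D_i w_i^2 = 1 cut with the hyperplane D-orthogonal to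
  u. Vectors are functions on a possibly infinite type, so coordinates outside E are pinned to 0 and
  the others satisfy |w_i| <= 1/sqrt(D_i), which places the section in a compact product of
  intervals. The vector z makes the section nonempty, and homogeneity of degree 2 carries the bound
  over to all x in the hyperplane.\<close>

lemma constrained_sphere_attains_max:
  assumes fin: "finite E" and Dpos: "\<And>i. i \<in> E \<Longrightarrow> 0 < D i"
    and ne: "(\<Sum>i\<in>E. D i * u i * z i) = 0" "\<exists>i\<in>E. z i \<noteq> (0::real)"
  shows "\<exists>w. (\<Sum>i\<in>E. D i * (w i)\<^sup>2) = 1 \<and> (\<Sum>i\<in>E. D i * u i * w i) = 0 \<and>
    (\<forall>x. (\<Sum>i\<in>E. D i * u i * x i) = 0 \<longrightarrow> form E H x x \<le> form E H w w * (\<Sum>i\<in>E. D i * (x i)\<^sup>2))"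
proof -
  define S where "S i = (if i \<in> E then {- 1 / sqrt (D i) .. 1 / sqrt (D i)} else {0::real})" for i
  define K where "K = {w. w \<in> PiE UNIV S \<and> (\<Sum>i\<in>E. D i * (w i)\<^sup>2) = 1 \<and> (\<Sum>i\<in>E. D i * u i * w i) = 0}"
  define nrm where "nrm x = (\<Sum>i\<in>E. D i * (x i)\<^sup>2)" for x
  have "compactin (product_topology (\<lambda>i. euclidean) UNIV) (PiE UNIV S)"
    by (subst compactin_PiE) (auto simp: S_def)
  then have cS: "compact (PiE UNIV S)"
    by (simp add: euclidean_product_topology)
  have cont: "continuous_on A (\<lambda>w. w i :: real)" for A i
    by (rule continuous_on_subset[OF continuous_on_product_coordinates]) simp
  have c1: "continuous_on UNIV (\<lambda>w. \<Sum>i\<in>E. D i * (w i)\<^sup>2)"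
    and c2: "continuous_on UNIV (\<lambda>w. \<Sum>i\<in>E. D i * u i * w i)"
    by (intro continuous_intros cont)+
  have "K = PiE UNIV S \<inter> ((\<lambda>w. \<Sum>i\<in>E. D i * (w i)\<^sup>2) -` {1} \<inter> (\<lambda>w. \<Sum>i\<in>E. D i * u i * w i) -` {0})"
    by (auto simp: K_def)
  moreover have "closed ((\<lambda>w. \<Sum>i\<in>E. D i * (w i)\<^sup>2) -` {1} \<inter> (\<lambda>w. \<Sum>i\<in>E. D i * u i * w i) -` {0})"
    by (intro closed_Int closed_vimage c1 c2) auto
  ultimately have cK: "compact K" using cS by (simp add: compact_Int_closed)
  have normalise: "(\<lambda>i. if i \<in> E then x i / sqrt (nrm x) else 0) \<in> K"
    if "(\<Sum>i\<in>E. D i * u i * x i) = 0" "nrm x > 0" for x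
  proof -
    let ?y = "\<lambda>i. if i \<in> E then x i / sqrt (nrm x) else 0"
    have 1: "(\<Sum>i\<in>E. D i * (?y i)\<^sup>2) = 1"
    proof -
      have "(\<Sum>i\<in>E. D i * (?y i)\<^sup>2) = (\<Sum>i\<in>E. D i * (x i)\<^sup>2) / nrm x"
        using that(2) by (simp add: sum_divide_distrib power_divide)
      then show ?thesis using that(2) by (simp add: nrm_def)
    qed
    have 2: "(\<Sum>i\<in>E. D i * u i * ?y i) = 0"
    proof -
      have "(\<Sum>i\<in>E. D i * u i * ?y i) = (\<Sum>i\<in>E. D i * u i * x i) / sqrt (nrm x)"
        by (simp add: sum_divide_distrib)
      then show ?thesis using that by simp
    qed
    have "?y i \<in> S i" for i
    proof (cases "i \<in> E")
      case True
      have "D i * (?y i)\<^sup>2 \<le> (\<Sum>i\<in>E. D i * (?y i)\<^sup>2)"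
        using True fin by (intro member_le_sum) (auto intro!: mult_nonneg_nonneg less_imp_le[OF Dpos])
      then have "(?y i)\<^sup>2 \<le> 1 / D i"
        using 1 Dpos[OF True] by (simp add: field_simps)
      then have "\<bar>?y i\<bar> \<le> sqrt (1 / D i)"
        by (metis real_sqrt_abs real_sqrt_le_iff)
      then have "- (1 / sqrt (D i)) \<le> ?y i" "?y i \<le> 1 / sqrt (D i)"
        unfolding real_sqrt_divide abs_le_iff by simp_all
      then show ?thesis using True by (simp add: S_def)
    qed (simp add: S_def)
    then show ?thesis using 1 2 by (simp add: K_def PiE_def)
  qed
  have nrm_pos: "nrm x > 0" if ex: "\<exists>i\<in>E. x i \<noteq> 0" for x
  proof -
    obtain i where i: "i \<in> E" "x i \<noteq> 0" using ex by blast
    then show ?thesis unfolding nrm_def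
      using fin Dpos by (intro sum_pos2[of E i]) (auto intro!: mult_nonneg_nonneg less_imp_le[OF Dpos])
  qed
  have "K \<noteq> {}" using normalise[OF ne(1) nrm_pos[OF ne(2)]] by blast
  moreover have "continuous_on K (\<lambda>w. form E H w w)"
    unfolding form_def by (intro continuous_intros cont)
  ultimately obtain w where w: "w \<in> K" "\<And>y. y \<in> K \<Longrightarrow> form E H y y \<le> form E H w w"
    using continuous_attains_sup[OF cK] by blast
  show ?thesis
  proof (intro exI[of _ w] conjI allI impI)
    show "(\<Sum>i\<in>E. D i * (w i)\<^sup>2) = 1" "(\<Sum>i\<in>E. D i * u i * w i) = 0"
      using w(1) by (auto simp: K_def)
    fix x assume x: "(\<Sum>i\<in>E. D i * u i * x i) = 0"
    show "form E H x x \<le> form E H w w * (\<Sum>i\<in>E. D i * (x i)\<^sup>2)"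
    proof (cases "\<exists>i\<in>E. x i \<noteq> 0")
      case True
      let ?y = "\<lambda>i. if i \<in> E then x i / sqrt (nrm x) else 0"
      have p: "nrm x > 0" using nrm_pos[OF True] .
      have "form E H ?y ?y = form E H x x / nrm x"
        using p by (simp add: form_def sum_divide_distrib)
      moreover have "form E H ?y ?y \<le> form E H w w" using w(2) normalise[OF x p] by blast
      ultimately have "form E H x x / nrm x \<le> form E H w w" by simp
      then show ?thesis using p by (simp add: nrm_def[symmetric] pos_divide_le_eq)
    next
      case False
      then show ?thesis by (simp add: form_def)
    qed
  qed
qed

text \<open>Maximise the Rayleigh quotient on the D-orthogonal complement of the known eigenvector
  u. The maximum \<open>ev\<close> is positive because of z, and the first-order condition kills the
  residual functional \<open>r\<close> on the complement. On u it vanishes because H is symmetric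
  and u is an eigenvector, so the maximiser solves H w = ev D w in every coordinate. The choice u =
  0 gives the unconstrained maximum.\<close>

lemma generalised_eigenvector_exists:
  assumes fin: "finite E" and sym: "symmetric_on E H" and Dpos: "\<And>i. i \<in> E \<Longrightarrow> 0 < D i"
    and eig: "\<And>i. i \<in> E \<Longrightarrow> (\<Sum>j\<in>E. H i j * u j) = \<mu> * D i * u i"
    and z: "(\<Sum>i\<in>E. D i * u i * z i) = 0" "form E H z z > 0"
  shows "\<exists>w ev. ev > 0 \<and> (\<exists>i\<in>E. w i \<noteq> 0) \<and> (\<Sum>i\<in>E. D i * u i * w i) = 0 \<and>
    (\<forall>i\<in>E. (\<Sum>j\<in>E. H i j * w j) = ev * D i * w i)"
proof -
  have z0: "\<exists>i\<in>E. z i \<noteq> 0" 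
    using z(2) by (rule contrapos_pp) (simp add: form_def)
  obtain w where w1: "(\<Sum>i\<in>E. D i * (w i)\<^sup>2) = 1" and w2: "(\<Sum>i\<in>E. D i * u i * w i) = 0"
    and w3: "\<And>x. (\<Sum>i\<in>E. D i * u i * x i) = 0 \<Longrightarrow> form E H x x \<le> form E H w w * (\<Sum>i\<in>E. D i * (x i)\<^sup>2)"
    using constrained_sphere_attains_max[of E D u z H] fin Dpos z(1) z0 by blast
  define ev where "ev = form E H w w"
  have "ev * (\<Sum>i\<in>E. D i * (z i)\<^sup>2) > 0" using w3[OF z(1)] z(2) by (simp add: ev_def)
  moreover have "(\<Sum>i\<in>E. D i * (z i)\<^sup>2) \<ge> 0" by (intro sum_nonneg) (auto intro!: mult_nonneg_nonneg less_imp_le[OF Dpos])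
  ultimately have lpos: "ev > 0" by (simp add: zero_less_mult_iff)
  define r where "r x = form E H x w - ev * (\<Sum>i\<in>E. D i * x i * w i)" for x
  have perp: "r x = 0" if x: "(\<Sum>i\<in>E. D i * u i * x i) = 0" for x
  proof -
    have "0 \<le> 2 * t * (- r x) + t\<^sup>2 * (ev * (\<Sum>i\<in>E. D i * (x i)\<^sup>2) - form E H x x)" for t
    proof -
      let ?y = "\<lambda>i. 1 * w i + t * x i"
      have "(\<Sum>i\<in>E. D i * u i * ?y i) = (\<Sum>i\<in>E. D i * u i * w i) + t * (\<Sum>i\<in>E. D i * u i * x i)"
        by (simp add: algebra_simps sum.distrib sum_distrib_left)
      then have "(\<Sum>i\<in>E. D i * u i * ?y i) = 0" using x w2 by simp
      from w3[OF this] have le: "form E H ?y ?y \<le> ev * (\<Sum>i\<in>E. D i * (?y i)\<^sup>2)" unfolding ev_def .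
      have "(\<Sum>i\<in>E. D i * (?y i)\<^sup>2) = (\<Sum>i\<in>E. D i * (w i)\<^sup>2) + 2 * t * (\<Sum>i\<in>E. D i * x i * w i) + t\<^sup>2 * (\<Sum>i\<in>E. D i * (x i)\<^sup>2)"
        by (simp add: power2_eq_square algebra_simps sum.distrib sum_distrib_left)
      moreover have "form E H ?y ?y = ev + 2 * t * form E H x w + t\<^sup>2 * form E H x x"
        unfolding form_lincomb_square[OF sym] ev_def using form_sym[OF sym, of w x] by simp
      ultimately show ?thesis using le w1 by (simp add: r_def algebra_simps)
    qed
    then show ?thesis using quadratic_nonneg_imp_linear_zero by fastforce
  qed
  have ru: "r u = 0"
  proof -
    have "form E H u w = form E H w u" using form_sym[OF sym] .
    also have "\<dots> = (\<Sum>i\<in>E. w i * (\<mu> * D i * u i))"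
      unfolding form_eq_sum_left by (intro sum.cong) (auto simp: eig)
    also have "\<dots> = \<mu> * (\<Sum>i\<in>E. D i * u i * w i)" by (simp add: sum_distrib_left mult_ac)
    finally show ?thesis using w2 by (simp add: r_def)
  qed
  have rlin: "r (\<lambda>i. a * x i + b * y i) = a * r x + b * r y" for a b x y
    by (simp add: r_def form_lincomb_left algebra_simps sum.distrib sum_distrib_left)
  have r0: "r x = 0" for x
  proof (cases "(\<Sum>i\<in>E. D i * u i * u i) = 0")
    case True
    moreover have "0 \<le> D i * u i * u i" if "i \<in> E" for i
      using Dpos[OF that] mult_nonneg_nonneg[of "D i" "u i * u i"] by (simp add: mult.assoc)
    ultimately have "\<forall>i\<in>E. D i * u i * u i = 0"
      using fin by (simp add: sum_nonneg_eq_0_iff)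
    then have "\<forall>i\<in>E. u i = 0" using Dpos by fastforce
    then show ?thesis by (intro perp) simp
  next
    case False
    define s where "s = (\<Sum>i\<in>E. D i * u i * x i) / (\<Sum>i\<in>E. D i * u i * u i)"
    have "(\<Sum>i\<in>E. D i * u i * (1 * x i + (- s) * u i)) = 
      (\<Sum>i\<in>E. D i * u i * x i) - s * (\<Sum>i\<in>E. D i * u i * u i)"
      by (simp add: algebra_simps sum_subtractf sum_distrib_left)
    also have "\<dots> = 0" using False by (simp add: s_def)
    finally have "r (\<lambda>i. 1 * x i + (- s) * u i) = 0" by (rule perp)
    then show ?thesis using ru by (simp only: rlin)
  qed
  show ?thesis
  proof (intro exI[of _ w] exI[of _ ev] conjI ballI lpos w2)
    show "\<exists>i\<in>E. w i \<noteq> 0" using w1 by (rule contrapos_pp) simp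
    fix k assume k: "k \<in> E"
    let ?e = "\<lambda>i. if i = k then 1 else (0::real)"
    have delta: "(\<Sum>i\<in>E. ?e i * g i) = g k" for g
    proof -
      have "(\<Sum>i\<in>E. ?e i * g i) = (\<Sum>i\<in>E. if i = k then g i else 0)"
        by (intro sum.cong) auto
      then show ?thesis using k fin by simp
    qed
    have "form E H ?e w = (\<Sum>j\<in>E. H k j * w j)"
      unfolding form_eq_sum_left by (rule delta)
    moreover have "(\<Sum>i\<in>E. D i * ?e i * w i) = D k * w k"
      using delta[of "\<lambda>i. D i * w i"] by (simp add: mult_ac)
    ultimately show "(\<Sum>j\<in>E. H k j * w j) = ev * D k * w k"
      using r0[of ?e] by (simp add: r_def)
  qed
qed

text \<open>Equivalently, the form has at most one positive eigenvalue.\<close>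

definition index_le_one :: "'e set \<Rightarrow> ('e \<Rightarrow> 'e \<Rightarrow> real) \<Rightarrow> bool" where
  "index_le_one E H \<longleftrightarrow> (\<exists>l. \<forall>x. (\<Sum>i\<in>E. l i * x i) = 0 \<longrightarrow> form E H x x \<le> 0)"

text \<open>The combination a x - b y with a = l . y and b = l . x lies in the hyperplane on which
  the form is nonpositive. Multiplying by \<open>form E H y y\<close> and completing the square
  leaves the claim times a^2, and a is nonzero because the form is positive at y.\<close>

lemma index_le_one_reverse_cauchy_schwarz:
  assumes sym: "symmetric_on E H" and ind: "index_le_one E H" and y: "form E H y y \<ge> 0"
  shows "form E H x x * form E H y y \<le> (form E H x y)\<^sup>2"
proof (cases "form E H y y = 0")
  case False
  then have ypos: "form E H y y > 0" using y by simp
  obtain l where l: "\<And>x. (\<Sum>i\<in>E. l i * x i) = 0 \<Longrightarrow> form E H x x \<le> 0"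
    using ind by (auto simp: index_le_one_def)
  define a where "a = (\<Sum>i\<in>E. l i * y i)"
  define b where "b = (\<Sum>i\<in>E. l i * x i)"
  have a: "a \<noteq> 0" using l[of y] ypos by (auto simp: a_def)
  have "(\<Sum>i\<in>E. l i * (a * x i + (- b) * y i)) = a * (\<Sum>i\<in>E. l i * x i) - b * (\<Sum>i\<in>E. l i * y i)"
    by (simp add: algebra_simps sum_subtractf sum_distrib_left)
  then have "(\<Sum>i\<in>E. l i * (a * x i + (- b) * y i)) = 0" by (simp add: a_def b_def)
  then have "form E H (\<lambda>i. a * x i + (- b) * y i) (\<lambda>i. a * x i + (- b) * y i) \<le> 0"
    using l[of "\<lambda>i. a * x i + (- b) * y i"] by simp
  then have "a\<^sup>2 * form E H x x - 2 * a * b * form E H x y + b\<^sup>2 * form E H y y \<le> 0"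
    unfolding form_lincomb_square[OF sym] by simp
  then have "form E H y y * (a\<^sup>2 * form E H x x - 2 * a * b * form E H x y + b\<^sup>2 * form E H y y) \<le> 0"
    using ypos by (simp add: mult_nonneg_nonpos)
  moreover have "(b * form E H y y - a * form E H x y)\<^sup>2 \<ge> 0" by simp
  ultimately have "a\<^sup>2 * (form E H x x * form E H y y - (form E H x y)\<^sup>2) \<le> 0"
    by (simp add: power2_eq_square algebra_simps)
  then show ?thesis using a by (simp add: mult_le_0_iff)
qed simp

text \<open>Index at most one is recorded through the inequality it yields: a closed polynomial
  condition passes directly to limits and to smaller index sets. The sign of x is free; only y is
  nonnegative.\<close>

definition hyperbolic :: "'e set \<Rightarrow> ('e \<Rightarrow> 'e \<Rightarrow> real) \<Rightarrow> bool" where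
  "hyperbolic E H \<longleftrightarrow>
     (\<forall>x y. (\<forall>i\<in>E. y i \<ge> 0) \<longrightarrow> form E H x x * form E H y y \<le> (form E H x y)\<^sup>2)"

lemma form_nonneg:
  assumes "\<And>i j. i \<in> E \<Longrightarrow> j \<in> E \<Longrightarrow> H i j \<ge> 0" "\<And>i. i \<in> E \<Longrightarrow> x i \<ge> 0" "\<And>i. i \<in> E \<Longrightarrow> y i \<ge> 0"
  shows "form E H x y \<ge> 0"
  unfolding form_def using assms by (intro sum_nonneg mult_nonneg_nonneg) auto

lemma hyperbolic_if_index_le_one:
  assumes "symmetric_on E H" "index_le_one E H" "\<And>i j. i \<in> E \<Longrightarrow> j \<in> E \<Longrightarrow> H i j \<ge> 0"
  shows "hyperbolic E H"
  unfolding hyperbolic_def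
  using index_le_one_reverse_cauchy_schwarz[OF assms(1,2)] form_nonneg[of E H] assms(3) by blast

text \<open>
  With \<open>D\<^sub>i = (H v)\<^sub>i / v\<^sub>i\<close>, the reverse Cauchy-Schwarz inequality for each \<open>T k\<close> against \<open>v\<close> gives
  \<open>z\<^sup>T H z \<le> (H z)\<^sup>T D\<^sup>-\<^sup>1 (H z)\<close>. So no eigenvalue of \<open>D\<^sup>-\<^sup>1 H\<close> lies strictly between \<open>0\<close> and \<open>1\<close>,
  and the Perron eigenvalue \<open>1\<close> is simple by connectivity.
\<close>

lemma local_to_global:
  fixes T :: "'e \<Rightarrow> 'e \<Rightarrow> 'e \<Rightarrow> real"
  assumes fin: "finite E"
    and Tnn: "\<And>i j k. i \<in> E \<Longrightarrow> j \<in> E \<Longrightarrow> k \<in> E \<Longrightarrow> T i j k \<ge> 0"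
    and Tsym1: "\<And>i j k. i \<in> E \<Longrightarrow> j \<in> E \<Longrightarrow> k \<in> E \<Longrightarrow> T i j k = T j i k"
    and Tsym2: "\<And>i j k. i \<in> E \<Longrightarrow> j \<in> E \<Longrightarrow> k \<in> E \<Longrightarrow> T i j k = T i k j"
    and vpos: "\<And>i. i \<in> E \<Longrightarrow> v i > 0"
    and hyp: "\<And>k. k \<in> E \<Longrightarrow> hyperbolic E (T k)"
    and H: "\<And>i j. i \<in> E \<Longrightarrow> j \<in> E \<Longrightarrow> H i j = (\<Sum>k\<in>E. v k * T k i j)"
    and conn: "\<And>i j p q. i \<in> E \<Longrightarrow> j \<in> E \<Longrightarrow> p \<in> E \<Longrightarrow> q \<in> E \<Longrightarrow> H i p > 0 \<Longrightarrow> H j q > 0 \<Longrightarrow>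
      i = j \<or> H i j > 0 \<or> (\<exists>m\<in>E. H i m > 0 \<and> H m j > 0)"
  shows "hyperbolic E H"
proof -
  \<comment> \<open>\<open>s\<close> is H v, so s . x = 0 describes the complement of v with respect
    to H; this functional witnesses \<open>index_le_one\<close> at the end.\<close>
  define s where "s i = (\<Sum>j\<in>E. H i j * v j)" for i
  have Hnn: "H i j \<ge> 0" if "i \<in> E" "j \<in> E" for i j
    unfolding H[OF that] using that by (intro sum_nonneg mult_nonneg_nonneg Tnn less_imp_le[OF vpos]) auto
  have Hsym: "H i j = H j i" if "i \<in> E" "j \<in> E" for i j
    unfolding H[OF that] H[OF that(2,1)] using that by (intro sum.cong) (auto simp: Tsym2)
  then have symH: "symmetric_on E H" by (simp add: symmetric_on_def)
  have symT: "symmetric_on E (T k)" if "k \<in> E" for k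
    using that Tsym2 by (simp add: symmetric_on_def)
  have snn: "s i \<ge> 0" if "i \<in> E" for i
    unfolding s_def using that by (intro sum_nonneg mult_nonneg_nonneg Hnn less_imp_le[OF vpos]) auto
  have s0: "H i j = 0" if "i \<in> E" "j \<in> E" "s i = 0" for i j
  proof -
    have "\<forall>j\<in>E. H i j * v j = 0"
      using that(3) unfolding s_def
      by (subst (asm) sum_nonneg_eq_0_iff[OF fin]) (auto intro!: mult_nonneg_nonneg Hnn[OF that(1)] less_imp_le[OF vpos])
    then show ?thesis using that vpos by fastforce
  qed
  have row: "form E (T k) v z = (\<Sum>j\<in>E. H k j * z j)" if k: "k \<in> E" for k z
  proof -
    have "(\<Sum>j\<in>E. H k j * z j) = (\<Sum>j\<in>E. \<Sum>i\<in>E. v i * T i k j * z j)"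
      using k by (intro sum.cong) (auto simp: H sum_distrib_right)
    also have "\<dots> = (\<Sum>i\<in>E. \<Sum>j\<in>E. v i * T i k j * z j)" by (rule sum.swap)
    also have "\<dots> = form E (T k) v z"
      unfolding form_def using k by (intro sum.cong) (auto simp: Tsym1 mult_ac)
    finally show ?thesis ..
  qed
  have formH: "form E H x y = (\<Sum>k\<in>E. v k * form E (T k) x y)" for x y
  proof -
    have "form E H x y = (\<Sum>i\<in>E. \<Sum>j\<in>E. \<Sum>k\<in>E. v k * (T k i j * x i * y j))"
      unfolding form_def by (intro sum.cong) (auto simp: H sum_distrib_right sum_distrib_left mult_ac)
    also have "\<dots> = (\<Sum>i\<in>E. \<Sum>k\<in>E. \<Sum>j\<in>E. v k * (T k i j * x i * y j))"
      by (intro sum.cong refl sum.swap)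
    also have "\<dots> = (\<Sum>k\<in>E. \<Sum>i\<in>E. \<Sum>j\<in>E. v k * (T k i j * x i * y j))" by (rule sum.swap)
    finally show ?thesis by (simp add: form_def sum_distrib_left)
  qed
  have "form E H x x \<le> 0" if x: "(\<Sum>i\<in>E. s i * x i) = 0" for x
  proof (rule ccontr)
    assume "\<not> form E H x x \<le> 0"
    then have xpos: "form E H x x > 0" by simp
    \<comment> \<open>A row with s i = 0 vanishes entirely, as v is positive and H nonnegative.
      Dropping these indices makes D positive on the rest.\<close>
    define E' where "E' = {i\<in>E. s i > 0}"
    define D where "D i = s i / v i" for i
    have E'sub: "E' \<subseteq> E" and finE': "finite E'" using fin by (auto simp: E'_def)
    have off: "H i j = 0" if "i \<in> E - E'" "j \<in> E" for i j
      using s0[of i j] snn[of i] that by (force simp: E'_def)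
    have off': "H i j = 0" if "i \<in> E" "j \<in> E - E'" for i j
      using off[of j i] Hsym[of i j] that by auto
    have restr: "(\<Sum>j\<in>E. H i j * z j) = (\<Sum>j\<in>E'. H i j * z j)" if "i \<in> E" for i z
      using off' that E'sub fin by (intro sum.mono_neutral_right) auto
    have restrf: "form E H z z = form E' H z z" for z
    proof -
      have "form E H z z = (\<Sum>i\<in>E'. z i * (\<Sum>j\<in>E. H i j * z j))"
        unfolding form_eq_sum_left using off E'sub fin by (intro sum.mono_neutral_right) auto
      also have "\<dots> = form E' H z z"
        unfolding form_eq_sum_left using restr E'sub by (intro sum.cong) auto
      finally show ?thesis .
    qed
    have Dpos: "D i > 0" if "i \<in> E'" for i
      using that vpos by (auto simp: D_def E'_def)
    have eig: "(\<Sum>j\<in>E'. H i j * v j) = 1 * D i * v i" if "i \<in> E'" for i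
      using that restr[of i v] vpos[of i] by (auto simp: D_def E'_def s_def)
    have "(\<Sum>i\<in>E'. D i * v i * x i) = (\<Sum>i\<in>E'. s i * x i)"
      using vpos E'sub by (intro sum.cong) (auto simp: D_def less_imp_neq[symmetric])
    also have "\<dots> = (\<Sum>i\<in>E. s i * x i)"
      using E'sub fin snn by (intro sum.mono_neutral_left) (force simp: E'_def)+
    finally have perp: "(\<Sum>i\<in>E'. D i * v i * x i) = 0" using x by simp
    have "symmetric_on E' H" using symH E'sub by (auto simp: symmetric_on_def)
    moreover have "form E' H x x > 0" using xpos restrf[of x] by simp
    ultimately have "\<exists>w ev. ev > 0 \<and> (\<exists>i\<in>E'. w i \<noteq> 0) \<and> (\<Sum>i\<in>E'. D i * v i * w i) = 0 \<and>
        (\<forall>i\<in>E'. (\<Sum>j\<in>E'. H i j * w j) = ev * D i * w i)"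
      using finE' Dpos eig perp by (intro generalised_eigenvector_exists[where \<mu> = 1])
    then obtain w ev where ev: "ev > 0" and wne: "\<exists>i\<in>E'. w i \<noteq> 0"
      and wperp: "(\<Sum>i\<in>E'. D i * v i * w i) = 0"
      and weig: "\<And>i. i \<in> E' \<Longrightarrow> (\<Sum>j\<in>E'. H i j * w j) = ev * D i * w i" by blast
    define N where "N = (\<Sum>i\<in>E'. D i * (w i)\<^sup>2)"
    have Npos: "N > 0"
    proof -
      obtain i where i: "i \<in> E'" "w i \<noteq> 0" using wne by blast
      show ?thesis unfolding N_def
        using i finE' Dpos by (intro sum_pos2[of E' i]) (auto intro!: mult_nonneg_nonneg less_imp_le[OF Dpos])
    qed
    have "form E H w w = (\<Sum>i\<in>E'. w i * (ev * D i * w i))"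
      unfolding restrf unfolding form_eq_sum_left by (intro sum.cong) (auto simp: weig)
    then have wf: "form E H w w = ev * N"
      by (simp add: N_def sum_distrib_left power2_eq_square mult_ac)
    \<comment> \<open>The inequality is applied to the second eigenvector w: pairing
      \<open>T k\<close> with v and v gives s k, with w and v it gives (H w)_k = ev D_k w_k. Outside
      \<open>E'\<close> row k of H is zero, which by nonnegativity forces \<open>T k\<close> to
      vanish.\<close>
    have "v k * form E (T k) w w \<le> (if k \<in> E' then ev\<^sup>2 * (D k * (w k)\<^sup>2) else 0)" if k: "k \<in> E" for k
    proof (cases "k \<in> E'")
      case True
      have "form E (T k) w w * form E (T k) v v \<le> (form E (T k) w v)\<^sup>2"
        using hyp[OF k] vpos by (auto simp: hyperbolic_def less_imp_le)
      moreover have "form E (T k) v v = s k" unfolding row[OF k] s_def ..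
      moreover have "form E (T k) w v = ev * D k * w k"
        unfolding form_sym[OF symT[OF k], of w v] row[OF k] restr[OF k] using weig[OF True] .
      ultimately have "form E (T k) w w * s k \<le> (ev * D k * w k)\<^sup>2" by simp
      then have "form E (T k) w w \<le> (ev * D k * w k)\<^sup>2 / s k"
        using True by (simp add: E'_def pos_le_divide_eq)
      then have "v k * form E (T k) w w \<le> v k * ((ev * D k * w k)\<^sup>2 / s k)"
        using vpos[OF k] by (intro mult_left_mono) auto
      also have "\<dots> = ev\<^sup>2 * (D k * (w k)\<^sup>2)"
        using True vpos[OF k] by (simp add: E'_def D_def power2_eq_square)
      finally show ?thesis using True by simp
    next
      case False
      have "T k i j = 0" if ij: "i \<in> E" "j \<in> E" for i j
      proof -
        have "(\<Sum>i\<in>E. v i * T i k j) = 0" using off[of k j] H[of k j] False k ij by auto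
        then have "\<forall>i\<in>E. v i * T i k j = 0"
          using k ij by (subst (asm) sum_nonneg_eq_0_iff[OF fin])
            (auto intro!: mult_nonneg_nonneg Tnn less_imp_le[OF vpos])
        then have "T i k j = 0" using ij vpos[OF ij(1)] by fastforce
        then show ?thesis using Tsym1[of k i j] k ij by simp
      qed
      then have "form E (T k) w w = 0" by (simp add: form_def)
      then show ?thesis using False by simp
    qed
    then have "form E H w w \<le> (\<Sum>k\<in>E. if k \<in> E' then ev\<^sup>2 * (D k * (w k)\<^sup>2) else 0)"
      unfolding formH by (rule sum_mono)
    also have "\<dots> = (\<Sum>k\<in>E'. ev\<^sup>2 * (D k * (w k)\<^sup>2))"
      using fin E'sub by (intro sum.mono_neutral_cong_right) auto
    also have "\<dots> = ev\<^sup>2 * N" by (simp add: N_def sum_distrib_left)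
    finally have "ev * N \<le> ev\<^sup>2 * N" using wf by simp
    then have ev1: "ev \<ge> 1" using Npos ev by (simp add: power2_eq_square)
    \<comment> \<open>A weighted Dirichlet form, equal to 2 (1 - ev) N because v has eigenvalue 1
      and w has eigenvalue ev. It is nonnegative while ev >= 1, so every summand is zero and w/v is
      constant along each pair with H i j > 0.\<close>
    have sq: "(\<Sum>i\<in>E'. \<Sum>j\<in>E'. H i j * v i * v j * (w i / v i - w j / v j)\<^sup>2) = 2 * N - 2 * (ev * N)"
    proof -
      have 1: "(\<Sum>i\<in>E'. \<Sum>j\<in>E'. H i j * v j * ((w i)\<^sup>2 / v i)) = N"
      proof -
        have "(\<Sum>i\<in>E'. \<Sum>j\<in>E'. H i j * v j * ((w i)\<^sup>2 / v i)) = (\<Sum>i\<in>E'. (\<Sum>j\<in>E'. H i j * v j) * ((w i)\<^sup>2 / v i))"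
          by (simp only: sum_distrib_right)
        also have "\<dots> = (\<Sum>i\<in>E'. D i * (w i)\<^sup>2)"
        proof (rule sum.cong[OF refl])
          fix i assume i: "i \<in> E'"
          then show "(\<Sum>j\<in>E'. H i j * v j) * ((w i)\<^sup>2 / v i) = D i * (w i)\<^sup>2"
            unfolding eig[OF i] using vpos[of i] E'sub by auto
        qed
        finally show ?thesis by (simp add: N_def)
      qed
      have "(\<Sum>i\<in>E'. \<Sum>j\<in>E'. H i j * v i * ((w j)\<^sup>2 / v j)) = (\<Sum>j\<in>E'. \<Sum>i\<in>E'. H i j * v i * ((w j)\<^sup>2 / v j))"
        by (rule sum.swap)
      also have "\<dots> = (\<Sum>j\<in>E'. \<Sum>i\<in>E'. H j i * v i * ((w j)\<^sup>2 / v j))"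
        using Hsym E'sub by (intro sum.cong refl) (metis subsetD)
      also have "\<dots> = N" by (rule 1)
      finally have 2: "(\<Sum>i\<in>E'. \<Sum>j\<in>E'. H i j * v i * ((w j)\<^sup>2 / v j)) = N" .
      have "H i j * v i * v j * (w i / v i - w j / v j)\<^sup>2 =
          H i j * v j * ((w i)\<^sup>2 / v i) + H i j * v i * ((w j)\<^sup>2 / v j) - 2 * (H i j * w i * w j)"
        if "i \<in> E'" "j \<in> E'" for i j
      proof -
        have "v i \<noteq> 0" "v j \<noteq> 0" using that vpos E'sub by force+
        then show ?thesis by (simp add: power2_eq_square field_simps)
      qed
      then have "(\<Sum>i\<in>E'. \<Sum>j\<in>E'. H i j * v i * v j * (w i / v i - w j / v j)\<^sup>2) =
         (\<Sum>i\<in>E'. \<Sum>j\<in>E'. H i j * v j * ((w i)\<^sup>2 / v i) + H i j * v i * ((w j)\<^sup>2 / v j) - 2 * (H i j * w i * w j))"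
        by (intro sum.cong) auto
      also have "\<dots> = N + N - 2 * form E' H w w"
        unfolding sum.distrib sum_subtractf 1 2 form_def by (simp only: sum_distrib_left)
      finally show ?thesis using wf restrf[of w] by simp
    qed
    have nn: "H i j * v i * v j * (w i / v i - w j / v j)\<^sup>2 \<ge> 0" if "i \<in> E'" "j \<in> E'" for i j
      using that Hnn vpos E'sub by (intro mult_nonneg_nonneg) (auto simp: less_imp_le subset_iff)
    have "2 * N - 2 * (ev * N) \<le> 0" using ev1 Npos by simp
    then have "(\<Sum>i\<in>E'. \<Sum>j\<in>E'. H i j * v i * v j * (w i / v i - w j / v j)\<^sup>2) = 0"
      using sq sum_nonneg[of E' "\<lambda>i. \<Sum>j\<in>E'. H i j * v i * v j * (w i / v i - w j / v j)\<^sup>2"]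
        sum_nonneg[of E' "\<lambda>j. H _ j * v _ * v j * (w _ / v _ - w j / v j)\<^sup>2"] nn
      by (smt (verit) sum_nonneg)
    then have "\<forall>i\<in>E'. (\<Sum>j\<in>E'. H i j * v i * v j * (w i / v i - w j / v j)\<^sup>2) = 0"
      using nn by (subst (asm) sum_nonneg_eq_0_iff[OF finE']) (auto intro!: sum_nonneg)
    then have "\<forall>i\<in>E'. \<forall>j\<in>E'. H i j * v i * v j * (w i / v i - w j / v j)\<^sup>2 = 0"
      using nn by (simp add: sum_nonneg_eq_0_iff[OF finE'])
    then have edge: "w i / v i = w j / v j" if "i \<in> E'" "j \<in> E'" "H i j > 0" for i j
      using that vpos E'sub by (force simp: less_imp_neq[symmetric])
    have inE': "m \<in> E'" if "i \<in> E" "m \<in> E" "H i m > 0" for i m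
      using off'[of i m] that by force
    have nbr: "\<exists>p\<in>E. H i p > 0" if "i \<in> E'" for i
    proof (rule ccontr)
      assume "\<not> ?thesis"
      then have "H i p = 0" if "p \<in> E" for p using Hnn[of i p] that \<open>i \<in> E'\<close> E'sub by force
      then have "s i = 0" by (simp add: s_def)
      then show False using \<open>i \<in> E'\<close> by (simp add: E'_def)
    qed
    have all: "w i / v i = w j / v j" if ij: "i \<in> E'" "j \<in> E'" for i j
    proof -
      obtain p q where "p \<in> E" "q \<in> E" "H i p > 0" "H j q > 0" using nbr ij by blast
      then consider "i = j" | "H i j > 0" | m where "m \<in> E" "H i m > 0" "H m j > 0"
        using conn[of i j p q] ij E'sub by blast
      then show ?thesis
      proof cases
        case 3
        then have "m \<in> E'" using inE'[of i m] ij E'sub by auto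
        then show ?thesis using 3 edge ij by metis
      qed (use edge ij in auto)
    qed
    obtain i0 where i0: "i0 \<in> E'" "w i0 \<noteq> 0" using wne by blast
    define r where "r = w i0 / v i0"
    have wr: "w i = r * v i" if "i \<in> E'" for i
      using all[OF that i0(1)] vpos[of i] that E'sub by (auto simp: r_def field_simps)
    \<comment> \<open>Now w is a multiple of v on \<open>E'\<close>, yet it was chosen D-orthogonal
      to v; so the ratio r is 0.\<close>
    have "(\<Sum>i\<in>E'. D i * v i * w i) = r * (\<Sum>i\<in>E'. D i * (v i)\<^sup>2)"
      unfolding sum_distrib_left by (intro sum.cong) (auto simp: wr power2_eq_square)
    moreover have "(\<Sum>i\<in>E'. D i * (v i)\<^sup>2) > 0"
      using i0 finE' E'sub vpos Dpos by (intro sum_pos) (auto intro!: mult_pos_pos zero_less_power)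
    ultimately have "r = 0" using wperp by simp
    then show False using i0 wr by simp
  qed
  then have "index_le_one E H" unfolding index_le_one_def by (intro exI[of _ s]) blast
  then show ?thesis using hyperbolic_if_index_le_one[OF symH] Hnn by blast
qed

section \<open>Directional derivatives of multiaffine polynomials\<close>

text \<open>
  A function \<open>c\<close> on the subsets of \<open>E\<close> stands for the multiaffine polynomial with coefficient
  \<open>c T\<close> at \<open>\<Prod>\<^sub>i\<^sub>\<in>\<^sub>T x\<^sub>i\<close>, and \<open>set_deriv E v c\<close> for its directional derivative along \<open>v\<close>.
\<close>

definition set_deriv :: "'e set \<Rightarrow> ('e \<Rightarrow> real) \<Rightarrow> ('e set \<Rightarrow> real) \<Rightarrow> 'e set \<Rightarrow> real" where
  "set_deriv E v c T = (\<Sum>i\<in>E - T. v i * c (insert i T))"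

definition set_derivs :: "'e set \<Rightarrow> ('e \<Rightarrow> real) list \<Rightarrow> ('e set \<Rightarrow> real) \<Rightarrow> 'e set \<Rightarrow> real" where
  "set_derivs E vs c = foldr (set_deriv E) vs c"

text \<open>The Hessian at the origin; its diagonal is 0 because no variable occurs squared in a
  multiaffine polynomial.\<close>

definition pair_matrix :: "('e set \<Rightarrow> real) \<Rightarrow> 'e \<Rightarrow> 'e \<Rightarrow> real" where
  "pair_matrix c i j = (if i = j then 0 else c {i, j})"

text \<open>Lists of every length are allowed, so that no degree has to be tracked and further
  derivatives merely lengthen the list. For a homogeneous c at most one length gives a nonzero
  matrix.\<close>

definition alexandrov_fenchel :: "'e set \<Rightarrow> ('e set \<Rightarrow> real) \<Rightarrow> bool" where
  "alexandrov_fenchel E c \<longleftrightarrow>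
     (\<forall>vs. (\<forall>v\<in>set vs. \<forall>i\<in>E. v i \<ge> 0) \<longrightarrow> hyperbolic E (pair_matrix (set_derivs E vs c)))"

lemma set_derivs_Nil [simp]: "set_derivs E [] c = c"
  by (simp add: set_derivs_def)

lemma set_derivs_Cons [simp]: "set_derivs E (v # vs) c = set_deriv E v (set_derivs E vs c)"
  by (simp add: set_derivs_def)

lemma set_derivs_append: "set_derivs E (vs @ ws) c = set_derivs E vs (set_derivs E ws c)"
  by (simp add: set_derivs_def)

lemma set_deriv_commute:
  assumes "finite E"
  shows "set_deriv E v (set_deriv E w c) = set_deriv E w (set_deriv E v c)"
proof
  fix T
  have expand: "set_deriv E v (set_deriv E w c) T =
      (\<Sum>i\<in>E - T. \<Sum>j\<in>E - T. if i = j then 0 else v i * w j * c (insert i (insert j T)))" for v w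
  proof -
    have "v i * set_deriv E w c (insert i T) =
        (\<Sum>j\<in>E - T. if i = j then 0 else v i * w j * c (insert i (insert j T)))" for i
      unfolding set_deriv_def sum_distrib_left using assms
      by (intro sum.mono_neutral_cong_left) (auto simp: insert_commute mult_ac)
    then show ?thesis by (simp add: set_deriv_def)
  qed
  show "set_deriv E v (set_deriv E w c) T = set_deriv E w (set_deriv E v c) T"
    unfolding expand
    by (subst sum.swap) (auto intro!: sum.cong simp: insert_commute mult_ac)
qed

lemma set_derivs_set_deriv:
  "finite E \<Longrightarrow> set_derivs E vs (set_deriv E v c) = set_deriv E v (set_derivs E vs c)"
  by (induction vs) (simp_all add: set_deriv_commute[of E _ v])

definition unit_fun :: "'e \<Rightarrow> 'e \<Rightarrow> real" where
  "unit_fun k i = (if i = k then 1 else 0)"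

lemma set_deriv_unit_fun:
  assumes "finite E"
  shows "set_deriv E (unit_fun k) c T = (if k \<in> E - T then c (insert k T) else 0)"
proof -
  have "set_deriv E (unit_fun k) c T = (\<Sum>i\<in>E - T. if i = k then c (insert i T) else 0)"
    unfolding set_deriv_def unit_fun_def by (intro sum.cong) auto
  then show ?thesis using assms by auto
qed

lemma set_deriv_eq_sum_unit_fun:
  assumes "finite E"
  shows "set_deriv E v c T = (\<Sum>k\<in>E. v k * set_deriv E (unit_fun k) c T)"
  unfolding set_deriv_unit_fun[OF assms] unfolding set_deriv_def using assms
  by (intro sum.mono_neutral_cong_left) auto

lemma set_deriv_nonneg:
  "(\<And>i. i \<in> E \<Longrightarrow> v i \<ge> 0) \<Longrightarrow> (\<And>T. c T \<ge> 0) \<Longrightarrow> set_deriv E v c T \<ge> 0"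
  unfolding set_deriv_def by (intro sum_nonneg mult_nonneg_nonneg) auto

lemma set_derivs_nonneg:
  "(\<And>v i. v \<in> set vs \<Longrightarrow> i \<in> E \<Longrightarrow> v i \<ge> 0) \<Longrightarrow> (\<And>T. c T \<ge> 0) \<Longrightarrow> set_derivs E vs c T \<ge> 0"
  by (induction vs arbitrary: T) (auto intro!: set_deriv_nonneg)

text \<open>A chain of single insertions from T up to S contributes a positive product of weights
  times \<open>c S\<close>; every other term is nonnegative.\<close>

lemma set_derivs_pos:
  assumes "finite E" "\<And>T. c T \<ge> 0" "\<And>v i. v \<in> set vs \<Longrightarrow> i \<in> E \<Longrightarrow> v i > 0"
    and "T \<subseteq> S" "S \<subseteq> E" "card S = card T + length vs" "c S > 0"
  shows "set_derivs E vs c T > 0"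
  using assms
proof (induction vs arbitrary: T)
  case Nil
  then have "T = S" by (metis add_0_right card_subset_eq finite_subset list.size(3))
  then show ?case using Nil by simp
next
  case (Cons v vs)
  have fS: "finite S" using Cons.prems finite_subset by blast
  have fT: "finite T" using Cons.prems fS finite_subset by blast
  have "card T < card S" using Cons.prems by simp
  then obtain i where i: "i \<in> S" "i \<notin> T"
    by (metis card_mono fT leD subsetI)
  have "set_derivs E vs c (insert i T) > 0"
    using Cons.prems i fT by (intro Cons.IH) auto
  moreover have "set_derivs E vs c T' \<ge> 0" for T'
    using Cons.prems by (intro set_derivs_nonneg) (auto simp: less_imp_le)
  ultimately show ?case
    unfolding set_derivs_Cons set_deriv_def using Cons.prems i
    by (intro sum_pos2[of "E - T" i]) (auto simp: less_imp_le subset_iff intro!: mult_nonneg_nonneg)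
qed

lemma set_derivs_nonzero:
  assumes "finite E" "T \<subseteq> E" "set_derivs E vs c T \<noteq> 0"
  shows "\<exists>S. T \<subseteq> S \<and> S \<subseteq> E \<and> card S = card T + length vs \<and> c S \<noteq> 0"
  using assms
proof (induction vs arbitrary: T)
  case (Cons v vs)
  then obtain i where i: "i \<in> E" "i \<notin> T" "set_derivs E vs c (insert i T) \<noteq> 0"
    unfolding set_derivs_Cons set_deriv_def
    by (metis (no_types, lifting) DiffE mult_zero_right sum.neutral)
  then obtain S where "insert i T \<subseteq> S" "S \<subseteq> E" "card S = card (insert i T) + length vs" "c S \<noteq> 0"
    using Cons.IH[of "insert i T"] Cons.prems by auto
  moreover have "card (insert i T) = Suc (card T)"
    using i Cons.prems finite_subset by (metis card_insert_disjoint)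
  ultimately show ?case by (intro exI[of _ S]) auto
qed auto

lemma set_derivs_continuous:
  fixes fs :: "(real \<Rightarrow> 'e \<Rightarrow> real) list"
  assumes "\<And>f i. f \<in> set fs \<Longrightarrow> continuous_on A (\<lambda>t. f t i)"
  shows "continuous_on A (\<lambda>t. set_derivs E (map (\<lambda>f. f t) fs) c T)"
  using assms
  by (induction fs arbitrary: T) (auto simp: set_deriv_def intro!: continuous_intros)

text \<open>Supplies the connectivity hypothesis of \<open>local_to_global\<close>: two elements
  that occur in bases share a basis or have a common neighbour. Exchanging elements of T' - T other
  than j moves T' towards T. If only j is left, T and T' have d - 1 >= 1 elements in common, and any
  of them is the neighbour.\<close>

lemma exchange_path:
  assumes exch: "\<And>T T' i. B T \<Longrightarrow> B T' \<Longrightarrow> i \<in> T \<Longrightarrow> i \<notin> T' \<Longrightarrow> \<exists>j. j \<in> T' \<and> j \<notin> T \<and> B (insert j (T - {i}))"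
    and B: "\<And>T. B T \<Longrightarrow> finite T \<and> card T = d" and d: "d \<ge> 2"
    and "B T" "B T'" "i \<in> T" "j \<in> T'" "i \<noteq> j"
  shows "(\<exists>S. B S \<and> i \<in> S \<and> j \<in> S) \<or>
    (\<exists>m S S'. m \<noteq> i \<and> m \<noteq> j \<and> B S \<and> i \<in> S \<and> m \<in> S \<and> B S' \<and> m \<in> S' \<and> j \<in> S')"
  using assms(4-)
proof (induction "card (T' - T)" arbitrary: T' rule: less_induct)
  case less
  note fT = B[OF \<open>B T\<close>] and fT' = B[OF \<open>B T'\<close>]
  consider "j \<in> T" | "i \<in> T'" | "j \<notin> T" "i \<notin> T'" "T' - T = {j}" | m where "i \<notin> T'" "j \<notin> T" "m \<in> T' - T" "m \<noteq> j"
    using less.prems by blast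
  then show ?case
  proof cases
    case 3
    have "card (T - T') = card (T' - T)"
      using fT fT' by (metis card_le_sym_Diff le_antisym order_refl)
    then have "card (T - T') = 1" using 3 by simp
    then have TT: "T - T' = {i}" using less.prems 3 by (metis Diff_iff card_1_singletonE singletonD)
    have "card (T \<inter> T') + card (T - T') = card T"
      using fT by (metis add.commute card_Diff_subset_Int card_mono finite_Int inf_le1 le_add_diff_inverse2)
    then have "T \<inter> T' \<noteq> {}" using TT d fT by auto
    then obtain m where "m \<in> T" "m \<in> T'" by blast
    then show ?thesis using 3 less.prems by metis
  next
    case 4
    obtain m' where m': "m' \<in> T" "m' \<notin> T'" "B (insert m' (T' - {m}))"
      using exch[of T' T m] less.prems 4 by blast
    have "insert m' (T' - {m}) - T = (T' - T) - {m}" using m' by blast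
    then have "card (insert m' (T' - {m}) - T) < card (T' - T)"
      using 4 fT' by (metis card_Diff1_less finite_Diff)
    then show ?thesis using less.hyps[OF _ \<open>B T\<close> m'(3) \<open>i \<in> T\<close>] 4 less.prems by auto
  qed (use less.prems in blast)+
qed

text \<open>The combinatorial description of a multiaffine Lorentzian polynomial: nonnegative
  coefficients, a support that is empty or the bases of a matroid of rank d, and hyperbolic
  quadratic derivatives along coordinate directions only. Such derivatives are what the Hessians of
  the dual control.\<close>

definition locally_hyperbolic :: "'e set \<Rightarrow> nat \<Rightarrow> ('e set \<Rightarrow> real) \<Rightarrow> bool" where
  "locally_hyperbolic E d c \<longleftrightarrow>
     (\<forall>T. c T \<ge> 0) \<and>
     (\<forall>T. c T \<noteq> 0 \<longrightarrow> T \<subseteq> E \<and> card T = d) \<and>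
     (\<forall>T T' i. c T \<noteq> 0 \<longrightarrow> c T' \<noteq> 0 \<longrightarrow> i \<in> T - T' \<longrightarrow> (\<exists>j\<in>T' - T. c (insert j (T - {i})) \<noteq> 0)) \<and>
     (\<forall>A\<subseteq>E. card A + 2 = d \<longrightarrow>
        hyperbolic E (\<lambda>i j. if i = j \<or> i \<in> A \<or> j \<in> A then 0 else c (A \<union> {i, j})))"

lemma locally_hyperbolicD:
  assumes "locally_hyperbolic E d c"
  shows "c T \<ge> 0"
    and "c T \<noteq> 0 \<Longrightarrow> T \<subseteq> E" and "c T \<noteq> 0 \<Longrightarrow> card T = d"
    and "c T \<noteq> 0 \<Longrightarrow> c T' \<noteq> 0 \<Longrightarrow> i \<in> T \<Longrightarrow> i \<notin> T' \<Longrightarrow> \<exists>j. j \<in> T' \<and> j \<notin> T \<and> c (insert j (T - {i})) \<noteq> 0"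
    and "A \<subseteq> E \<Longrightarrow> card A + 2 = d \<Longrightarrow>
      hyperbolic E (\<lambda>i j. if i = j \<or> i \<in> A \<or> j \<in> A then 0 else c (A \<union> {i, j}))"
proof -
  note c = assms[unfolded locally_hyperbolic_def]
  show "c T \<ge> 0" using c[THEN conjunct1] by (rule spec)
  show "T \<subseteq> E" "card T = d" if "c T \<noteq> 0"
    using c[THEN conjunct2, THEN conjunct1, rule_format, OF that] by simp_all
  show "\<exists>j. j \<in> T' \<and> j \<notin> T \<and> c (insert j (T - {i})) \<noteq> 0" if "c T \<noteq> 0" "c T' \<noteq> 0" "i \<in> T" "i \<notin> T'"
    using c[THEN conjunct2, THEN conjunct2, THEN conjunct1, rule_format, OF that(1,2), of i] that(3,4) by auto
  show "hyperbolic E (\<lambda>i j. if i = j \<or> i \<in> A \<or> j \<in> A then 0 else c (A \<union> {i, j}))"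
    if "A \<subseteq> E" "card A + 2 = d"
    using c[THEN conjunct2, THEN conjunct2, THEN conjunct2, rule_format, OF that] .
qed

lemma hyperbolic_zero: "(\<And>i j. i \<in> E \<Longrightarrow> j \<in> E \<Longrightarrow> H i j = 0) \<Longrightarrow> hyperbolic E H"
  by (simp add: hyperbolic_def form_def)

lemma hyperbolic_cong:
  assumes "\<And>i j. i \<in> E \<Longrightarrow> j \<in> E \<Longrightarrow> H i j = H' i j"
  shows "hyperbolic E H \<longleftrightarrow> hyperbolic E H'"
  unfolding hyperbolic_def form_def using assms by simp

text \<open>On supports this is contraction at k. The quadratic derivative along A of the contracted
  polynomial is that of c along \<open>insert k A\<close>, and it is zero if A contains k.\<close>

lemma locally_hyperbolic_unit_deriv:
  assumes fin: "finite E" and k: "k \<in> E" and c: "locally_hyperbolic E (Suc d) c"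
  shows "locally_hyperbolic E d (set_deriv E (unit_fun k) c)"
proof -
  let ?c = "set_deriv E (unit_fun k) c"
  have cT: "?c T = (if k \<in> T then 0 else c (insert k T))" for T
    using set_deriv_unit_fun[OF fin] k by simp
  note supp = locally_hyperbolicD(2,3)[OF c] and exch = locally_hyperbolicD(4)[OF c]
  show ?thesis unfolding locally_hyperbolic_def
  proof (intro conjI allI impI)
    show "?c T \<ge> 0" for T using locally_hyperbolicD(1)[OF c] by (simp add: cT)
    fix T assume T: "?c T \<noteq> 0"
    then have "k \<notin> T" "c (insert k T) \<noteq> 0" by (auto simp: cT split: if_splits)
    then show "T \<subseteq> E" "card T = d"
      using supp[of "insert k T"] fin finite_subset[of "insert k T" E] by auto
  next
    fix T T' i assume *: "?c T \<noteq> 0" "?c T' \<noteq> 0" "i \<in> T - T'"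
    then have k': "k \<notin> T" "k \<notin> T'" "c (insert k T) \<noteq> 0" "c (insert k T') \<noteq> 0"
      by (auto simp: cT split: if_splits)
    then obtain j where j: "j \<in> insert k T'" "j \<notin> insert k T" "c (insert j (insert k T - {i})) \<noteq> 0"
      using exch[of "insert k T" "insert k T'" i] * by blast
    moreover have "insert j (insert k T - {i}) = insert k (insert j (T - {i}))"
      using * k' by blast
    ultimately show "\<exists>j\<in>T' - T. ?c (insert j (T - {i})) \<noteq> 0"
      using k' by (intro bexI[of _ j]) (auto simp: cT)
  next
    fix A assume A: "A \<subseteq> E" "card A + 2 = d"
    show "hyperbolic E (\<lambda>i j. if i = j \<or> i \<in> A \<or> j \<in> A then 0 else ?c (A \<union> {i, j}))"
    proof (cases "k \<in> A")
      case True
      then show ?thesis by (intro hyperbolic_zero) (simp add: cT)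
    next
      case False
      have "card (insert k A) + 2 = Suc d" using A False fin finite_subset by fastforce
      then have "hyperbolic E (\<lambda>i j. if i = j \<or> i \<in> insert k A \<or> j \<in> insert k A then 0 else c (insert k A \<union> {i, j}))"
        using A k by (intro locally_hyperbolicD(5)[OF c]) auto
      then show ?thesis
        by (rule hyperbolic_cong[THEN iffD1, rotated]) (use False in \<open>auto simp: cT insert_commute\<close>)
    qed
  qed
qed

text \<open>Induction on the number of directions. In \<open>local_to_global\<close> the slice
  \<open>T k\<close> is the Hessian left by a derivative along k and the remaining directions, hence
  hyperbolic by the induction hypothesis for a polynomial of one degree less. Strict positivity of
  the directions makes an entry positive exactly when its two distinct indices lie in a common
  support set, so \<open>exchange_path\<close> yields the connectivity.\<close>

lemma hyperbolic_pair_matrix_pos: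
  assumes fin: "finite E" and "locally_hyperbolic E (length vs + 2) c"
    and "\<And>v i. v \<in> set vs \<Longrightarrow> i \<in> E \<Longrightarrow> v i > 0"
  shows "hyperbolic E (pair_matrix (set_derivs E vs c))"
  using assms(2-)
proof (induction vs arbitrary: c)
  case Nil
  then have "hyperbolic E (\<lambda>i j. if i = j \<or> i \<in> {} \<or> j \<in> {} then 0 else c ({} \<union> {i, j}))"
    by (intro locally_hyperbolicD(5)) auto
  then show ?case by (rule hyperbolic_cong[THEN iffD1, rotated]) (auto simp: pair_matrix_def)
next
  case (Cons v vs)
  define g where "g = set_derivs E vs c"
  define T where "T k = pair_matrix (set_deriv E (unit_fun k) g)" for k
  have cnn: "c S \<ge> 0" for S using Cons.prems(1) by (simp add: locally_hyperbolic_def)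
  have csupp: "S \<subseteq> E \<and> finite S \<and> card S = length vs + 3" if "c S \<noteq> 0" for S
    using locally_hyperbolicD(2,3)[OF Cons.prems(1) that] fin finite_subset by auto
  have gnn: "g S \<ge> 0" for S
    unfolding g_def using Cons.prems cnn by (intro set_derivs_nonneg) (auto simp: less_imp_le)
  have T: "T k i j = (if i = j \<or> k = i \<or> k = j then 0 else g {i, j, k})" if "k \<in> E" for i j k
    unfolding T_def pair_matrix_def set_deriv_unit_fun[OF fin] using that by (auto simp: insert_commute)
  have hypT: "hyperbolic E (T k)" if k: "k \<in> E" for k
  proof -
    have "locally_hyperbolic E (length vs + 2) (set_deriv E (unit_fun k) c)"
      using locally_hyperbolic_unit_deriv[OF fin k] Cons.prems(1) by simp
    then have "hyperbolic E (pair_matrix (set_derivs E vs (set_deriv E (unit_fun k) c)))"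
      using Cons.prems by (intro Cons.IH) auto
    then show ?thesis by (simp add: T_def g_def set_derivs_set_deriv[OF fin])
  qed
  have HT: "pair_matrix (set_deriv E v g) i j = (\<Sum>k\<in>E. v k * T k i j)" for i j
    unfolding T_def pair_matrix_def by (simp add: set_deriv_eq_sum_unit_fun[OF fin, of v])
  have pos_iff: "set_derivs E (v # vs) c S > 0 \<longleftrightarrow> (\<exists>S'. S \<subseteq> S' \<and> c S' \<noteq> 0)" if S: "S \<subseteq> E" "card S = 2" for S
  proof
    assume "set_derivs E (v # vs) c S > 0"
    then show "\<exists>S'. S \<subseteq> S' \<and> c S' \<noteq> 0" using set_derivs_nonzero[OF fin S(1), of "v # vs" c] by auto
  next
    assume "\<exists>S'. S \<subseteq> S' \<and> c S' \<noteq> 0"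
    then obtain S' where S': "S \<subseteq> S'" "c S' \<noteq> 0" by blast
    then show "set_derivs E (v # vs) c S > 0"
      using csupp[OF S'(2)] S cnn[of S'] Cons.prems by (intro set_derivs_pos[OF fin cnn, of _ _ S']) auto
  qed
  have Hpos_iff: "pair_matrix (set_deriv E v g) i j > 0 \<longleftrightarrow> i \<noteq> j \<and> (\<exists>S. i \<in> S \<and> j \<in> S \<and> c S \<noteq> 0)"
    if "i \<in> E" "j \<in> E" for i j
    using pos_iff[of "{i, j}"] that by (auto simp: pair_matrix_def g_def)
  have "hyperbolic E (pair_matrix (set_deriv E v g))"
  proof (rule local_to_global[OF fin, where T = T and v = v])
    show "T i j k \<ge> 0" if "i \<in> E" "j \<in> E" "k \<in> E" for i j k using T gnn that by simp
    show "T i j k = T j i k" "T i j k = T i k j" if "i \<in> E" "j \<in> E" "k \<in> E" for i j k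
      using T that by (auto simp: insert_commute)
    show "v i > 0" if "i \<in> E" for i using Cons.prems that by simp
    show "hyperbolic E (T k)" if "k \<in> E" for k using hypT that .
    show "pair_matrix (set_deriv E v g) i j = (\<Sum>k\<in>E. v k * T k i j)" for i j by (rule HT)
    fix i j p q
    assume E: "i \<in> E" "j \<in> E" "p \<in> E" "q \<in> E"
      and p: "pair_matrix (set_deriv E v g) i p > 0" and q: "pair_matrix (set_deriv E v g) j q > 0"
    obtain S where S1: "c S \<noteq> 0" "i \<in> S" using p unfolding Hpos_iff[OF E(1,3)] by blast
    obtain S' where S2: "c S' \<noteq> 0" "j \<in> S'" using q unfolding Hpos_iff[OF E(2,4)] by blast
    note S = S1 S2
    have "i = j \<or> (\<exists>S. c S \<noteq> 0 \<and> i \<in> S \<and> j \<in> S) \<or>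
      (\<exists>m S S'. m \<noteq> i \<and> m \<noteq> j \<and> c S \<noteq> 0 \<and> i \<in> S \<and> m \<in> S \<and> c S' \<noteq> 0 \<and> m \<in> S' \<and> j \<in> S')"
    proof (cases "i = j")
      case False
      show ?thesis
      proof (rule disjI2, rule exchange_path[where B = "\<lambda>S. c S \<noteq> 0" and d = "length vs + 3"])
        show "\<exists>k. k \<in> R' \<and> k \<notin> R \<and> c (insert k (R - {h})) \<noteq> 0"
          if "c R \<noteq> 0" "c R' \<noteq> 0" "h \<in> R" "h \<notin> R'" for R R' h
          using locally_hyperbolicD(4)[OF Cons.prems(1) that] .
        show "finite R \<and> card R = length vs + 3" if "c R \<noteq> 0" for R
          using csupp[OF that] by simp
      qed (use S False in simp_all)
    qed simp
    then show "i = j \<or> pair_matrix (set_deriv E v g) i j > 0 \<or>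
        (\<exists>m\<in>E. pair_matrix (set_deriv E v g) i m > 0 \<and> pair_matrix (set_deriv E v g) m j > 0)"
    proof (elim disjE exE conjE)
      fix m S S'
      assume *: "m \<noteq> i" "m \<noteq> j" "c S \<noteq> 0" "i \<in> S" "m \<in> S" "c S' \<noteq> 0" "m \<in> S'" "j \<in> S'"
      then have m: "m \<in> E" using csupp[of S] by blast
      have "pair_matrix (set_deriv E v g) i m > 0" "pair_matrix (set_deriv E v g) m j > 0"
        unfolding Hpos_iff[OF E(1) m] Hpos_iff[OF m E(2)] using * by blast+
      then show ?thesis using m by blast
    next
      fix S assume "c S \<noteq> 0" "i \<in> S" "j \<in> S"
      then show ?thesis using Hpos_iff[OF E(1,2)] by blast
    qed simp
  qed
  then show ?case by (simp add: g_def)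
qed

text \<open>Adding t > 0 to every coordinate of every direction makes the directions strictly
  positive, and the inequality survives t tending to 0 by continuity. If the number of directions
  does not match the degree, the matrix is zero.\<close>

theorem alexandrov_fenchel_if_locally_hyperbolic:
  assumes fin: "finite E" and c: "locally_hyperbolic E d c"
  shows "alexandrov_fenchel E c"
  unfolding alexandrov_fenchel_def
proof (intro allI impI)
  fix vs :: "('a \<Rightarrow> real) list" assume vs: "\<forall>v\<in>set vs. \<forall>i\<in>E. v i \<ge> 0"
  show "hyperbolic E (pair_matrix (set_derivs E vs c))"
  proof (cases "d = length vs + 2")
    case True
    let ?fs = "map (\<lambda>v t i. v i + t) vs"
    define H where "H t = pair_matrix (set_derivs E (map (\<lambda>f. f t) ?fs) c)" for t
    have cont: "continuous_on UNIV (\<lambda>t. form E (H t) x y)" for x y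
    proof -
      have "continuous_on UNIV (\<lambda>t. set_derivs E (map (\<lambda>f. f t) ?fs) c T)" for T
        by (intro set_derivs_continuous) (auto intro!: continuous_intros)
      then have "continuous_on UNIV (\<lambda>t. H t i j)" for i j
        unfolding H_def pair_matrix_def by (cases "i = j") simp_all
      then show ?thesis unfolding form_def by (intro continuous_intros)
    qed
    have lim: "((\<lambda>t. form E (H t) x y) \<longlongrightarrow> form E (H 0) x y) (at_right 0)" for x y
      using cont[of x y] by (simp add: continuous_on_eq_continuous_at continuous_at filterlim_at_split)
    have "hyperbolic E (H t)" if "t > 0" for t
      unfolding H_def using vs c that True
      by (intro hyperbolic_pair_matrix_pos[OF fin]) (auto simp: add_nonneg_pos)
    then have ev: "eventually (\<lambda>t. hyperbolic E (H t)) (at_right 0)"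
      by (simp add: eventually_at_right_less eventually_mono[OF eventually_at_right_less])
    have "hyperbolic E (H 0)"
      unfolding hyperbolic_def
    proof (intro allI impI)
      fix x y :: "'a \<Rightarrow> real" assume y: "\<forall>i\<in>E. y i \<ge> 0"
      have l1: "((\<lambda>t. form E (H t) x x * form E (H t) y y) \<longlongrightarrow> form E (H 0) x x * form E (H 0) y y) (at_right 0)"
        and l2: "((\<lambda>t. (form E (H t) x y)\<^sup>2) \<longlongrightarrow> (form E (H 0) x y)\<^sup>2) (at_right 0)"
        by (intro tendsto_intros lim)+
      show "form E (H 0) x x * form E (H 0) y y \<le> (form E (H 0) x y)\<^sup>2"
        by (rule tendsto_le[OF _ l2 l1]) (use ev y in \<open>auto elim!: eventually_mono simp: hyperbolic_def\<close>)
    qed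
    then show ?thesis by (simp add: H_def comp_def)
  next
    case False
    show ?thesis
    proof (rule hyperbolic_zero, rule ccontr)
      fix i j assume ij: "i \<in> E" "j \<in> E" and "pair_matrix (set_derivs E vs c) i j \<noteq> 0"
      then have "i \<noteq> j" "set_derivs E vs c {i, j} \<noteq> 0" by (auto simp: pair_matrix_def split: if_splits)
      then obtain S where "card S = card {i, j} + length vs" "c S \<noteq> 0"
        using set_derivs_nonzero[OF fin, of "{i, j}" vs c] ij by auto
      then show False using c False \<open>i \<noteq> j\<close> by (auto simp: locally_hyperbolic_def)
    qed
  qed
qed

lemma form_pair_matrix:
  assumes "finite E"
  shows "form E (pair_matrix c) x y = set_derivs E [x, y] c {}"
proof -
  have "x i * set_deriv E y c {i} = (\<Sum>j\<in>E. pair_matrix c i j * x i * y j)" for i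
    unfolding set_deriv_def sum_distrib_left pair_matrix_def using assms
    by (intro sum.mono_neutral_cong_left) (auto simp: insert_commute)
  then show ?thesis by (simp add: form_def set_deriv_def[of E x])
qed

lemma alexandrov_fenchel_ineq:
  assumes "finite E" "alexandrov_fenchel E c"
    and "\<And>v i. v \<in> set vs \<Longrightarrow> i \<in> E \<Longrightarrow> v i \<ge> 0" "\<And>i. i \<in> E \<Longrightarrow> y i \<ge> 0"
  shows "set_derivs E (x # x # vs) c {} * set_derivs E (y # y # vs) c {} \<le> (set_derivs E (x # y # vs) c {})\<^sup>2"
proof -
  have "hyperbolic E (pair_matrix (set_derivs E vs c))"
    using assms(2,3) by (auto simp: alexandrov_fenchel_def)
  then show ?thesis
    using assms(4) unfolding hyperbolic_def form_pair_matrix[OF assms(1)] by simp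
qed

section \<open>Splitting the exponents into slots\<close>

definition inc :: "'w \<Rightarrow> ('w \<Rightarrow> nat) \<Rightarrow> 'w \<Rightarrow> nat" where
  "inc u \<alpha> = \<alpha>(u := Suc (\<alpha> u))"

definition dec :: "'w \<Rightarrow> ('w \<Rightarrow> nat) \<Rightarrow> 'w \<Rightarrow> nat" where
  "dec u \<alpha> = \<alpha>(u := \<alpha> u - 1)"

definition type_count :: "('e \<Rightarrow> 'w) \<Rightarrow> 'e set \<Rightarrow> 'w \<Rightarrow> nat" where
  "type_count \<tau> S u = card {p \<in> S. \<tau> p = u}"

text \<open>Expands the product over p in S of the operators sum_{u in L p} d_u: a choice function
  \<open>w\<close> picks one variable for each slot, and \<open>type_count w S\<close> is the
  resulting exponent. The offset \<alpha> lets slots be peeled off one at a time.\<close>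

definition slot_sum :: "('e \<Rightarrow> 'w set) \<Rightarrow> (('w \<Rightarrow> nat) \<Rightarrow> real) \<Rightarrow> 'e set \<Rightarrow> ('w \<Rightarrow> nat) \<Rightarrow> real" where
  "slot_sum L \<phi> S \<alpha> = (\<Sum>w\<in>PiE S L. \<phi> (\<lambda>u. \<alpha> u + type_count w S u))"

text \<open>
  The slots outside \<open>T\<close> are differentiated, a slot \<open>p\<close> along the sum of the directions in \<open>L p\<close>;
  \<open>\<phi> \<alpha>\<close> is the derivative with exponent \<open>\<alpha>\<close>.
\<close>

definition slot_poly :: "'e set \<Rightarrow> ('e \<Rightarrow> 'w set) \<Rightarrow> (('w \<Rightarrow> nat) \<Rightarrow> real) \<Rightarrow> 'e set \<Rightarrow> real" where
  "slot_poly E L \<phi> T = (if T \<subseteq> E then slot_sum L \<phi> (E - T) (\<lambda>_. 0) else 0)"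

lemma type_count_insert:
  assumes "finite S" "p \<notin> S"
  shows "type_count \<tau> (insert p S) = inc (\<tau> p) (type_count \<tau> S)"
proof
  fix u
  have "{x \<in> insert p S. \<tau> x = u} = (if \<tau> p = u then insert p {x \<in> S. \<tau> x = u} else {x \<in> S. \<tau> x = u})"
    by auto
  then show "type_count \<tau> (insert p S) u = inc (\<tau> p) (type_count \<tau> S) u"
    using assms by (auto simp: type_count_def inc_def)
qed

lemma type_count_remove:
  assumes "finite S" "p \<in> S"
  shows "type_count \<tau> (S - {p}) = dec (\<tau> p) (type_count \<tau> S)"
  using type_count_insert[of "S - {p}" p \<tau>] assms
  by (auto simp: insert_absorb inc_def dec_def fun_eq_iff)

lemma type_count_cong: "(\<And>p. p \<in> S \<Longrightarrow> \<tau> p = \<tau>' p) \<Longrightarrow> type_count \<tau> S = type_count \<tau>' S"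
  unfolding type_count_def by (intro ext arg_cong[where f = card]) auto

lemma sum_type_count:
  fixes \<tau> :: "'e \<Rightarrow> 'w::finite"
  assumes "finite S"
  shows "(\<Sum>u\<in>UNIV. type_count \<tau> S u) = card S"
  unfolding type_count_def card_eq_sum
  using sum.group[OF assms finite_class.finite_UNIV, of \<tau> "\<lambda>_. 1::nat"] by simp

lemma slot_sum_empty [simp]: "slot_sum L \<phi> {} \<alpha> = \<phi> \<alpha>"
  by (simp add: slot_sum_def type_count_def)

lemma slot_sum_insert:
  assumes "finite S" "p \<notin> S"
  shows "slot_sum L \<phi> (insert p S) \<alpha> = (\<Sum>u\<in>L p. slot_sum L \<phi> S (inc u \<alpha>))"
proof -
  have "slot_sum L \<phi> (insert p S) \<alpha> =
      (\<Sum>(u, g)\<in>L p \<times> PiE S L. \<phi> (\<lambda>x. \<alpha> x + type_count (g(p := u)) (insert p S) x))"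
    unfolding slot_sum_def PiE_insert_eq using inj_combinator[OF assms(2)]
    by (subst sum.reindex) (auto simp: case_prod_beta)
  also have "\<dots> = (\<Sum>u\<in>L p. \<Sum>g\<in>PiE S L. \<phi> (\<lambda>x. \<alpha> x + type_count (g(p := u)) (insert p S) x))"
    by (rule sum.cartesian_product[symmetric])
  also have "\<dots> = (\<Sum>u\<in>L p. slot_sum L \<phi> S (inc u \<alpha>))"
    unfolding slot_sum_def
  proof (intro sum.cong refl arg_cong[of _ _ \<phi>])
    fix u :: 'b and g :: "'a \<Rightarrow> 'b"
    have "type_count (g(p := u)) S = type_count g S"
      using assms by (intro type_count_cong) auto
    then show "(\<lambda>x. \<alpha> x + type_count (g(p := u)) (insert p S) x) = (\<lambda>x. inc u \<alpha> x + type_count g S x)"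
      using type_count_insert[OF assms, of "g(p := u)"] by (auto simp: inc_def)
  qed
  finally show ?thesis .
qed

lemma slot_sum_cong:
  assumes "\<And>p. p \<in> S \<Longrightarrow> L p = L' p"
  shows "slot_sum L \<phi> S \<alpha> = slot_sum L' \<phi> S \<alpha>"
proof -
  have "PiE S L = PiE S L'" using assms by (rule PiE_cong)
  then show ?thesis by (simp add: slot_sum_def)
qed

lemma slot_sum_singletons:
  assumes "finite S"
  shows "slot_sum (\<lambda>p. {\<tau> p}) \<phi> S \<alpha> = \<phi> (\<lambda>u. \<alpha> u + type_count \<tau> S u)"
  using assms
proof (induction S arbitrary: \<alpha>)
  case empty
  then show ?case by (simp add: type_count_def)
next
  case (insert p S)
  then show ?case
    by (auto simp: slot_sum_insert type_count_insert inc_def intro!: arg_cong[where f = \<phi>])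
qed

section \<open>Restricting, merging and splitting slots\<close>

lemma set_derivs_restrict:
  assumes "finite E" "E' \<subseteq> E" "\<And>T. T \<subseteq> E' \<Longrightarrow> c' T = c T" "T \<subseteq> E'"
  shows "set_derivs E' vs c' T = set_derivs E (map (\<lambda>v i. if i \<in> E' then v i else 0) vs) c T"
  using assms(4)
proof (induction vs arbitrary: T)
  case (Cons v vs)
  have "set_deriv E' v (set_derivs E' vs c') T =
      (\<Sum>i\<in>E' - T. v i * set_derivs E (map (\<lambda>v i. if i \<in> E' then v i else 0) vs) c (insert i T))"
    unfolding set_deriv_def using Cons by (intro sum.cong) auto
  also have "\<dots> = set_deriv E (\<lambda>i. if i \<in> E' then v i else 0)
      (set_derivs E (map (\<lambda>v i. if i \<in> E' then v i else 0) vs) c) T"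
    unfolding set_deriv_def using assms(1,2) by (intro sum.mono_neutral_cong_left) auto
  finally show ?case by simp
qed (use assms(3) in simp)

text \<open>Setting the variables outside E' to 0 amounts to testing with vectors extended by zero,
  and the derivatives \<open>ws\<close> are appended to the list of directions. Both operations
  preserve nonnegativity of the directions.\<close>

lemma alexandrov_fenchel_restrict:
  assumes fin: "finite E" and sub: "E' \<subseteq> E" and AF: "alexandrov_fenchel E c"
    and ws: "\<And>w i. w \<in> set ws \<Longrightarrow> i \<in> E \<Longrightarrow> w i \<ge> 0"
    and c': "\<And>T. T \<subseteq> E' \<Longrightarrow> c' T = set_derivs E ws c T"
  shows "alexandrov_fenchel E' c'"
  unfolding alexandrov_fenchel_def hyperbolic_def
proof (intro allI impI)
  fix vs :: "('a \<Rightarrow> real) list" and x y :: "'a \<Rightarrow> real"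
  assume vs: "\<forall>v\<in>set vs. \<forall>i\<in>E'. v i \<ge> 0" and y: "\<forall>i\<in>E'. y i \<ge> 0"
  let ?r = "\<lambda>v i. if i \<in> E' then v i else (0::real)"
  have fin': "finite E'" using fin sub finite_subset by blast
  have eq: "form E' (pair_matrix (set_derivs E' vs c')) x y = set_derivs E (?r x # ?r y # (map ?r vs @ ws)) c {}" for x y
    using set_derivs_restrict[OF fin sub, where c' = c' and c = "set_derivs E ws c" and T = "{}" and vs = "x # y # vs"] c'
    by (simp add: form_pair_matrix[OF fin'] set_derivs_append)
  show "form E' (pair_matrix (set_derivs E' vs c')) x x * form E' (pair_matrix (set_derivs E' vs c')) y y
      \<le> (form E' (pair_matrix (set_derivs E' vs c')) x y)\<^sup>2"
    unfolding eq by (rule alexandrov_fenchel_ineq[OF fin AF]) (use vs ws y in auto)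
qed

text \<open>
  If slots \<open>p\<close> and \<open>q\<close> carry \<open>A\<close> and \<open>B\<close>, then \<open>\<partial>\<^sub>p + \<partial>\<^sub>q\<close> at \<open>x\<^sub>q = 0\<close> turns \<open>p\<close> into a slot carrying \<open>A \<union> B\<close>.
\<close>

lemma alexandrov_fenchel_merge_slots:
  assumes fin: "finite E" and pq: "p \<notin> E" "q \<notin> E" "p \<noteq> q" and AB: "A \<inter> B = {}" "finite A" "finite B"
    and AF: "alexandrov_fenchel (insert q (insert p E)) (slot_poly (insert q (insert p E)) (L(p := A, q := B)) \<phi>)"
  shows "alexandrov_fenchel (insert p E) (slot_poly (insert p E) (L(p := A \<union> B)) \<phi>)"
proof (rule alexandrov_fenchel_restrict[OF _ _ AF, where ws = "[\<lambda>i. if i = p \<or> i = q then 1 else 0]"])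
  let ?E = "insert q (insert p E)" and ?L = "L(p := A, q := B)"
  let ?c = "slot_poly ?E ?L \<phi>"
  fix T assume T: "T \<subseteq> insert p E"
  have "set_deriv ?E (\<lambda>i. if i = p \<or> i = q then 1 else 0) ?c T =
      (\<Sum>i\<in>?E - T. if i = p \<or> i = q then ?c (insert i T) else 0)"
    unfolding set_deriv_def by (intro sum.cong) auto
  also have "\<dots> = (\<Sum>i\<in>{p, q} - T. ?c (insert i T))"
    using fin by (intro sum.mono_neutral_cong_right) auto
  also have "\<dots> = slot_poly (insert p E) (L(p := A \<union> B)) \<phi> T"
  proof (cases "p \<in> T")
    case True
    have "{p, q} - T = {q}" using True T pq by auto
    moreover have "?E - insert q T = insert p E - T" using T pq by auto
    moreover have "slot_sum ?L \<phi> (insert p E - T) (\<lambda>_. 0) = slot_sum (L(p := A \<union> B)) \<phi> (insert p E - T) (\<lambda>_. 0)"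
      using True pq by (intro slot_sum_cong) auto
    ultimately show ?thesis using T by (auto simp: slot_poly_def)
  next
    case False
    have sum: "{p, q} - T = {p, q}" using False T pq by auto
    have fT: "finite (E - T)" using fin by simp
    have e1: "?E - insert p T = insert q (E - T)" "?E - insert q T = insert p (E - T)"
      "insert p E - T = insert p (E - T)" using T pq False by auto
    have cg: "slot_sum ?L \<phi> (E - T) \<alpha> = slot_sum (L(p := A \<union> B)) \<phi> (E - T) \<alpha>" for \<alpha>
      using pq by (intro slot_sum_cong) auto
    \<comment> \<open>With p in the set, slot q is still differentiated and contributes B; with q in
      the set, slot p contributes A. Together they act as one slot carrying both, and disjointness
      prevents double counting.\<close>
    have "?c (insert p T) = (\<Sum>u\<in>B. slot_sum ?L \<phi> (E - T) (inc u (\<lambda>_. 0)))"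
      using T pq fT by (auto simp: slot_poly_def e1 slot_sum_insert)
    moreover have "?c (insert q T) = (\<Sum>u\<in>A. slot_sum ?L \<phi> (E - T) (inc u (\<lambda>_. 0)))"
      using T pq fT by (auto simp: slot_poly_def e1 slot_sum_insert)
    moreover have "slot_poly (insert p E) (L(p := A \<union> B)) \<phi> T = (\<Sum>u\<in>A \<union> B. slot_sum ?L \<phi> (E - T) (inc u (\<lambda>_. 0)))"
      using T pq fT by (auto simp: slot_poly_def e1 slot_sum_insert cg)
    ultimately show ?thesis using pq AB by (simp add: sum sum.union_disjoint)
  qed
  finally show "slot_poly (insert p E) (L(p := A \<union> B)) \<phi> T =
      set_derivs ?E [\<lambda>i. if i = p \<or> i = q then 1 else 0] ?c T" by simp
qed (use fin in auto)

text \<open>Read backwards, merging splits one variable off a slot into a fresh slot, which the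
  infinite type provides. Each split lowers the total of \<open>card (L p) - 1\<close> by one, down
  to slots with one variable each, where \<open>base\<close> applies.\<close>

lemma alexandrov_fenchel_slot_poly:
  fixes L :: "'e \<Rightarrow> 'w::finite set"
  assumes inf: "infinite (UNIV :: 'e set)"
    and base: "\<And>(E :: 'e set) \<tau>. finite E \<Longrightarrow> alexandrov_fenchel E (slot_poly E (\<lambda>p. {\<tau> p}) \<phi>)"
    and "finite E" "\<And>p. p \<in> E \<Longrightarrow> L p \<noteq> {}"
  shows "alexandrov_fenchel E (slot_poly E L \<phi>)"
  using assms(3-)
proof (induction "\<Sum>p\<in>E. card (L p) - 1" arbitrary: E L rule: less_induct)
  case less
  show ?case
  proof (cases "\<forall>p\<in>E. \<exists>u. L p = {u}")
    case True
    then have "\<exists>\<tau>. \<forall>p\<in>E. L p = {\<tau> p}" by (rule bchoice)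
    then obtain \<tau> where \<tau>: "\<forall>p\<in>E. L p = {\<tau> p}" by (rule exE)
    have "slot_poly E L \<phi> = slot_poly E (\<lambda>p. {\<tau> p}) \<phi>"
      unfolding slot_poly_def using \<tau> by (intro ext if_cong refl slot_sum_cong) auto
    then show ?thesis using base less.prems(1) by simp
  next
    case False
    then obtain p where p: "p \<in> E" "\<nexists>u. L p = {u}" by blast
    then obtain u where u: "u \<in> L p" using less.prems by blast
    obtain q where q: "q \<notin> E" using ex_new_if_finite[OF inf less.prems(1)] by blast
    define E0 where "E0 = E - {p}"
    define A where "A = L p - {u}"
    have E: "E = insert p E0" "p \<notin> E0" "finite E0" "q \<notin> E0" "p \<noteq> q"
      using p q less.prems by (auto simp: E0_def)
    have A: "A \<noteq> {}" "A \<inter> {u} = {}" "A \<union> {u} = L p" using u p by (auto simp: A_def)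
    have "card (L p) = Suc (card A)" unfolding A_def by (rule card.remove) (use u in auto)
    moreover have "card A > 0" using A(1) by (simp add: card_gt_0_iff)
    ultimately have card: "card (L p) = Suc (card A)" "card A > 0" .
    let ?L = "L(p := A, q := {u})"
    have s: "(\<Sum>x\<in>E0. card (?L x) - 1) = (\<Sum>x\<in>E0. card (L x) - 1)"
      using E by (intro sum.cong) auto
    have "(\<Sum>x\<in>insert q (insert p E0). card (?L x) - 1) < (\<Sum>x\<in>E. card (L x) - 1)"
      using E card s by simp
    then have "alexandrov_fenchel (insert q (insert p E0)) (slot_poly (insert q (insert p E0)) ?L \<phi>)"
      by (rule less.hyps) (use E A less.prems in auto)
    then have "alexandrov_fenchel (insert p E0) (slot_poly (insert p E0) (L(p := A \<union> {u})) \<phi>)"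
      using E A by (intro alexandrov_fenchel_merge_slots) auto
    then show ?thesis using A(3) E(1) by simp
  qed
qed

text \<open>The value of C at \<rho> - e_u - e_v. Testing v against \<open>dec u \<rho>\<close>
  demands \<rho> u >= 2 when u = v.\<close>

definition lower2 :: "(('w \<Rightarrow> nat) \<Rightarrow> real) \<Rightarrow> ('w \<Rightarrow> nat) \<Rightarrow> 'w \<Rightarrow> 'w \<Rightarrow> real" where
  "lower2 C \<rho> u v = (if \<rho> u \<ge> 1 \<and> dec u \<rho> v \<ge> 1 then C (dec v (dec u \<rho>)) else 0)"

text \<open>Variables with \<open>\<rho> u = 0\<close> own no slot, so \<open>y\<close> vanishes there.\<close>

definition local_index :: "(('w::finite \<Rightarrow> nat) \<Rightarrow> real) \<Rightarrow> bool" where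
  "local_index C \<longleftrightarrow> (\<forall>\<rho>. \<exists>l. \<forall>y. (\<forall>u. \<rho> u = 0 \<longrightarrow> y u = 0) \<longrightarrow> (\<Sum>u\<in>UNIV. l u * y u) = 0 \<longrightarrow>
     form UNIV (lower2 C \<rho>) y y \<le> 0)"

text \<open>The exchange axiom of M-convex sets. It starts from a coordinate to be raised because
  taking a slot out of T means differentiating along it, which raises the exponent of its
  variable.\<close>

definition exchange_support :: "(('w \<Rightarrow> nat) \<Rightarrow> real) \<Rightarrow> bool" where
  "exchange_support C \<longleftrightarrow> (\<forall>\<alpha> \<beta> u. C \<alpha> \<noteq> 0 \<longrightarrow> C \<beta> \<noteq> 0 \<longrightarrow> \<alpha> u < \<beta> u \<longrightarrow>
     (\<exists>v. \<beta> v < \<alpha> v \<and> C (dec v (inc u \<alpha>)) \<noteq> 0))"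

definition factorial_weighted :: "(('w::finite \<Rightarrow> nat) \<Rightarrow> real) \<Rightarrow> ('w \<Rightarrow> nat) \<Rightarrow> real" where
  "factorial_weighted C \<alpha> = (\<Prod>u\<in>UNIV. fact (\<alpha> u)) * C \<alpha>"

section \<open>Local conditions for slots carrying one variable each\<close>

lemma prod_fact_dec:
  fixes \<alpha> :: "'w::finite \<Rightarrow> nat"
  assumes "\<alpha> u \<ge> 1"
  shows "(\<Prod>w\<in>UNIV. fact (\<alpha> w)) = real (\<alpha> u) * (\<Prod>w\<in>UNIV. fact (dec u \<alpha> w))"
proof -
  have "(\<Prod>w\<in>UNIV - {u}. fact (\<alpha> w) :: real) = (\<Prod>w\<in>UNIV - {u}. fact (dec u \<alpha> w))"
    by (intro prod.cong) (auto simp: dec_def)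
  moreover have "(fact (\<alpha> u) :: real) = real (\<alpha> u) * fact (dec u \<alpha> u)"
    using assms by (cases "\<alpha> u") (auto simp: dec_def)
  ultimately show ?thesis
    by (simp add: prod.remove[of UNIV u "\<lambda>w. fact (\<alpha> w) :: real"]
        prod.remove[of UNIV u "\<lambda>w. fact (dec u \<alpha> w) :: real"])
qed

text \<open>With \<rho> u slots for each variable u, the factor in parentheses counts ordered pairs
  of distinct slots for u and v. Summing the weighted entries over slots therefore replaces the
  factorials by the constant \<rho>!, which does not affect signs.\<close>

lemma lower2_factorial_weighted:
  fixes C :: "('w::finite \<Rightarrow> nat) \<Rightarrow> real"
  shows "lower2 (factorial_weighted C) \<rho> u v * (real (\<rho> u) * real (dec u \<rho> v)) =
    (\<Prod>w\<in>UNIV. fact (\<rho> w)) * lower2 C \<rho> u v"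
proof (cases "\<rho> u \<ge> 1 \<and> dec u \<rho> v \<ge> 1")
  case True
  then show ?thesis
    using prod_fact_dec[of \<rho> u] prod_fact_dec[of "dec u \<rho>" v]
    by (simp add: lower2_def factorial_weighted_def)
qed (auto simp: lower2_def)

text \<open>
  Averaging over the slots of each variable turns the form into \<open>lower2 C \<rho>\<close>; the fluctuations
  within one variable only contribute negatively.
\<close>

lemma index_le_one_slots:
  fixes \<tau> :: "'e \<Rightarrow> 'w::finite"
  assumes fin: "finite R" and Cnn: "\<And>\<alpha>. C \<alpha> \<ge> 0" and loc: "local_index C"
  defines "\<rho> \<equiv> type_count \<tau> R"
  shows "index_le_one R (\<lambda>i j. if i = j then 0 else lower2 (factorial_weighted C) \<rho> (\<tau> i) (\<tau> j))"
proof -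
  define S where "S = lower2 (factorial_weighted C) \<rho>"
  define F where "F = (\<Prod>w\<in>UNIV. fact (\<rho> w) :: real)"
  obtain l where l: "\<And>y. (\<And>u. \<rho> u = 0 \<Longrightarrow> y u = 0) \<Longrightarrow> (\<Sum>u\<in>UNIV. l u * y u) = 0 \<Longrightarrow>
     form UNIV (lower2 C \<rho>) y y \<le> 0"
    using loc unfolding local_index_def by meson
  have Snn: "S u v \<ge> 0" for u v
    using Cnn by (simp add: S_def lower2_def factorial_weighted_def prod_nonneg)
  \<comment> \<open>Dividing l by the slot count makes the constraint on x read l . Y = 0 for the
    averages Y of x over the slots of each variable.\<close>
  have "form R (\<lambda>i j. if i = j then 0 else S (\<tau> i) (\<tau> j)) x x \<le> 0"
    if x: "(\<Sum>i\<in>R. (l (\<tau> i) / \<rho> (\<tau> i)) * x i) = 0" for x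
  proof -
    define X where "X u = (\<Sum>p\<in>{p\<in>R. \<tau> p = u}. x p)" for u
    define Q where "Q u = (\<Sum>p\<in>{p\<in>R. \<tau> p = u}. (x p)\<^sup>2)" for u
    define Y where "Y u = X u / \<rho> u" for u
    have grp: "(\<Sum>i\<in>R. g i) = (\<Sum>u\<in>UNIV. \<Sum>i\<in>{i\<in>R. \<tau> i = u}. g i)" for g :: "'e \<Rightarrow> real"
      using sum.group[OF fin finite_class.finite_UNIV, of \<tau> g] by simp
    have empty: "{p\<in>R. \<tau> p = u} = {}" if "\<rho> u = 0" for u
      using that fin by (simp add: \<rho>_def type_count_def)
    have X: "X u = \<rho> u * Y u" for u
    proof (cases "\<rho> u = 0")
      case True
      then show ?thesis unfolding X_def empty[OF True] by simp
    qed (simp add: Y_def)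
    have "(\<Sum>i\<in>R. (l (\<tau> i) / \<rho> (\<tau> i)) * x i) = (\<Sum>u\<in>UNIV. l u * Y u)"
      unfolding grp Y_def X_def
      by (intro sum.cong) (auto simp: sum_distrib_left sum_divide_distrib)
    then have "(\<Sum>u\<in>UNIV. l u * Y u) = 0" using x by simp
    then have neg: "form UNIV (lower2 C \<rho>) Y Y \<le> 0" using l[of Y] by (simp add: Y_def)
    have cs: "\<rho> u * (Y u)\<^sup>2 \<le> Q u" for u
    proof (cases "\<rho> u = 0")
      case False
      have "(X u)\<^sup>2 \<le> Q u * \<rho> u"
        unfolding X_def Q_def \<rho>_def type_count_def
        by (rule sum_squared_le_sum_of_squares)
      then have "\<rho> u * (\<rho> u * (Y u)\<^sup>2) \<le> \<rho> u * Q u"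
        unfolding X by (simp add: power2_eq_square mult_ac)
      then show ?thesis using False by (simp add: mult_le_cancel_left)
    qed (simp add: Q_def sum_nonneg)
    have "form R (\<lambda>i j. if i = j then 0 else S (\<tau> i) (\<tau> j)) x x =
        (\<Sum>i\<in>R. (\<Sum>j\<in>R. S (\<tau> i) (\<tau> j) * x i * x j) - S (\<tau> i) (\<tau> i) * (x i)\<^sup>2)"
      unfolding form_def
    proof (rule sum.cong[OF refl])
      fix i assume i: "i \<in> R"
      show "(\<Sum>j\<in>R. (if i = j then 0 else S (\<tau> i) (\<tau> j)) * x i * x j) =
        (\<Sum>j\<in>R. S (\<tau> i) (\<tau> j) * x i * x j) - S (\<tau> i) (\<tau> i) * (x i)\<^sup>2"
        using i fin by (simp add: sum.remove[of R i] power2_eq_square) (intro sum.cong, auto)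
    qed
    also have "\<dots> = (\<Sum>i\<in>R. \<Sum>j\<in>R. S (\<tau> i) (\<tau> j) * x i * x j) - (\<Sum>i\<in>R. S (\<tau> i) (\<tau> i) * (x i)\<^sup>2)"
      by (rule sum_subtractf)
    also have "(\<Sum>i\<in>R. S (\<tau> i) (\<tau> i) * (x i)\<^sup>2) = (\<Sum>u\<in>UNIV. S u u * Q u)"
      unfolding grp Q_def by (intro sum.cong) (auto simp: sum_distrib_left)
    also have "(\<Sum>i\<in>R. \<Sum>j\<in>R. S (\<tau> i) (\<tau> j) * x i * x j) = form UNIV S X X"
    proof -
      have "(\<Sum>j\<in>R. S (\<tau> i) (\<tau> j) * x i * x j) = (\<Sum>v\<in>UNIV. S (\<tau> i) v * x i * X v)" for i
        unfolding grp X_def by (intro sum.cong) (auto simp: sum_distrib_left)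
      moreover define f where "f u = (\<Sum>v\<in>UNIV. S u v * X v)" for u
      ultimately have "(\<Sum>i\<in>R. \<Sum>j\<in>R. S (\<tau> i) (\<tau> j) * x i * x j) = (\<Sum>i\<in>R. x i * f (\<tau> i))"
        by (simp add: sum_distrib_left mult_ac)
      also have "\<dots> = (\<Sum>u\<in>UNIV. \<Sum>i\<in>{i\<in>R. \<tau> i = u}. x i * f (\<tau> i))" by (rule grp)
      also have "\<dots> = (\<Sum>u\<in>UNIV. X u * f u)"
        unfolding X_def by (intro sum.cong) (auto simp: sum_distrib_right)
      also have "\<dots> = form UNIV S X X" by (simp add: form_eq_sum_left f_def)
      finally show ?thesis .
    qed
    \<comment> \<open>The entry S u u meets (\<rho> u)^2 pairs on the left but only \<rho> u (\<rho>
      u - 1) pairs of distinct slots, which leaves S u u * \<rho> u * (Y u)^2. The absent diagonal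
      of the slot matrix subtracts S u u * Q u, at least as much by Cauchy-Schwarz.\<close>
    also have "form UNIV S X X = F * form UNIV (lower2 C \<rho>) Y Y + (\<Sum>u\<in>UNIV. S u u * (\<rho> u * (Y u)\<^sup>2))"
    proof -
      have entry: "S u v * X u * X v = F * (lower2 C \<rho> u v * Y u * Y v) +
          (if u = v then S u u * (\<rho> u * (Y u)\<^sup>2) else 0)" for u v
      proof -
        have FL: "F * lower2 C \<rho> u v = S u v * (real (\<rho> u) * real (dec u \<rho> v))"
          unfolding S_def F_def by (rule lower2_factorial_weighted[symmetric])
        have "F * (lower2 C \<rho> u v * Y u * Y v) = (F * lower2 C \<rho> u v) * Y u * Y v" by simp
        also have "\<dots> = S u v * (real (\<rho> u) * real (dec u \<rho> v)) * Y u * Y v" unfolding FL ..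
        finally have e: "F * (lower2 C \<rho> u v * Y u * Y v) = S u v * (real (\<rho> u) * real (dec u \<rho> v)) * Y u * Y v" .
        show ?thesis
        proof (cases "u = v")
          case True
          show ?thesis
          proof (cases "\<rho> u = 0")
            case False
            then have "real (\<rho> u - 1) = real (\<rho> u) - 1" by simp
            then show ?thesis unfolding e X using True by (simp add: dec_def power2_eq_square algebra_simps)
          next
            case r0: True
            then show ?thesis unfolding e X using True by simp
          qed
        qed (simp add: e X dec_def)
      qed
      show ?thesis
        unfolding form_def entry sum.distrib by (simp add: sum_distrib_left)
    qed
    finally have "form R (\<lambda>i j. if i = j then 0 else S (\<tau> i) (\<tau> j)) x x =
      F * form UNIV (lower2 C \<rho>) Y Y + (\<Sum>u\<in>UNIV. S u u * (\<rho> u * (Y u)\<^sup>2)) - (\<Sum>u\<in>UNIV. S u u * Q u)" .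
    moreover have "F * form UNIV (lower2 C \<rho>) Y Y \<le> 0"
      using neg by (intro mult_nonneg_nonpos) (auto simp: F_def prod_nonneg)
    moreover have "(\<Sum>u\<in>UNIV. S u u * (\<rho> u * (Y u)\<^sup>2)) \<le> (\<Sum>u\<in>UNIV. S u u * Q u)"
      by (intro sum_mono mult_left_mono cs Snn)
    ultimately show ?thesis by linarith
  qed
  then show ?thesis
    unfolding index_le_one_def S_def by (intro exI[of _ "\<lambda>i. l (\<tau> i) / \<rho> (\<tau> i)"]) blast
qed

lemma index_le_one_extend_zero:
  assumes "finite E" "R \<subseteq> E" "index_le_one R H"
    and "\<And>i j. i \<in> E \<Longrightarrow> j \<in> E \<Longrightarrow> H' i j = (if i \<in> R \<and> j \<in> R then H i j else 0)"
  shows "index_le_one E H'"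
proof -
  obtain l where l: "\<And>x. (\<Sum>i\<in>R. l i * x i) = 0 \<Longrightarrow> form R H x x \<le> 0"
    using assms(3) by (auto simp: index_le_one_def)
  have "form E H' x x = form R H x x" for x
  proof -
    have "form E H' x x = (\<Sum>i\<in>R. \<Sum>j\<in>E. H' i j * x i * x j)"
      unfolding form_def using assms by (intro sum.mono_neutral_right) auto
    also have "\<dots> = (\<Sum>i\<in>R. \<Sum>j\<in>R. H i j * x i * x j)"
    proof (rule sum.cong[OF refl])
      fix i assume i: "i \<in> R"
      show "(\<Sum>j\<in>E. H' i j * x i * x j) = (\<Sum>j\<in>R. H i j * x i * x j)"
        using assms(1,2,4) i by (intro sum.mono_neutral_cong_right) (auto simp: subset_iff)
    qed
    finally show ?thesis by (simp add: form_def)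
  qed
  moreover have "(\<Sum>i\<in>E. (if i \<in> R then l i else 0) * x i) = (\<Sum>i\<in>R. l i * x i)" for x
    using assms by (intro sum.mono_neutral_cong_right) auto
  ultimately show ?thesis
    unfolding index_le_one_def using l by (intro exI[of _ "\<lambda>i. if i \<in> R then l i else 0"]) auto
qed

text \<open>The exponent belonging to T is counted on the complement E - T, so degree K turns into
  \<open>card E - K\<close>, and the quadratic derivative along A is \<open>lower2\<close> at the
  type count of E - A. For the exchange, swapping two slots of the same variable leaves the exponent
  alone; if no such swap exists, the counts differ strictly and \<open>exchange_support\<close>
  names another variable.\<close>

lemma locally_hyperbolic_singleton_slots:
  fixes \<tau> :: "'e \<Rightarrow> 'w::finite"
  assumes fin: "finite E" and Cnn: "\<And>\<alpha>. C \<alpha> \<ge> 0"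
    and deg: "\<And>\<alpha>. C \<alpha> \<noteq> 0 \<Longrightarrow> (\<Sum>u\<in>UNIV. \<alpha> u) = K"
    and exch: "exchange_support C" and loc: "local_index C"
  shows "locally_hyperbolic E (card E - K) (slot_poly E (\<lambda>p. {\<tau> p}) (factorial_weighted C))"
proof -
  let ?c = "slot_poly E (\<lambda>p. {\<tau> p}) (factorial_weighted C)"
  have c: "?c T = (if T \<subseteq> E then factorial_weighted C (type_count \<tau> (E - T)) else 0)" for T
    using fin by (simp add: slot_poly_def slot_sum_singletons)
  have c_nz: "?c T \<noteq> 0 \<longleftrightarrow> T \<subseteq> E \<and> C (type_count \<tau> (E - T)) \<noteq> 0" for T
    by (simp add: c factorial_weighted_def)
  show ?thesis unfolding locally_hyperbolic_def
  proof (intro conjI allI impI)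
    show "?c T \<ge> 0" for T using Cnn by (simp add: c factorial_weighted_def prod_nonneg)
  next
    fix T assume T: "?c T \<noteq> 0"
    show "T \<subseteq> E" using T c_nz by blast
    have "card (E - T) = K" using T deg[of "type_count \<tau> (E - T)"] sum_type_count[of "E - T" \<tau>] fin
      by (simp add: c_nz)
    then show "card T = card E - K"
      using \<open>T \<subseteq> E\<close> fin by (metis card_Diff_subset card_mono diff_diff_cancel finite_subset)
  next
    fix T T' i
    assume T: "?c T \<noteq> 0" and T': "?c T' \<noteq> 0" and i: "i \<in> T - T'"
    define S S' where "S = E - T" and "S' = E - T'"
    have fS: "finite S" "finite S'" using fin by (auto simp: S_def S'_def)
    have CS: "C (type_count \<tau> S) \<noteq> 0" "C (type_count \<tau> S') \<noteq> 0" and TE: "T \<subseteq> E" "T' \<subseteq> E"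
      using T T' by (auto simp: c_nz S_def S'_def)
    have iS: "i \<in> S'" "i \<notin> S" using i TE by (auto simp: S_def S'_def)
    have goal: "\<exists>j\<in>T' - T. ?c (insert j (T - {i})) \<noteq> 0" if j: "j \<in> S" "j \<notin> S'" "C (dec (\<tau> j) (inc (\<tau> i) (type_count \<tau> S))) \<noteq> 0" for j
    proof (rule bexI[of _ j])
      show "j \<in> T' - T" using j by (auto simp: S_def S'_def)
      have "E - insert j (T - {i}) = insert i S - {j}" using i TE by (auto simp: S_def)
      then have "type_count \<tau> (E - insert j (T - {i})) = dec (\<tau> j) (inc (\<tau> i) (type_count \<tau> S))"
        using fS j iS by (simp add: type_count_remove type_count_insert)
      then show "?c (insert j (T - {i})) \<noteq> 0"
        using j TE by (auto simp: c_nz S_def)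
    qed
    show "\<exists>j\<in>T' - T. ?c (insert j (T - {i})) \<noteq> 0"
    proof (cases "\<exists>j. j \<in> S \<and> j \<notin> S' \<and> \<tau> j = \<tau> i")
      case True
      then obtain j where j: "j \<in> S" "j \<notin> S'" "\<tau> j = \<tau> i" by blast
      have "dec (\<tau> j) (inc (\<tau> i) (type_count \<tau> S)) = type_count \<tau> S"
        by (auto simp: dec_def inc_def j(3))
      then show ?thesis using goal[of j] j CS by simp
    next
      case False
      then have "{p \<in> S. \<tau> p = \<tau> i} \<subset> {p \<in> S'. \<tau> p = \<tau> i}" using iS by blast
      then have "type_count \<tau> S (\<tau> i) < type_count \<tau> S' (\<tau> i)"
        unfolding type_count_def using fS by (intro psubset_card_mono) auto
      then obtain v where v: "type_count \<tau> S' v < type_count \<tau> S v" "C (dec v (inc (\<tau> i) (type_count \<tau> S))) \<noteq> 0"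
        using exch CS unfolding exchange_support_def by blast
      have "\<not> {p \<in> S. \<tau> p = v} \<subseteq> {p \<in> S'. \<tau> p = v}"
        using v(1) fS card_mono[of "{p \<in> S'. \<tau> p = v}" "{p \<in> S. \<tau> p = v}"] by (auto simp: type_count_def)
      then obtain j where "j \<in> S" "j \<notin> S'" "\<tau> j = v" by blast
      then show ?thesis using goal[of j] v by simp
    qed
  next
    fix A assume A: "A \<subseteq> E" "card A + 2 = card E - K"
    define R where "R = E - A"
    have fR: "finite R" "R \<subseteq> E" using fin by (auto simp: R_def)
    let ?H = "\<lambda>i j. if i = j \<or> i \<in> A \<or> j \<in> A then 0 else ?c (A \<union> {i, j})"
    show "hyperbolic E ?H"
    proof (rule hyperbolic_if_index_le_one)
      show "symmetric_on E ?H" by (auto simp: symmetric_on_def insert_commute)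
      show "?H i j \<ge> 0" for i j using Cnn by (simp add: c factorial_weighted_def prod_nonneg)
      show "index_le_one E ?H"
      proof (rule index_le_one_extend_zero[OF fin fR(2) index_le_one_slots[OF fR(1) Cnn loc, of \<tau>]])
        fix i j assume ij: "i \<in> E" "j \<in> E"
        show "?H i j = (if i \<in> R \<and> j \<in> R then
            if i = j then 0 else lower2 (factorial_weighted C) (type_count \<tau> R) (\<tau> i) (\<tau> j) else 0)"
        proof (cases "i \<noteq> j \<and> i \<in> R \<and> j \<in> R")
          case True
          have "E - (A \<union> {i, j}) = (R - {i}) - {j}" by (auto simp: R_def)
          then have "type_count \<tau> (E - (A \<union> {i, j})) = dec (\<tau> j) (dec (\<tau> i) (type_count \<tau> R))"
            using True fR type_count_remove[of R i \<tau>] type_count_remove[of "R - {i}" j \<tau>] by auto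
          moreover have "type_count \<tau> R (\<tau> i) \<ge> 1"
            using True fR by (auto simp: type_count_def Suc_le_eq card_gt_0_iff)
          moreover have "type_count \<tau> (R - {i}) (\<tau> j) \<ge> 1"
            using True fR by (auto simp: type_count_def Suc_le_eq card_gt_0_iff)
          then have "dec (\<tau> i) (type_count \<tau> R) (\<tau> j) \<ge> 1"
            using True fR type_count_remove[of R i \<tau>] by auto
          ultimately show ?thesis using True A by (auto simp: c lower2_def R_def)
        qed (auto simp: R_def ij)
      qed
    qed
  qed
qed

section \<open>Two copies of a coefficient function\<close>

lemma sum_inc:
  fixes \<alpha> :: "'w::finite \<Rightarrow> nat"
  shows "(\<Sum>u\<in>UNIV. inc v \<alpha> u) = Suc (\<Sum>u\<in>UNIV. \<alpha> u)"
proof -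
  have "(\<Sum>u\<in>UNIV - {v}. inc v \<alpha> u) = (\<Sum>u\<in>UNIV - {v}. \<alpha> u)"
    by (intro sum.cong) (auto simp: inc_def)
  then show ?thesis
    by (simp add: sum.remove[of UNIV v "inc v \<alpha>"] sum.remove[of UNIV v \<alpha>]) (simp add: inc_def)
qed

lemma inc_dec: "\<alpha> v \<ge> 1 \<Longrightarrow> inc v (dec v \<alpha>) = \<alpha>"
  by (auto simp: inc_def dec_def)

lemma dec_inc: "dec v (inc v \<alpha>) = \<alpha>"
  by (auto simp: inc_def dec_def)

lemma dec_le: "dec v \<alpha> u \<le> \<alpha> u"
  by (simp add: dec_def)

lemma sum_dec:
  fixes \<alpha> :: "'w::finite \<Rightarrow> nat"
  assumes "\<alpha> v \<ge> 1"
  shows "Suc (\<Sum>u\<in>UNIV. dec v \<alpha> u) = (\<Sum>u\<in>UNIV. \<alpha> u)"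
  using sum_inc[of v "dec v \<alpha>"] inc_dec[of \<alpha> v] assms by simp

definition lower1 :: "(('w \<Rightarrow> nat) \<Rightarrow> real) \<Rightarrow> ('w \<Rightarrow> nat) \<Rightarrow> 'w \<Rightarrow> real" where
  "lower1 C \<rho> u = (if \<rho> u \<ge> 1 then C (dec u \<rho>) else 0)"

definition slice :: "bool \<Rightarrow> (bool \<times> 'r \<Rightarrow> nat) \<Rightarrow> 'r \<Rightarrow> nat" where
  "slice s \<alpha> i = \<alpha> (s, i)"

definition double :: "(('r \<Rightarrow> nat) \<Rightarrow> real) \<Rightarrow> (bool \<times> 'r \<Rightarrow> nat) \<Rightarrow> real" where
  "double c \<alpha> = c (slice False \<alpha>) * c (slice True \<alpha>)"

lemma slice_inc: "slice s (inc (t, i) \<alpha>) = (if s = t then inc i (slice s \<alpha>) else slice s \<alpha>)"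
  by (auto simp: slice_def inc_def)

lemma slice_dec: "slice s (dec (t, i) \<alpha>) = (if s = t then dec i (slice s \<alpha>) else slice s \<alpha>)"
  by (auto simp: slice_def dec_def)

lemma sum_bool_times:
  fixes g :: "bool \<times> 'r::finite \<Rightarrow> 'a::comm_monoid_add"
  shows "(\<Sum>p\<in>UNIV. g p) = (\<Sum>i\<in>UNIV. g (False, i)) + (\<Sum>i\<in>UNIV. g (True, i))"
proof -
  have "(\<Sum>p\<in>UNIV. g p) = (\<Sum>(s, i)\<in>UNIV \<times> UNIV. g (s, i))" by simp
  also have "\<dots> = (\<Sum>s\<in>UNIV. \<Sum>i\<in>UNIV. g (s, i))" by (rule sum.cartesian_product[symmetric])
  finally show ?thesis by (simp add: UNIV_bool)
qed

text \<open>The support of c is a full degree slice of a box, which the perturbation will provide.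
  Within one copy both exponents have degree k, so a coordinate with a deficit is accompanied by one
  with a surplus, and moving a unit between them stays in the box.\<close>

lemma exchange_support_double:
  fixes c :: "('r::finite \<Rightarrow> nat) \<Rightarrow> real"
  assumes c: "\<And>\<alpha>. c \<alpha> \<noteq> 0 \<longleftrightarrow> (\<forall>i. \<alpha> i \<le> \<kappa> i) \<and> (\<Sum>i\<in>UNIV. \<alpha> i) = k"
  shows "exchange_support (double c)"
  unfolding exchange_support_def
proof (intro allI impI)
  fix \<alpha> \<beta> :: "bool \<times> 'r \<Rightarrow> nat" and u
  assume a: "double c \<alpha> \<noteq> 0" and b: "double c \<beta> \<noteq> 0" and less: "\<alpha> u < \<beta> u"
  obtain s i where u: "u = (s, i)" by (cases u)
  have ca: "c (slice t \<alpha>) \<noteq> 0" and cb: "c (slice t \<beta>) \<noteq> 0" for t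
    using a b by (cases t; simp add: double_def)+
  have sums: "(\<Sum>i\<in>UNIV. slice s \<alpha> i) = k" "(\<Sum>i\<in>UNIV. slice s \<beta> i) = k"
    using ca[of s] cb[of s] unfolding c by auto
  have "\<exists>j. slice s \<beta> j < slice s \<alpha> j"
  proof (rule ccontr)
    assume "\<not> ?thesis"
    then have "(\<Sum>i\<in>UNIV. slice s \<alpha> i) < (\<Sum>i\<in>UNIV. slice s \<beta> i)"
      using less by (intro sum_strict_mono_ex1) (auto simp: u slice_def not_less)
    then show False using sums by simp
  qed
  then obtain j where j: "slice s \<beta> j < slice s \<alpha> j" by blast
  have ij: "i \<noteq> j" using j less by (auto simp: u slice_def)
  let ?\<gamma> = "dec j (inc i (slice s \<alpha>))"
  have "inc i (slice s \<alpha>) j \<ge> 1" using j ij by (simp add: inc_def)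
  then have "(\<Sum>i\<in>UNIV. ?\<gamma> i) = k"
    using sum_dec[of "inc i (slice s \<alpha>)" j] sums(1) by (simp add: sum_inc)
  moreover have "slice s \<alpha> i < slice s \<beta> i" using less by (simp add: u slice_def)
  then have "\<forall>l. ?\<gamma> l \<le> \<kappa> l"
    using ca[of s] cb[of s] ij unfolding c by (auto simp: inc_def dec_def le_diff_conv intro: le_SucI) (metis Suc_leI le_trans)
  ultimately have "c ?\<gamma> \<noteq> 0" using c by blast
  then have "double c (dec (s, j) (inc u \<alpha>)) \<noteq> 0"
    using ca by (cases s) (auto simp: double_def u slice_inc slice_dec)
  then show "\<exists>v. \<beta> v < \<alpha> v \<and> double c (dec v (inc u \<alpha>)) \<noteq> 0"
    using j by (intro exI[of _ "(s, j)"]) (simp add: slice_def)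
qed

text \<open>At a slice of \<rho>, the values of c, \<open>lower1 c\<close> and
  \<open>lower2 c\<close> can be nonzero only if its degree is k, k + 1 or k + 2 respectively. If c
  is nonzero at one slice, only the block of the other copy survives and \<open>loc\<close> applies
  to it. Otherwise the form is twice the product of the linear forms \<open>b False\<close> and
  \<open>b True\<close>, which vanishes on the kernel of the first.\<close>

lemma local_index_double:
  fixes c :: "('r::finite \<Rightarrow> nat) \<Rightarrow> real"
  assumes nn: "\<And>\<alpha>. c \<alpha> \<ge> 0" and deg: "\<And>\<alpha>. c \<alpha> \<noteq> 0 \<Longrightarrow> (\<Sum>i\<in>UNIV. \<alpha> i) = k"
    and loc: "local_index c"
  shows "local_index (double c)"
  unfolding local_index_def
proof
  fix \<rho> :: "bool \<times> 'r \<Rightarrow> nat"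
  have deg1: "(\<Sum>i\<in>UNIV. \<sigma> i) = Suc k" if "lower1 c \<sigma> i \<noteq> 0" for \<sigma> i
    using that deg[of "dec i \<sigma>"] sum_dec[of \<sigma> i] by (auto simp: lower1_def split: if_splits)
  have deg2: "(\<Sum>i\<in>UNIV. \<sigma> i) = Suc (Suc k)" if "lower2 c \<sigma> i j \<noteq> 0" for \<sigma> i j
    using that deg[of "dec j (dec i \<sigma>)"] sum_dec[of \<sigma> i] sum_dec[of "dec i \<sigma>" j]
    by (auto simp: lower2_def split: if_splits)
  define A where "A s = (\<lambda>y. form UNIV (lower2 c (slice s \<rho>)) (\<lambda>i. y (s, i)) (\<lambda>i. y (s, i)))" for s
  define b where "b s = (\<lambda>y. \<Sum>i\<in>UNIV. lower1 c (slice s \<rho>) i * y (s, i))" for s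
  have entry: "lower2 (double c) \<rho> (s, i) (t, j) =
      (if s = t then c (slice (\<not> s) \<rho>) * lower2 c (slice s \<rho>) i j
       else lower1 c (slice s \<rho>) i * lower1 c (slice t \<rho>) j)" for s t i j
  proof -
    have "\<rho> (s, i) = slice s \<rho> i" "dec (s, i) \<rho> (t, j) = slice t (dec (s, i) \<rho>) j"
      by (simp_all add: slice_def)
    then show ?thesis
      unfolding lower2_def lower1_def double_def by (cases s; cases t) (simp_all add: slice_dec)
  qed
  have expand: "form UNIV (lower2 (double c) \<rho>) y y =
      c (slice True \<rho>) * A False y + c (slice False \<rho>) * A True y + 2 * (b False y * b True y)" for y
  proof -
    have ba: "b s y * b t y = (\<Sum>i\<in>UNIV. \<Sum>j\<in>UNIV. lower1 c (slice s \<rho>) i * lower1 c (slice t \<rho>) j * y (s, i) * y (t, j))" for s t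
      unfolding b_def sum_product by (simp add: mult_ac)
    have "b False y * b True y = b True y * b False y" by simp
    then show ?thesis
      unfolding form_def[of UNIV "lower2 (double c) \<rho>"] sum_bool_times entry sum.distrib
      using ba[of False True] ba[of True False]
      by (simp add: A_def form_def sum_distrib_left mult_ac)
  qed
  have zero: "A s y = 0" "b s y = 0" if "c (slice s \<rho>) \<noteq> 0" for s y
  proof -
    have s: "(\<Sum>i\<in>UNIV. slice s \<rho> i) = k" using deg[OF that] .
    then have "lower2 c (slice s \<rho>) i j = 0" "lower1 c (slice s \<rho>) i = 0" for i j
      using deg1[of "slice s \<rho>" i] deg2[of "slice s \<rho>" i j] by auto
    then show "A s y = 0" "b s y = 0" by (simp_all add: A_def b_def form_def)
  qed
  show "\<exists>l. \<forall>y. (\<forall>u. \<rho> u = 0 \<longrightarrow> y u = 0) \<longrightarrow> (\<Sum>u\<in>UNIV. l u * y u) = 0 \<longrightarrow>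
     form UNIV (lower2 (double c) \<rho>) y y \<le> 0"
  proof (cases "\<exists>s. c (slice s \<rho>) \<noteq> 0")
    case True
    then obtain s where s: "c (slice s \<rho>) \<noteq> 0" by blast
    obtain l where l: "\<And>y. (\<forall>u. slice (\<not> s) \<rho> u = 0 \<longrightarrow> y u = 0) \<Longrightarrow> (\<Sum>u\<in>UNIV. l u * y u) = 0 \<Longrightarrow>
     form UNIV (lower2 c (slice (\<not> s) \<rho>)) y y \<le> 0"
      using loc unfolding local_index_def by meson
    have "form UNIV (lower2 (double c) \<rho>) y y \<le> 0"
      if y: "\<forall>u. \<rho> u = 0 \<longrightarrow> y u = 0" "(\<Sum>u\<in>UNIV. (if fst u = (\<not> s) then l (snd u) else 0) * y u) = 0" for y
    proof -
      have "(\<Sum>u\<in>UNIV. l u * y (\<not> s, u)) = 0"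
        using y(2) unfolding sum_bool_times by (cases s) simp_all
      then have "A (\<not> s) y \<le> 0" unfolding A_def using y(1) by (intro l) (auto simp: slice_def)
      then have "c (slice s \<rho>) * A (\<not> s) y \<le> 0" using nn by (simp add: mult_nonneg_nonpos)
      then show ?thesis unfolding expand using zero[OF s] by (cases s) simp_all
    qed
    then show ?thesis by (intro exI[of _ "\<lambda>u. if fst u = (\<not> s) then l (snd u) else 0"]) blast
  next
    case False
    have "form UNIV (lower2 (double c) \<rho>) y y \<le> 0"
      if "(\<Sum>u\<in>UNIV. (if fst u then 0 else lower1 c (slice False \<rho>) (snd u)) * y u) = 0" for y
    proof -
      have "b False y = 0" using that unfolding sum_bool_times b_def by simp
      then show ?thesis unfolding expand using False by simp
    qed
    then show ?thesis by (intro exI[of _ "\<lambda>u. if fst u then 0 else lower1 c (slice False \<rho>) (snd u)"]) blast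
  qed
qed

text \<open>In the application h lists derivatives at 0 of the dual after a positive change of
  variables. Lowering \<rho> raises \<mu> = \<kappa> - \<rho>, so for \<rho> below \<kappa> of
  degree k + 2 the entry \<open>lower2 c \<rho> i j\<close> is the Hessian entry of h at \<mu>
  wherever \<rho> has room for both steps. A comparison of the two forms then suffices.\<close>

lemma local_index_of_hessians:
  fixes h :: "('r::finite \<Rightarrow> nat) \<Rightarrow> real"
  assumes hnn: "\<And>\<mu>. (\<Sum>i\<in>UNIV. \<mu> i) = d \<Longrightarrow> h \<mu> \<ge> 0"
    and hess: "\<And>\<mu>. (\<Sum>i\<in>UNIV. \<mu> i) + 2 = d \<Longrightarrow> index_le_one UNIV (\<lambda>i j. h (inc i (inc j \<mu>)))"
    and \<kappa>: "(\<Sum>i\<in>UNIV. \<kappa> i) = k + d"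
    and c: "\<And>\<alpha>. c \<alpha> = (if (\<forall>i. \<alpha> i \<le> \<kappa> i) \<and> (\<Sum>i\<in>UNIV. \<alpha> i) = k then h (\<lambda>i. \<kappa> i - \<alpha> i) else 0)"
  shows "local_index c"
  unfolding local_index_def
proof
  fix \<rho> :: "'r \<Rightarrow> nat"
  show "\<exists>l. \<forall>y. (\<forall>u. \<rho> u = 0 \<longrightarrow> y u = 0) \<longrightarrow> (\<Sum>u\<in>UNIV. l u * y u) = 0 \<longrightarrow>
     form UNIV (lower2 c \<rho>) y y \<le> 0"
  proof (cases "\<forall>i. \<rho> i \<le> \<kappa> i")
    case False
    then obtain i0 where i0: "\<rho> i0 > \<kappa> i0" by (auto simp: not_le)
    \<comment> \<open>An exponent above \<kappa> at i0 can enter the box only by a step at i0, so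
      nothing is left on the hyperplane y i0 = 0.\<close>
    have "form UNIV (lower2 c \<rho>) y y \<le> 0" if "(\<Sum>u\<in>UNIV. unit_fun i0 u * y u) = 0" for y
    proof -
      have "(\<Sum>u\<in>UNIV. unit_fun i0 u * y u) = (\<Sum>u\<in>UNIV. if u = i0 then y u else 0)"
        by (intro sum.cong) (auto simp: unit_fun_def)
      then have y0: "y i0 = 0" using that by simp
      have z: "lower2 c \<rho> i j * y i * y j = 0" for i j
      proof (cases "i = i0 \<or> j = i0")
        case False
        then have "dec j (dec i \<rho>) i0 > \<kappa> i0" using i0 False by (auto simp: dec_def)
        then have "c (dec j (dec i \<rho>)) = 0" unfolding c using not_le by auto
        then show ?thesis by (simp add: lower2_def)
      qed (use y0 in auto)
      show ?thesis unfolding form_def z by simp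
    qed
    then show ?thesis by (intro exI[of _ "unit_fun i0"]) blast
  next
    case True
    show ?thesis
    proof (cases "(\<Sum>i\<in>UNIV. \<rho> i) = k + 2")
      case False
      have "lower2 c \<rho> i j = 0" for i j
        using sum_dec[of \<rho> i] sum_dec[of "dec i \<rho>" j] False by (auto simp: lower2_def c)
      then show ?thesis by (simp add: form_def)
    next
      case sum: True
      define \<mu> where "\<mu> i = \<kappa> i - \<rho> i" for i
      have "(\<Sum>i\<in>UNIV. \<mu> i) = (\<Sum>i\<in>UNIV. \<kappa> i) - (\<Sum>i\<in>UNIV. \<rho> i)"
        unfolding \<mu>_def using True by (intro sum_subtractf_nat) auto
      moreover have "(\<Sum>i\<in>UNIV. \<rho> i) \<le> (\<Sum>i\<in>UNIV. \<kappa> i)" using True by (intro sum_mono) auto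
      ultimately have \<mu>: "(\<Sum>i\<in>UNIV. \<mu> i) + 2 = d" using sum \<kappa> by simp
      obtain l where l: "\<And>y. (\<Sum>i\<in>UNIV. l i * y i) = 0 \<Longrightarrow> form UNIV (\<lambda>i j. h (inc i (inc j \<mu>))) y y \<le> 0"
        using hess[OF \<mu>] by (auto simp: index_le_one_def)
      have "form UNIV (lower2 c \<rho>) y y \<le> form UNIV (\<lambda>i j. h (inc i (inc j \<mu>))) y y"
        if y: "\<forall>u. \<rho> u = 0 \<longrightarrow> y u = 0" for y
        unfolding form_def
      proof (intro sum_mono)
        fix i j
        show "lower2 c \<rho> i j * y i * y j \<le> h (inc i (inc j \<mu>)) * y i * y j"
        proof (cases "\<rho> i \<ge> 1 \<and> dec i \<rho> j \<ge> 1")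
          case ij: True
          have "(\<Sum>u\<in>UNIV. dec j (dec i \<rho>) u) = k"
            using sum_dec[of \<rho> i] sum_dec[of "dec i \<rho>" j] ij sum by simp
          moreover have "\<forall>u. dec j (dec i \<rho>) u \<le> \<kappa> u"
            using True dec_le[of j "dec i \<rho>"] dec_le[of i \<rho>] by (meson le_trans)
          moreover have "(\<lambda>u. \<kappa> u - dec j (dec i \<rho>) u) = inc i (inc j \<mu>)"
          proof
            fix u
            show "\<kappa> u - dec j (dec i \<rho>) u = inc i (inc j \<mu>) u"
              using ij True[rule_format, of u] by (auto simp: inc_def dec_def \<mu>_def split: if_splits)
          qed
          ultimately show ?thesis using ij by (simp add: lower2_def c)
        next
          case False
          then have "lower2 c \<rho> i j = 0" by (auto simp: lower2_def)
          moreover have "0 \<le> h (inc i (inc j \<mu>)) * y i * y j"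
          proof (cases "y i = 0 \<or> y j = 0")
            case ne: False
            then have "\<rho> i \<ge> 1" "\<rho> j \<ge> 1" using y by (auto simp: Suc_le_eq)
            \<comment> \<open>Where y does not vanish, the forms differ only at i = j with \<rho> i
              = 1: there \<open>lower2\<close> is 0 while the Hessian entry is nonnegative, so the
              discrepancy has the favourable sign.\<close>
            then have "i = j" using False by (auto simp: dec_def split: if_splits)
            moreover have "h (inc i (inc j \<mu>)) \<ge> 0" using \<mu> by (intro hnn) (simp add: sum_inc)
            ultimately show ?thesis by (simp add: mult.assoc)
          qed auto
          ultimately show ?thesis by simp
        qed
      qed
      then show ?thesis using l by (intro exI[of _ l]) (meson order_trans)
    qed
  qed
qed

section \<open>Derivatives of real polynomials\<close>

lemma coefficient_Const_mult: "coefficient (Const c * p) \<beta> = c * coefficient p \<beta>"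
  by (simp add: Const_def Poly_Mapping.map.rep_eq when_def flip: mult_map_scale_conv_mult)

lemma poly_mapping_eq_sum_single:
  fixes f :: "'a \<Rightarrow>\<^sub>0 'b::comm_monoid_add"
  shows "f = (\<Sum>\<alpha>\<in>Poly_Mapping.keys f. Poly_Mapping.single \<alpha> (Poly_Mapping.lookup f \<alpha>))"
  by (intro poly_mapping_eqI) (auto simp: lookup_sum lookup_single when_def in_keys_iff)

lemma coefficient_partial:
  "coefficient (partial i f) \<beta> = real (exponent \<beta> i + 1) * coefficient f (\<beta> + Poly_Mapping.single i 1)"
proof -
  let ?e = "Poly_Mapping.single i (1::nat)"
  have "(real (exponent \<alpha> i) * coefficient f \<alpha> when \<alpha> - ?e = \<beta>) =
      (if \<alpha> = \<beta> + ?e then real (exponent \<beta> i + 1) * coefficient f (\<beta> + ?e) else 0)" for \<alpha>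
  proof (cases "exponent \<alpha> i = 0")
    case False
    then have "\<alpha> - ?e + ?e = \<alpha>"
      by (intro poly_mapping_eqI) (auto simp: lookup_add lookup_minus lookup_single when_def)
    then have "\<alpha> - ?e = \<beta> \<longleftrightarrow> \<alpha> = \<beta> + ?e" by auto
    then show ?thesis by (auto simp: lookup_add)
  next
    case True
    then have "\<alpha> \<noteq> \<beta> + ?e" by (auto simp: lookup_add)
    then show ?thesis using True by simp
  qed
  then show ?thesis
    by (auto simp: partial_def lookup_sum lookup_single in_keys_iff)
qed

lemma partial_add: "partial i (f + g) = partial i f + partial i g"
  by (intro poly_mapping_eqI) (simp add: coefficient_partial lookup_add algebra_simps)

lemma partial_zero [simp]: "partial i 0 = 0"
  by (simp add: partial_def)

lemma partial_sum: "partial i (sum f A) = (\<Sum>a\<in>A. partial i (f a))"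
  by (induction A rule: infinite_finite_induct) (simp_all add: partial_add)

lemma partial_single:
  "partial i (Poly_Mapping.single \<alpha> a) =
    Poly_Mapping.single (\<alpha> - Poly_Mapping.single i 1) (real (exponent \<alpha> i) * a)"
  by (cases "a = 0") (simp_all add: partial_def)

lemma partial_mult_single:
  "partial i (Poly_Mapping.single \<alpha> a * Poly_Mapping.single \<beta> b) =
    partial i (Poly_Mapping.single \<alpha> a) * Poly_Mapping.single \<beta> b +
    Poly_Mapping.single \<alpha> a * partial i (Poly_Mapping.single \<beta> b)"
proof -
  let ?e = "Poly_Mapping.single i (1::nat)"
  have shift: "Poly_Mapping.single (\<alpha> + \<beta> - ?e) (real (exponent \<alpha> i) * c) =
      Poly_Mapping.single (\<alpha> - ?e + \<beta>) (real (exponent \<alpha> i) * c)" for \<alpha> \<beta> and c :: real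
  proof (cases "exponent \<alpha> i = 0")
    case False
    then have "\<alpha> + \<beta> - ?e = \<alpha> - ?e + \<beta>"
      by (intro poly_mapping_eqI) (auto simp: lookup_add lookup_minus lookup_single when_def)
    then show ?thesis by simp
  qed simp
  have "partial i (Poly_Mapping.single \<alpha> a * Poly_Mapping.single \<beta> b) =
    Poly_Mapping.single (\<alpha> + \<beta> - ?e) (real (exponent \<alpha> i) * (a * b)) +
    Poly_Mapping.single (\<beta> + \<alpha> - ?e) (real (exponent \<beta> i) * (a * b))"
    by (simp add: mult_single partial_single lookup_add algebra_simps flip: single_add)
  then show ?thesis
    unfolding shift by (simp add: mult_single partial_single mult_ac add_ac)
qed

lemma partial_mult: "partial i (f * g) = partial i f * g + f * partial i g"
proof -
  let ?s = "\<lambda>f \<alpha>. Poly_Mapping.single \<alpha> (coefficient f \<alpha>)"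
  have "partial i ((\<Sum>\<alpha>\<in>monomials f. ?s f \<alpha>) * (\<Sum>\<beta>\<in>monomials g. ?s g \<beta>)) =
    partial i (\<Sum>\<alpha>\<in>monomials f. ?s f \<alpha>) * (\<Sum>\<beta>\<in>monomials g. ?s g \<beta>) +
    (\<Sum>\<alpha>\<in>monomials f. ?s f \<alpha>) * partial i (\<Sum>\<beta>\<in>monomials g. ?s g \<beta>)"
    by (simp add: sum_product partial_sum partial_mult_single sum.distrib)
  then show ?thesis by (simp flip: poly_mapping_eq_sum_single)
qed

section \<open>The diagonal shift as a flow\<close>

definition diagonal_derivative :: "'v::finite rpoly \<Rightarrow> 'v rpoly" where
  "diagonal_derivative f = (\<Sum>i\<in>UNIV. partial i f)"

lemma diagonal_derivative_mult:
  "diagonal_derivative (f * g) = diagonal_derivative f * g + f * diagonal_derivative g"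
  by (simp add: diagonal_derivative_def partial_mult sum.distrib sum_distrib_left sum_distrib_right)

lemma diagonal_derivative_zero [simp]: "diagonal_derivative 0 = 0"
  by (simp add: diagonal_derivative_def)

lemma diagonal_derivative_sum: "diagonal_derivative (sum f A) = (\<Sum>a\<in>A. diagonal_derivative (f a))"
  unfolding diagonal_derivative_def partial_sum by (rule sum.swap)

text \<open>The equation dP/dt = D P with D the diagonal derivative, written for the coefficients in
  t. It passes from the factors \<open>[:Var i, 1:]\<close> and constants to products and sums, so
  the shift is never expanded binomially.\<close>

definition translation_flow :: "'v::finite rpoly poly \<Rightarrow> bool" where
  "translation_flow P \<longleftrightarrow> (\<forall>n. of_nat (Suc n) * coeff P (Suc n) = diagonal_derivative (coeff P n))"

lemma diagonal_derivative_add: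
  "diagonal_derivative (f + g) = diagonal_derivative f + diagonal_derivative g"
  by (simp add: diagonal_derivative_def partial_add sum.distrib)

text \<open>Write n + 1 = i + (n + 1 - i) in each term of the convolution and attach each part to
  its own factor; the boundary terms carry the factor 0, and the Leibniz rule for D reassembles the
  rest.\<close>

lemma translation_flow_mult:
  assumes P: "translation_flow P" and Q: "translation_flow Q"
  shows "translation_flow (P * Q)"
  unfolding translation_flow_def
proof
  fix n
  have "of_nat (Suc n) * coeff (P * Q) (Suc n) =
      (\<Sum>i\<le>Suc n. of_nat (i + (Suc n - i)) * (coeff P i * coeff Q (Suc n - i)))"
    unfolding coeff_mult sum_distrib_left by (intro sum.cong) auto
  also have "\<dots> = (\<Sum>i\<le>Suc n. (of_nat i * coeff P i) * coeff Q (Suc n - i)) +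
      (\<Sum>i\<le>Suc n. coeff P i * (of_nat (Suc n - i) * coeff Q (Suc n - i)))"
    by (simp only: of_nat_add ring_distribs sum.distrib mult_ac)
  also have "(\<Sum>i\<le>Suc n. (of_nat i * coeff P i) * coeff Q (Suc n - i)) =
      (\<Sum>i\<le>n. diagonal_derivative (coeff P i) * coeff Q (n - i))"
    unfolding sum.atMost_Suc_shift using P by (simp add: translation_flow_def del: of_nat_Suc)
  also have "(\<Sum>i\<le>Suc n. coeff P i * (of_nat (Suc n - i) * coeff Q (Suc n - i))) =
      (\<Sum>i\<le>n. coeff P i * diagonal_derivative (coeff Q (n - i)))"
  proof -
    have "of_nat (Suc n - i) * coeff Q (Suc n - i) = diagonal_derivative (coeff Q (n - i))" if "i \<le> n" for i
      using Q Suc_diff_le[OF that] by (simp only: translation_flow_def)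
    then have "(\<Sum>i\<le>n. coeff P i * (of_nat (Suc n - i) * coeff Q (Suc n - i))) =
        (\<Sum>i\<le>n. coeff P i * diagonal_derivative (coeff Q (n - i)))"
      by (intro sum.cong refl) (simp only: atMost_iff)
    then show ?thesis unfolding sum.atMost_Suc by simp
  qed
  also have "(\<Sum>i\<le>n. diagonal_derivative (coeff P i) * coeff Q (n - i)) +
      (\<Sum>i\<le>n. coeff P i * diagonal_derivative (coeff Q (n - i))) = diagonal_derivative (coeff (P * Q) n)"
    by (simp add: coeff_mult diagonal_derivative_sum diagonal_derivative_mult sum.distrib)
  finally show "of_nat (Suc n) * coeff (P * Q) (Suc n) = diagonal_derivative (coeff (P * Q) n)" .
qed

lemma translation_flow_Const: "translation_flow [:Const c:]"
proof -
  have "diagonal_derivative (Const c :: 'a rpoly) = 0"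
    by (simp add: diagonal_derivative_def Const_def partial_single)
  then show ?thesis by (simp add: translation_flow_def coeff_pCons split: nat.split)
qed

lemma Const_one: "Const 1 = 1"
  by (simp add: Const_def)

lemma translation_flow_one: "translation_flow 1"
  using translation_flow_Const[of 1] by (simp add: Const_one one_pCons)

lemma translation_flow_Var: "translation_flow [:Var i, 1:]"
proof -
  have "partial j (Var i :: 'a rpoly) = (if j = i then 1 else 0)" for j
    by (simp add: Var_def partial_single lookup_single when_def)
  then have "diagonal_derivative (Var i :: 'a rpoly) = 1"
    by (simp add: diagonal_derivative_def)
  moreover have "diagonal_derivative (1 :: 'a rpoly) = 0"
    by (simp add: diagonal_derivative_def partial_single flip: single_one)
  ultimately show ?thesis by (simp add: translation_flow_def coeff_pCons split: nat.split)
qed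

lemma translation_flow_power: "translation_flow P \<Longrightarrow> translation_flow (P ^ n)"
  by (induction n) (simp_all add: translation_flow_one translation_flow_mult)

lemma translation_flow_prod: "(\<And>a. a \<in> A \<Longrightarrow> translation_flow (P a)) \<Longrightarrow> translation_flow (prod P A)"
  by (induction A rule: infinite_finite_induct) (simp_all add: translation_flow_one translation_flow_mult)

lemma translation_flow_sum: "(\<And>a. a \<in> A \<Longrightarrow> translation_flow (P a)) \<Longrightarrow> translation_flow (sum P A)"
  by (induction A rule: infinite_finite_induct)
    (simp_all add: translation_flow_def diagonal_derivative_add distrib_left)

lemma translation_flow_diagonal_shift: "translation_flow (diagonal_shift f)"
  unfolding diagonal_shift_def
  by (intro translation_flow_sum translation_flow_mult translation_flow_prod translation_flow_power
      translation_flow_Const translation_flow_Var)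

lemma coefficient_derived_Suc:
  "real (Suc n) * coefficient (derived f (Suc n)) \<beta> =
    (\<Sum>i\<in>UNIV. real (exponent \<beta> i + 1) * coefficient (derived f n) (\<beta> + Poly_Mapping.single i 1))"
proof -
  have "of_nat (Suc n) * derived f (Suc n) = diagonal_derivative (derived f n)"
    using translation_flow_diagonal_shift[of f] by (simp add: translation_flow_def derived_def)
  then have "coefficient (of_nat (Suc n) * derived f (Suc n)) \<beta> = coefficient (diagonal_derivative (derived f n)) \<beta>"
    by simp
  moreover have "(of_nat m :: 'a rpoly) = Const (real m)" for m
    by (induction m) (simp_all add: Const_def single_add single_one)
  ultimately show ?thesis
    by (simp only: coefficient_Const_mult) (simp add: diagonal_derivative_def lookup_sum coefficient_partial)
qed

lemma coefficient_derived_0: "coefficient (derived f 0) \<beta> = coefficient f \<beta>"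
proof -
  have coeff_0_power: "coeff (P ^ n) 0 = coeff P 0 ^ n" for P :: "'a rpoly poly" and n
    by (induction n) (simp_all add: coeff_mult)
  have coeff_0_prod: "coeff (prod P A) 0 = (\<Prod>a\<in>A. coeff (P a) 0)" for P :: "'a \<Rightarrow> 'a rpoly poly" and A
    by (induction A rule: infinite_finite_induct) (simp_all add: coeff_mult)
  have pow: "(Var i :: 'a rpoly) ^ n = Poly_Mapping.single (Poly_Mapping.single i n) 1" for i n
    by (induction n) (simp_all add: Var_def mult_single flip: single_add)
  have "(\<Prod>i\<in>A. Var i ^ exponent \<alpha> i :: 'a rpoly) =
      Poly_Mapping.single (\<Sum>i\<in>A. Poly_Mapping.single i (exponent \<alpha> i)) 1" if "finite A" for A \<alpha>
    using that by (induction A rule: finite_induct) (simp_all add: pow mult_single)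
  moreover have "(\<Sum>i\<in>UNIV. Poly_Mapping.single i (exponent \<alpha> i)) = \<alpha>" for \<alpha> :: "'a monomial"
    by (intro poly_mapping_eqI) (simp add: lookup_sum lookup_single when_def)
  ultimately have "(\<Prod>i\<in>UNIV. Var i ^ exponent \<alpha> i :: 'a rpoly) = Poly_Mapping.single \<alpha> 1" for \<alpha>
    by simp
  then have "derived f 0 = (\<Sum>\<alpha>\<in>monomials f. Poly_Mapping.single \<alpha> (coefficient f \<alpha>))"
    by (simp add: derived_def diagonal_shift_def coeff_sum coeff_mult coeff_0_prod coeff_0_power Const_def mult_single)
  then show ?thesis by (simp flip: poly_mapping_eq_sum_single)
qed

text \<open>Working with derivatives at 0 instead of coefficients makes a partial derivative a plain
  shift by \<open>inc\<close>, without numerical factors.\<close>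

definition deriv_at_0 :: "'v::finite rpoly \<Rightarrow> ('v \<Rightarrow> nat) \<Rightarrow> real" where
  "deriv_at_0 p \<beta> = (\<Prod>i\<in>UNIV. fact (\<beta> i)) * coefficient p (Abs_poly_mapping \<beta>)"

lemma lookup_Abs_finite [simp]: "Poly_Mapping.lookup (Abs_poly_mapping (\<beta> :: 'v::finite \<Rightarrow> nat)) = \<beta>"
  by (intro lookup_Abs_poly_mapping) simp

lemma Abs_poly_mapping_inc:
  "Abs_poly_mapping (inc i \<beta>) = Abs_poly_mapping \<beta> + Poly_Mapping.single i (1::nat)" for \<beta> :: "'v::finite \<Rightarrow> nat"
  by (intro poly_mapping_eqI) (simp add: lookup_add lookup_single when_def inc_def)

lemma prod_fact_inc: "(\<Prod>w\<in>UNIV. fact (inc u \<alpha> w)) = real (\<alpha> u + 1) * (\<Prod>w\<in>UNIV. fact (\<alpha> w))"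
  for \<alpha> :: "'w::finite \<Rightarrow> nat"
  using prod_fact_dec[of "inc u \<alpha>" u] by (simp add: dec_inc) (simp add: inc_def)

lemma deriv_at_0_inc:
  "deriv_at_0 p (inc i \<beta>) = (\<Prod>i\<in>UNIV. fact (\<beta> i)) *
     (real (\<beta> i + 1) * coefficient p (Abs_poly_mapping \<beta> + Poly_Mapping.single i 1))"
  by (simp add: deriv_at_0_def prod_fact_inc Abs_poly_mapping_inc)

lemma deriv_at_0_partial: "deriv_at_0 (partial i p) \<beta> = deriv_at_0 p (inc i \<beta>)"
  unfolding deriv_at_0_inc by (simp add: deriv_at_0_def coefficient_partial)

lemma deriv_at_0_derived_Suc:
  "real (Suc n) * deriv_at_0 (derived f (Suc n)) \<beta> = (\<Sum>i\<in>UNIV. deriv_at_0 (derived f n) (inc i \<beta>))"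
proof -
  have "real (Suc n) * deriv_at_0 (derived f (Suc n)) \<beta> =
      (\<Prod>i\<in>UNIV. fact (\<beta> i)) * (real (Suc n) * coefficient (derived f (Suc n)) (Abs_poly_mapping \<beta>))"
    by (simp only: deriv_at_0_def mult_ac)
  then show ?thesis
    unfolding deriv_at_0_inc coefficient_derived_Suc by (simp add: sum_distrib_left)
qed

lemma deriv_at_0_derived_0: "deriv_at_0 (derived f 0) = deriv_at_0 f"
  by (simp add: deriv_at_0_def coefficient_derived_0 fun_eq_iff)

definition dir_op :: "('v::finite \<Rightarrow> real) \<Rightarrow> (('v \<Rightarrow> nat) \<Rightarrow> real) \<Rightarrow> ('v \<Rightarrow> nat) \<Rightarrow> real" where
  "dir_op w \<phi> \<beta> = (\<Sum>i\<in>UNIV. w i * \<phi> (inc i \<beta>))"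

lemma deriv_at_0_directional: "deriv_at_0 (directional v p) = dir_op (($) v) (deriv_at_0 p)"
proof
  fix \<beta>
  have "deriv_at_0 (directional v p) \<beta> = (\<Sum>i\<in>UNIV. v $ i * deriv_at_0 (partial i p) \<beta>)"
  proof -
    have "coefficient (directional v p) \<alpha> = (\<Sum>i\<in>UNIV. v $ i * coefficient (partial i p) \<alpha>)" for \<alpha>
      by (simp add: directional_def lookup_sum coefficient_Const_mult)
    then show ?thesis by (simp add: deriv_at_0_def sum_distrib_left mult_ac)
  qed
  then show "deriv_at_0 (directional v p) \<beta> = dir_op (($) v) (deriv_at_0 p) \<beta>"
    by (simp add: dir_op_def deriv_at_0_partial)
qed

lemma deriv_at_0_directionals:
  "deriv_at_0 (directionals vs p) = foldr dir_op (map ($) vs) (deriv_at_0 p)"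
  by (induction vs) (simp_all add: directionals_def deriv_at_0_directional)

lemma coefficient_0_eq_deriv_at_0: "coefficient p 0 = deriv_at_0 p (\<lambda>_. 0)"
  by (simp add: deriv_at_0_def zero_poly_mapping_def[symmetric])

text \<open>The factorials of the normalization cancel those of \<open>deriv_at_0\<close>, so
  derivatives of the dual at 0 are plain coefficients of f at the complementary exponent.\<close>

lemma deriv_at_0_dual:
  assumes "degree_bounded \<kappa> f"
  shows "deriv_at_0 (dual \<kappa> f) \<mu> =
    (if \<forall>i. \<mu> i \<le> exponent \<kappa> i then coefficient f (Abs_poly_mapping (\<lambda>i. exponent \<kappa> i - \<mu> i)) else 0)"
proof -
  let ?\<mu> = "Abs_poly_mapping \<mu>" and ?\<nu> = "Abs_poly_mapping (\<lambda>i. exponent \<kappa> i - \<mu> i)"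
  have "coefficient (normalization_op p) \<alpha> = coefficient p \<alpha> / (\<Prod>i\<in>UNIV. fact (exponent \<alpha> i))" for p :: "'a rpoly" and \<alpha>
    by (auto simp: normalization_op_def lookup_sum lookup_single when_def in_keys_iff)
  then have "deriv_at_0 (dual \<kappa> f) \<mu> = coefficient (reversal \<kappa> f) ?\<mu>"
    by (simp add: deriv_at_0_def dual_def)
  also have "\<dots> = (\<Sum>\<alpha>\<in>monomials f. coefficient f \<alpha> when \<kappa> - \<alpha> = ?\<mu>)"
    by (simp add: reversal_def lookup_sum lookup_single)
  also have "\<dots> = (\<Sum>\<alpha>\<in>monomials f. if \<alpha> = ?\<nu> then (if \<forall>i. \<mu> i \<le> exponent \<kappa> i then coefficient f ?\<nu> else 0) else 0)"
  proof (rule sum.cong[OF refl])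
    fix \<alpha> assume "\<alpha> \<in> monomials f"
    then have le: "exponent \<alpha> i \<le> exponent \<kappa> i" for i
      using assms by (simp add: degree_bounded_def)
    have "\<kappa> - \<alpha> = ?\<mu> \<longleftrightarrow> (\<forall>i. exponent \<kappa> i - exponent \<alpha> i = \<mu> i)"
      by (simp add: poly_mapping_eq_iff fun_eq_iff lookup_minus)
    moreover have "\<alpha> = ?\<nu> \<longleftrightarrow> (\<forall>i. exponent \<alpha> i = exponent \<kappa> i - \<mu> i)"
      by (simp add: poly_mapping_eq_iff fun_eq_iff)
    moreover have "exponent \<kappa> i - exponent \<alpha> i = \<mu> i \<longleftrightarrow> \<mu> i \<le> exponent \<kappa> i \<and> exponent \<alpha> i = exponent \<kappa> i - \<mu> i" for i
      using le[of i] by auto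
    ultimately have "\<kappa> - \<alpha> = ?\<mu> \<longleftrightarrow> (\<forall>i. \<mu> i \<le> exponent \<kappa> i) \<and> \<alpha> = ?\<nu>" by auto
    then show "(coefficient f \<alpha> when \<kappa> - \<alpha> = ?\<mu>) =
        (if \<alpha> = ?\<nu> then (if \<forall>i. \<mu> i \<le> exponent \<kappa> i then coefficient f ?\<nu> else 0) else 0)"
      by (auto simp: when_def)
  qed
  also have "\<dots> = (if \<forall>i. \<mu> i \<le> exponent \<kappa> i then coefficient f ?\<nu> else 0)"
    by (auto simp: in_keys_iff)
  finally show ?thesis .
qed

text \<open>A form without the property is positive somewhere on every hyperplane. Maximising twice,
  the second time orthogonally to the first eigenvector, gives two orthogonal eigenvectors with
  positive eigenvalues. These contribute 2 to the count, through two distinct eigenvalues or through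
  an eigenspace of dimension at least two.\<close>

lemma index_le_one_if_num_positive_eigenvalues:
  fixes A :: "real ^ 'v ^ 'v::finite"
  assumes sym: "transpose A = A" and num: "num_positive_eigenvalues A \<le> 1"
  shows "index_le_one UNIV (\<lambda>i j. A $ i $ j)"
proof (rule ccontr)
  let ?H = "\<lambda>i j. A $ i $ j"
  assume neg: "\<not> index_le_one UNIV ?H"
  have symH: "symmetric_on UNIV ?H"
    using sym by (auto simp: symmetric_on_def transpose_def vec_eq_iff)
  \<comment> \<open>The factor 1 is the weight D of \<open>generalised_eigenvector_exists\<close>,
    here that of the standard inner product.\<close>
  have bad: "\<exists>x. (\<Sum>i\<in>UNIV. 1 * l i * x i) = 0 \<and> form UNIV ?H x x > 0" for l
    using neg unfolding index_le_one_def by (force simp: not_le)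
  have eigen: "(\<chi> i. w i) \<noteq> 0 \<and> (\<chi> i. w i) \<in> eigenspace A ev"
    if "\<exists>i\<in>UNIV. w i \<noteq> 0" "\<forall>i\<in>UNIV. (\<Sum>j\<in>UNIV. ?H i j * w j) = ev * 1 * w i" for w ev
    using that by (auto simp: eigenspace_def vec_eq_iff matrix_vector_mult_def)
  obtain x where x: "(\<Sum>i\<in>UNIV. 1 * 0 * x i) = 0" "form UNIV ?H x x > 0"
    using bad[of "\<lambda>_. 0"] by auto
  have "\<exists>w ev. ev > 0 \<and> (\<exists>i\<in>UNIV. w i \<noteq> 0) \<and> (\<Sum>i\<in>UNIV. 1 * 0 * w i) = 0 \<and>
      (\<forall>i\<in>UNIV. (\<Sum>j\<in>UNIV. ?H i j * w j) = ev * 1 * w i)"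
    by (rule generalised_eigenvector_exists[OF finite symH _ _ x]) simp_all
  then obtain w1 e1 where e1: "e1 > 0" and w1: "\<exists>i\<in>UNIV. w1 i \<noteq> 0"
    "\<forall>i\<in>UNIV. (\<Sum>j\<in>UNIV. ?H i j * w1 j) = e1 * 1 * w1 i" by blast
  obtain z where z: "(\<Sum>i\<in>UNIV. 1 * w1 i * z i) = 0" "form UNIV ?H z z > 0" using bad by blast
  have "\<exists>w ev. ev > 0 \<and> (\<exists>i\<in>UNIV. w i \<noteq> 0) \<and> (\<Sum>i\<in>UNIV. 1 * w1 i * w i) = 0 \<and>
      (\<forall>i\<in>UNIV. (\<Sum>j\<in>UNIV. ?H i j * w j) = ev * 1 * w i)"
    by (rule generalised_eigenvector_exists[OF finite symH _ _ z, of e1]) (use w1 in simp_all)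
  then obtain w2 e2 where e2: "e2 > 0" and w2: "\<exists>i\<in>UNIV. w2 i \<noteq> 0" 
    "\<forall>i\<in>UNIV. (\<Sum>j\<in>UNIV. ?H i j * w2 j) = e2 * 1 * w2 i"
    and perp: "(\<Sum>i\<in>UNIV. 1 * w1 i * w2 i) = 0" by blast
  define v1 v2 where "v1 = (\<chi> i. w1 i)" and "v2 = (\<chi> i. w2 i)"
  have v1: "v1 \<noteq> 0" "v1 \<in> eigenspace A e1" and v2: "v2 \<noteq> 0" "v2 \<in> eigenspace A e2"
    using eigen[OF w1] eigen[OF w2] by (simp_all add: v1_def v2_def)
  have orth: "v1 \<bullet> v2 = 0" using perp by (simp add: inner_vec_def v1_def v2_def)
  have pos: "e1 \<in> positive_eigenvalues A" "e2 \<in> positive_eigenvalues A"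
    using e1 e2 v1 v2 by (auto simp: positive_eigenvalues_def)
  have sub: "sum (\<lambda>l. dim (eigenspace A l)) {e1, e2} \<le> num_positive_eigenvalues A"
    unfolding num_positive_eigenvalues_def
    using finite_positive_eigenvalues[OF sym] pos by (intro sum_mono2) auto
  have dim1: "dim (eigenspace A l) \<ge> 1" if "v \<noteq> 0" "v \<in> eigenspace A l" for v l
  proof -
    have "dim {v} \<le> dim (eigenspace A l)" using that by (intro dim_subset) auto
    then show ?thesis using that by (simp add: dim_singleton)
  qed
  show False
  proof (cases "e1 = e2")
    case False
    then show False using sub num dim1[OF v1] dim1[OF v2] by simp
  next
    case True
    have ne: "v1 \<noteq> v2" using orth v1 by auto
    have "independent {v1, v2}"
      using orth v1 v2 by (intro pairwise_orthogonal_independent)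
        (auto simp: pairwise_def orthogonal_def inner_commute)
    then have "card {v1, v2} \<le> dim (eigenspace A e1)"
      using v1 v2 True by (intro independent_card_le_dim) auto
    then show False using sub num True ne by simp
  qed
qed

section \<open>From Lorentzian duals to local conditions\<close>

lemma inc_commute: "inc u (inc v \<alpha>) = inc v (inc u \<alpha>)"
  by (auto simp: inc_def fun_eq_iff)

lemma dir_op_commute: "dir_op v (dir_op w \<phi>) = dir_op w (dir_op v \<phi>)"
proof
  fix \<beta>
  have "dir_op v (dir_op w \<phi>) \<beta> = (\<Sum>i\<in>UNIV. \<Sum>j\<in>UNIV. v i * (w j * \<phi> (inc j (inc i \<beta>))))"
    by (simp add: dir_op_def sum_distrib_left)
  also have "\<dots> = (\<Sum>j\<in>UNIV. \<Sum>i\<in>UNIV. v i * (w j * \<phi> (inc j (inc i \<beta>))))"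
    by (rule sum.swap)
  also have "\<dots> = dir_op w (dir_op v \<phi>) \<beta>"
    by (simp add: dir_op_def sum_distrib_left inc_commute mult_ac)
  finally show "dir_op v (dir_op w \<phi>) \<beta> = dir_op w (dir_op v \<phi>) \<beta>" .
qed

section \<open>Iterated directional derivatives\<close>

lemma foldr_mset_eq:
  assumes "\<And>x y. f x \<circ> f y = f y \<circ> f x" "mset xs = mset ys"
  shows "foldr f xs = foldr f ys"
  unfolding foldr_conv_fold using assms by (intro fold_multiset_equiv) auto

definition index_list :: "'v::finite list" where
  "index_list = (SOME xs. set xs = UNIV \<and> distinct xs)"

lemma index_list: "set (index_list :: 'v::finite list) = UNIV" "distinct (index_list :: 'v list)"
  using someI_ex[OF finite_distinct_list[OF finite[of "UNIV :: 'v set"]]]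
  unfolding index_list_def by auto

definition direction_list :: "('v::finite \<Rightarrow> 'a) \<Rightarrow> ('v \<Rightarrow> nat) \<Rightarrow> 'a list" where
  "direction_list w \<mu> = concat (map (\<lambda>i. replicate (\<mu> i) (w i)) index_list)"

lemma set_direction_list: "set (direction_list w \<mu>) \<subseteq> range w"
  by (auto simp: direction_list_def)

lemma length_direction_list: "length (direction_list w \<mu>) = (\<Sum>i\<in>UNIV. \<mu> i)"
  by (simp add: direction_list_def length_concat comp_def index_list
      sum_list_distinct_conv_sum_set flip: index_list(1))

lemma map_direction_list: "map g (direction_list w \<mu>) = direction_list (\<lambda>i. g (w i)) \<mu>"
  by (simp add: direction_list_def map_concat comp_def)

lemma mset_direction_list_inc: "mset (direction_list w (inc i \<mu>)) = add_mset (w i) (mset (direction_list w \<mu>))"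
proof -
  have "mset (concat (map (\<lambda>j. replicate (inc i \<mu> j) (w j)) xs)) =
      mset (concat (map (\<lambda>j. replicate (\<mu> j) (w j)) xs)) + (if i \<in> set xs then {#w i#} else {#})"
    if "distinct xs" for xs
    using that by (induction xs) (auto simp: inc_def)
  from this[OF index_list(2)] show ?thesis by (simp only: direction_list_def index_list(1)) simp
qed

text \<open>The derivative at 0 with exponent \<mu> after the linear substitution sending x to sum_i
  x_i w_i. The order inside \<open>direction_list\<close> is immaterial, as directional derivatives
  commute.\<close>

definition mixed_derivative :: "('v::finite \<Rightarrow> 'v \<Rightarrow> real) \<Rightarrow> (('v \<Rightarrow> nat) \<Rightarrow> real) \<Rightarrow> ('v \<Rightarrow> nat) \<Rightarrow> real" where
  "mixed_derivative w \<phi> \<mu> = foldr dir_op (direction_list w \<mu>) \<phi> (\<lambda>_. 0)"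

lemma mixed_derivative_inc_inc:
  "mixed_derivative w \<phi> (inc i (inc j \<mu>)) =
    dir_op (w i) (dir_op (w j) (foldr dir_op (direction_list w \<mu>) \<phi>)) (\<lambda>_. 0)"
proof -
  have "foldr dir_op (direction_list w (inc i (inc j \<mu>))) = foldr dir_op (w i # w j # direction_list w \<mu>)"
    by (rule foldr_mset_eq) (auto simp: fun_eq_iff dir_op_commute mset_direction_list_inc)
  then show ?thesis by (simp add: mixed_derivative_def)
qed

lemma dir_op_unit_fun: "dir_op (unit_fun i) \<phi> \<beta> = \<phi> (inc i \<beta>)"
proof -
  have "dir_op (unit_fun i) \<phi> \<beta> = (\<Sum>j\<in>UNIV. if j = i then \<phi> (inc j \<beta>) else 0)"
    unfolding dir_op_def unit_fun_def by (intro sum.cong) auto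
  then show ?thesis by simp
qed

lemma mixed_derivative_unit_fun: "mixed_derivative unit_fun \<phi> \<mu> = \<phi> \<mu>"
proof -
  have rep: "foldr dir_op (replicate n (unit_fun i)) \<psi> \<beta> = \<psi> (\<lambda>u. \<beta> u + (if u = i then n else 0))"
    for n i \<psi> and \<beta> :: "'a \<Rightarrow> nat"
    by (induction n arbitrary: \<beta>) (auto simp: dir_op_unit_fun inc_def simp del: foldr_replicate intro!: arg_cong[of _ _ \<psi>])
  have "foldr dir_op (concat (map (\<lambda>i. replicate (\<mu> i) (unit_fun i)) xs)) \<phi> \<beta> =
      \<phi> (\<lambda>u. \<beta> u + (if u \<in> set xs then \<mu> u else 0))" if "distinct xs" for xs \<beta>
    using that
    by (induction xs arbitrary: \<beta>) (auto simp: rep simp del: foldr_replicate intro!: arg_cong[of _ _ \<phi>])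
  from this[OF index_list(2)] show ?thesis
    by (simp only: mixed_derivative_def direction_list_def index_list(1)) simp
qed

lemma foldr_dir_op_nonneg:
  "(\<And>w i. w \<in> set ws \<Longrightarrow> w i \<ge> 0) \<Longrightarrow> (\<And>\<mu>. \<phi> \<mu> \<ge> 0) \<Longrightarrow> foldr dir_op ws \<phi> \<beta> \<ge> 0"
  by (induction ws arbitrary: \<beta>) (auto simp: dir_op_def intro!: sum_nonneg)

lemma foldr_dir_op_pos:
  assumes "\<And>w i. w \<in> set ws \<Longrightarrow> w i > 0" "\<And>\<mu>. \<phi> \<mu> \<ge> 0" "\<phi> \<mu> > 0"
    and "\<And>i. \<beta> i \<le> \<mu> i" "(\<Sum>i\<in>UNIV. \<mu> i) = (\<Sum>i\<in>UNIV. \<beta> i) + length ws"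
  shows "foldr dir_op ws \<phi> \<beta> > 0"
  using assms
proof (induction ws arbitrary: \<beta>)
  case Nil
  have "\<mu> = \<beta>"
  proof (rule ccontr)
    assume "\<mu> \<noteq> \<beta>"
    then obtain i where "\<mu> i \<noteq> \<beta> i" by auto
    then have "\<beta> i < \<mu> i" using Nil.prems(4)[of i] by simp
    then have "(\<Sum>i\<in>UNIV. \<beta> i) < (\<Sum>i\<in>UNIV. \<mu> i)"
      using Nil.prems(4) by (intro sum_strict_mono_ex1) auto
    then show False using Nil.prems(5) by simp
  qed
  then show ?case using Nil by simp
next
  case (Cons w ws)
  have "\<exists>i. \<beta> i < \<mu> i"
  proof (rule ccontr)
    assume "\<not> ?thesis"
    then have "(\<Sum>i\<in>UNIV. \<mu> i) \<le> (\<Sum>i\<in>UNIV. \<beta> i)" by (intro sum_mono) (simp add: not_less)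
    then show False using Cons.prems(5) by simp
  qed
  then obtain i where i: "\<beta> i < \<mu> i" by blast
  have "foldr dir_op ws \<phi> (inc i \<beta>) > 0"
    using Cons.prems i sum_inc[of i \<beta>] by (intro Cons.IH) (auto simp: inc_def)
  moreover have "foldr dir_op ws \<phi> (inc j \<beta>) \<ge> 0" for j
    using Cons.prems by (intro foldr_dir_op_nonneg) (auto simp: less_imp_le)
  ultimately show ?case
    using Cons.prems(1) unfolding foldr_Cons comp_apply dir_op_def
    by (intro sum_pos2[of UNIV i]) (auto simp: less_imp_le)
qed

lemma foldr_dir_op_continuous:
  fixes fs :: "(real \<Rightarrow> 'v::finite \<Rightarrow> real) list"
  assumes "\<And>f i. f \<in> set fs \<Longrightarrow> continuous_on A (\<lambda>t. f t i)"
  shows "continuous_on A (\<lambda>t. foldr dir_op (map (\<lambda>f. f t) fs) \<phi> \<beta>)"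
  using assms by (induction fs arbitrary: \<beta>) (auto simp: dir_op_def intro!: continuous_intros)

text \<open>The matrix represents N pulled back along the linear map sending x to sum_i x_i w_i, and
  the functional l pulls back along the same map.\<close>

lemma index_le_one_pullback:
  assumes "index_le_one UNIV (N :: 'a::finite \<Rightarrow> 'a \<Rightarrow> real)"
  shows "index_le_one UNIV (\<lambda>i j :: 'b::finite. \<Sum>a\<in>UNIV. \<Sum>b\<in>UNIV. w i a * w j b * N a b)"
proof -
  obtain l where l: "\<And>x. (\<Sum>i\<in>UNIV. l i * x i) = 0 \<Longrightarrow> form UNIV N x x \<le> 0"
    using assms by (auto simp: index_le_one_def)
  define L where "L x a = (\<Sum>i\<in>UNIV. x i * w i a)" for x :: "'b \<Rightarrow> real" and a
  have "form UNIV (\<lambda>i j. \<Sum>a\<in>UNIV. \<Sum>b\<in>UNIV. w i a * w j b * N a b) x x = form UNIV N (L x) (L x)" for x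
  proof -
    have "form UNIV N (L x) (L x) = (\<Sum>a\<in>UNIV. \<Sum>b\<in>UNIV. \<Sum>i\<in>UNIV. \<Sum>j\<in>UNIV. w i a * w j b * N a b * x i * x j)"
      unfolding form_def
    proof (intro sum.cong refl)
      fix a b
      have "N a b * L x a * L x b = N a b * ((\<Sum>i\<in>UNIV. x i * w i a) * (\<Sum>j\<in>UNIV. x j * w j b))"
        by (simp add: L_def)
      also have "\<dots> = (\<Sum>i\<in>UNIV. \<Sum>j\<in>UNIV. N a b * ((x i * w i a) * (x j * w j b)))"
        by (subst sum_product) (simp only: sum_distrib_left)
      finally show "N a b * L x a * L x b = (\<Sum>i\<in>UNIV. \<Sum>j\<in>UNIV. w i a * w j b * N a b * x i * x j)"
        by (simp only: mult_ac)
    qed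
    also have "\<dots> = (\<Sum>a\<in>UNIV. \<Sum>i\<in>UNIV. \<Sum>b\<in>UNIV. \<Sum>j\<in>UNIV. w i a * w j b * N a b * x i * x j)"
      by (intro sum.cong refl sum.swap)
    also have "\<dots> = (\<Sum>i\<in>UNIV. \<Sum>a\<in>UNIV. \<Sum>b\<in>UNIV. \<Sum>j\<in>UNIV. w i a * w j b * N a b * x i * x j)"
      by (rule sum.swap)
    also have "\<dots> = (\<Sum>i\<in>UNIV. \<Sum>a\<in>UNIV. \<Sum>j\<in>UNIV. \<Sum>b\<in>UNIV. w i a * w j b * N a b * x i * x j)"
      by (intro sum.cong refl sum.swap)
    also have "\<dots> = (\<Sum>i\<in>UNIV. \<Sum>j\<in>UNIV. \<Sum>a\<in>UNIV. \<Sum>b\<in>UNIV. w i a * w j b * N a b * x i * x j)"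
      by (intro sum.cong refl sum.swap)
    finally show ?thesis by (simp add: form_def sum_distrib_right)
  qed
  moreover have "(\<Sum>i\<in>UNIV. (\<Sum>a\<in>UNIV. l a * w i a) * x i) = (\<Sum>a\<in>UNIV. l a * L x a)" for x
    unfolding L_def sum_distrib_left sum_distrib_right by (subst sum.swap) (simp add: mult_ac)
  ultimately show ?thesis
    unfolding index_le_one_def using l by (intro exI[of _ "\<lambda>i. \<Sum>a\<in>UNIV. l a * w i a"]) auto
qed

lemma lorentzian_deriv_nonneg:
  assumes g: "lorentzian_of_degree d g" and ws: "length ws = d" "\<And>w i. w \<in> set ws \<Longrightarrow> w i \<ge> 0"
    and ne: "\<And>w. w \<in> set ws \<Longrightarrow> \<exists>i. w i \<noteq> 0"
  shows "foldr dir_op ws (deriv_at_0 g) (\<lambda>_. 0) \<ge> 0"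
proof -
  have "length (map vec_lambda ws) = d" using ws by simp
  moreover have "set (map vec_lambda ws) \<subseteq> nonneg_nonzero"
    using ws ne by (auto simp: nonneg_nonzero_def vec_eq_iff)
  ultimately have "coefficient (directionals (map vec_lambda ws) g) 0 \<ge> 0"
    using g unfolding lorentzian_of_degree_def by blast
  then show ?thesis
    by (simp add: coefficient_0_eq_deriv_at_0 deriv_at_0_directionals comp_def vec_lambda_inverse)
qed

lemma lorentzian_hessian_index:
  assumes g: "lorentzian_of_degree d g" and ws: "length ws + 2 = d" "\<And>w i. w \<in> set ws \<Longrightarrow> w i \<ge> 0"
    and ne: "\<And>w. w \<in> set ws \<Longrightarrow> \<exists>i. w i \<noteq> 0"
  shows "index_le_one UNIV
    (\<lambda>i j. dir_op (unit_fun i) (dir_op (unit_fun j) (foldr dir_op ws (deriv_at_0 g))) (\<lambda>_. 0))"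
proof -
  let ?A = "gram_matrix (\<lambda>x y. coefficient (directional x (directional y (directionals (map vec_lambda ws) g))) 0)"
  have "length (map vec_lambda ws) = d - 2" "d \<ge> 2" using ws by auto
  moreover have "set (map vec_lambda ws) \<subseteq> nonneg_nonzero"
    using ws ne by (auto simp: nonneg_nonzero_def vec_eq_iff)
  ultimately have num: "num_positive_eigenvalues ?A \<le> 1"
    using g unfolding lorentzian_of_degree_def by blast
  have "(($) (axis i 1)) = (unit_fun i :: 'a \<Rightarrow> real)" for i
    by (auto simp: unit_fun_def axis_def fun_eq_iff)
  then have A: "?A $ i $ j = dir_op (unit_fun i) (dir_op (unit_fun j) (foldr dir_op ws (deriv_at_0 g))) (\<lambda>_. 0)" for i j
    by (simp add: gram_matrix_def coefficient_0_eq_deriv_at_0 deriv_at_0_directional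
        deriv_at_0_directionals comp_def vec_lambda_inverse)
  have "transpose ?A = ?A"
    unfolding transpose_def by (simp add: vec_eq_iff A) (simp add: dir_op_commute[of "unit_fun _" "unit_fun _"])
  then show ?thesis using index_le_one_if_num_positive_eigenvalues[OF _ num] by (simp add: A)
qed

text \<open>
  \<open>C t\<close> comes from the dual polynomial after the positive change of variables
  \<open>x \<mapsto> x + t (\<Sum>\<^sub>i x\<^sub>i) (1, \<dots>, 1)\<close>, which makes all its coefficients positive.
\<close>

lemma dually_lorentzian_approximation:
  fixes f :: "'r::finite rpoly"
  assumes f: "f \<noteq> 0" "homogeneous k f" "degree_bounded \<kappa> f" and lor: "lorentzian_of_degree d (dual \<kappa> f)"
  obtains C :: "real \<Rightarrow> ('r \<Rightarrow> nat) \<Rightarrow> real"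
  where "\<And>t \<alpha>. t > 0 \<Longrightarrow> C t \<alpha> \<ge> 0"
    "\<And>t \<alpha>. t > 0 \<Longrightarrow> C t \<alpha> \<noteq> 0 \<longleftrightarrow> (\<forall>i. \<alpha> i \<le> exponent \<kappa> i) \<and> (\<Sum>i\<in>UNIV. \<alpha> i) = k"
    "\<And>t. t > 0 \<Longrightarrow> local_index (C t)"
    "\<And>\<alpha>. ((\<lambda>t. C t (exponent \<alpha>)) \<longlongrightarrow> coefficient f \<alpha>) (at_right 0)"
proof -
  define K where "K = exponent \<kappa>"
  define \<phi> where "\<phi> = deriv_at_0 (dual \<kappa> f)"
  \<comment> \<open>\<open>w t i\<close> is e_i + t (1, ..., 1), the image of e_i under the change
    of variables: strictly positive for t > 0, and e_i itself at t = 0.\<close>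
  define w where "w t i j = unit_fun i j + (t :: real)" for t and i j :: 'r
  define h where "h t = mixed_derivative (w t) \<phi>" for t
  define box where "box \<alpha> \<longleftrightarrow> (\<forall>i. \<alpha> i \<le> K i) \<and> (\<Sum>i\<in>UNIV. \<alpha> i) = k" for \<alpha> :: "'r \<Rightarrow> nat"
  \<comment> \<open>Outside the box the subtraction K i - \<alpha> i may truncate, so 0 is
    prescribed there. Inside, positivity of h makes the support the full slice that
    \<open>exchange_support_double\<close> relies on.\<close>
  define C where "C t \<alpha> = (if box \<alpha> then h t (\<lambda>i. K i - \<alpha> i) else 0)" for t \<alpha>
  have \<phi>: "\<phi> \<mu> = (if \<forall>i. \<mu> i \<le> K i then coefficient f (Abs_poly_mapping (\<lambda>i. K i - \<mu> i)) else 0)" for \<mu>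
    unfolding \<phi>_def K_def by (rule deriv_at_0_dual[OF f(3)])
  have \<phi>_deg: "(\<Sum>i\<in>UNIV. \<mu> i) = d" if "\<phi> \<mu> \<noteq> 0" for \<mu>
  proof -
    have "homogeneous d (dual \<kappa> f)" using lor by (simp add: lorentzian_of_degree_def)
    moreover have "Abs_poly_mapping \<mu> \<in> monomials (dual \<kappa> f)"
      using that by (simp add: \<phi>_def deriv_at_0_def in_keys_iff)
    ultimately show ?thesis by (auto simp: homogeneous_def)
  qed
  have \<phi>_compl: "\<phi> (\<lambda>i. K i - \<alpha> i) = coefficient f (Abs_poly_mapping \<alpha>)" if "\<forall>i. \<alpha> i \<le> K i" for \<alpha>
    using that by (simp add: \<phi>)
  \<comment> \<open>One monomial of f serves twice: its complement \<mu>0 pins d to the total of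
    \<kappa> minus k, and the positive derivative there makes all perturbed derivatives of order d
    positive.\<close>
  obtain \<alpha>0 where \<alpha>0: "\<alpha>0 \<in> monomials f" using f(1) by (metis ex_in_conv keys_eq_empty)
  have b0: "\<forall>i. exponent \<alpha>0 i \<le> K i" "(\<Sum>i\<in>UNIV. exponent \<alpha>0 i) = k"
    using f(2,3) \<alpha>0 by (auto simp: homogeneous_def degree_bounded_def K_def)
  define \<mu>0 where "\<mu>0 i = K i - exponent \<alpha>0 i" for i
  have \<mu>0: "\<phi> \<mu>0 \<noteq> 0"
    using \<phi>_compl[OF b0(1)] \<alpha>0 by (simp add: \<mu>0_def[abs_def] in_keys_iff lookup_inverse)
  have compl_sum: "(\<Sum>i\<in>UNIV. K i - \<alpha> i) = (\<Sum>i\<in>UNIV. K i) - (\<Sum>i\<in>UNIV. \<alpha> i)"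
    "(\<Sum>i\<in>UNIV. \<alpha> i) \<le> (\<Sum>i\<in>UNIV. K i)" if "\<forall>i. \<alpha> i \<le> K i" for \<alpha>
    using that by (intro sum_subtractf_nat sum_mono; simp)+
  have Ksum: "(\<Sum>i\<in>UNIV. K i) = k + d"
    using \<phi>_deg[OF \<mu>0] compl_sum[OF b0(1)] b0(2) by (simp add: \<mu>0_def)
  have \<phi>_nonneg: "\<phi> \<mu> \<ge> 0" for \<mu>
  proof (cases "\<phi> \<mu> = 0")
    case False
    have "mixed_derivative unit_fun \<phi> \<mu> \<ge> 0"
      unfolding mixed_derivative_def \<phi>_def
      using set_direction_list[of "unit_fun :: 'r \<Rightarrow> _" \<mu>] \<phi>_deg[OF False]
      by (intro lorentzian_deriv_nonneg[OF lor]) (auto simp: length_direction_list unit_fun_def)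
    then show ?thesis by (simp add: mixed_derivative_unit_fun)
  qed simp
  have w_pos: "v i > 0" if "v \<in> set (direction_list (w t) \<mu>)" "t > 0" for v i t \<mu>
    using that set_direction_list[of "w t" \<mu>] by (auto simp: w_def unit_fun_def)
  have h_pos: "h t \<mu> > 0" if "(\<Sum>i\<in>UNIV. \<mu> i) = d" "t > 0" for t \<mu>
    unfolding h_def mixed_derivative_def
    using w_pos that \<phi>_nonneg \<mu>0 \<phi>_nonneg[of \<mu>0] \<phi>_deg[OF \<mu>0]
    by (intro foldr_dir_op_pos[of _ \<phi> \<mu>0]) (auto simp: length_direction_list less_le)
  have box_compl: "(\<Sum>i\<in>UNIV. K i - \<alpha> i) = d" if "box \<alpha>" for \<alpha>
    using that compl_sum[of \<alpha>] Ksum by (simp add: box_def)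
  have hess: "index_le_one UNIV (\<lambda>i j. h t (inc i (inc j \<mu>)))" if \<mu>: "(\<Sum>i\<in>UNIV. \<mu> i) + 2 = d" and t: "t > 0" for t \<mu>
  proof -
    let ?ws = "direction_list (w t) \<mu>"
    let ?N = "\<lambda>a b. dir_op (unit_fun a) (dir_op (unit_fun b) (foldr dir_op ?ws \<phi>)) (\<lambda>_. 0)"
    have "index_le_one UNIV ?N"
      unfolding \<phi>_def using \<mu> w_pos[OF _ t]
      by (intro lorentzian_hessian_index[OF lor]) (auto simp: length_direction_list less_imp_le less_imp_neq[symmetric])
    then have "index_le_one UNIV (\<lambda>i j. \<Sum>a\<in>UNIV. \<Sum>b\<in>UNIV. w t i a * w t j b * ?N a b)"
      by (rule index_le_one_pullback)
    moreover have "h t (inc i (inc j \<mu>)) = (\<Sum>a\<in>UNIV. \<Sum>b\<in>UNIV. w t i a * w t j b * ?N a b)" for i j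
      unfolding h_def mixed_derivative_inc_inc dir_op_unit_fun
      by (simp add: dir_op_def sum_distrib_left mult_ac)
    ultimately show ?thesis by simp
  qed
  show ?thesis
  proof (rule that[of C])
    fix t :: real and \<alpha> assume t: "t > 0"
    show "C t \<alpha> \<ge> 0" using h_pos[OF box_compl t] by (simp add: C_def less_imp_le)
    show "C t \<alpha> \<noteq> 0 \<longleftrightarrow> (\<forall>i. \<alpha> i \<le> exponent \<kappa> i) \<and> (\<Sum>i\<in>UNIV. \<alpha> i) = k"
      using h_pos[OF box_compl t, of \<alpha>] by (auto simp: C_def box_def K_def)
  next
    fix t :: real assume t: "t > 0"
    show "local_index (C t)"
      by (rule local_index_of_hessians[where h = "h t" and d = d and \<kappa> = K and k = k])
        (use h_pos[OF _ t] hess[OF _ t] Ksum in \<open>auto simp: C_def box_def less_imp_le\<close>)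
  next
    fix \<alpha> :: "'r monomial"
    have cont: "continuous_on UNIV (\<lambda>t. h t \<mu>)" for \<mu>
    proof -
      have "continuous_on UNIV (\<lambda>t. foldr dir_op (map (\<lambda>f. f t) (direction_list (\<lambda>i t. w t i) \<mu>)) \<phi> (\<lambda>_. 0))"
        by (intro foldr_dir_op_continuous)
          (use set_direction_list[of "\<lambda>i t. w t i" \<mu>] in \<open>auto simp: w_def intro!: continuous_intros\<close>)
      then show ?thesis by (simp add: h_def mixed_derivative_def map_direction_list)
    qed
    have h0: "h 0 \<mu> = \<phi> \<mu>" for \<mu>
    proof -
      have "w 0 = unit_fun" by (simp add: w_def fun_eq_iff)
      then show ?thesis by (simp add: h_def mixed_derivative_unit_fun)
    qed
    have "((\<lambda>t. h t \<mu>) \<longlongrightarrow> h 0 \<mu>) (at_right 0)" for \<mu>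
      using cont[of \<mu>] by (simp add: continuous_on_eq_continuous_at continuous_at filterlim_at_split)
    then have lim: "((\<lambda>t. h t \<mu>) \<longlongrightarrow> \<phi> \<mu>) (at_right 0)" for \<mu>
      unfolding h0 .
    show "((\<lambda>t. C t (exponent \<alpha>)) \<longlongrightarrow> coefficient f \<alpha>) (at_right 0)"
    proof (cases "box (exponent \<alpha>)")
      case True
      then show ?thesis
        using lim[of "\<lambda>i. K i - exponent \<alpha> i"] \<phi>_compl[of "exponent \<alpha>"]
        by (simp add: C_def box_def lookup_inverse)
    next
      case False
      then have "\<alpha> \<notin> monomials f"
        using f(2,3) by (auto simp: homogeneous_def degree_bounded_def K_def box_def)
      then show ?thesis using False by (simp add: C_def in_keys_iff)
    qed
  qed
qed

section \<open>Log-concavity along the two diagonal directions\<close>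

lemma slot_sum_shift: "slot_sum L \<phi> S (inc u \<alpha>) = slot_sum L (\<lambda>\<beta>. \<phi> (inc u \<beta>)) S \<alpha>"
  unfolding slot_sum_def
  by (intro sum.cong refl arg_cong[of _ _ \<phi>]) (auto simp: inc_def)

lemma slot_sum_sum:
  "slot_sum L (\<lambda>\<beta>. \<Sum>u\<in>U. \<phi> u \<beta>) S \<alpha> = (\<Sum>u\<in>U. slot_sum L (\<phi> u) S \<alpha>)"
  unfolding slot_sum_def by (rule sum.swap)

lemma slot_sum_scale: "slot_sum L (\<lambda>\<beta>. x * \<phi> \<beta>) S \<alpha> = x * slot_sum L \<phi> S \<alpha>"
  by (simp add: slot_sum_def sum_distrib_left)

text \<open>Here the slot acts on \<phi> as a differential operator instead of shifting the
  exponent, so groups of slots can be evaluated one after another.\<close>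

lemma slot_sum_insert_op:
  assumes "finite S" "p \<notin> S"
  shows "slot_sum L \<phi> (insert p S) \<alpha> = slot_sum L (\<lambda>\<beta>. \<Sum>u\<in>L p. \<phi> (inc u \<beta>)) S \<alpha>"
  unfolding slot_sum_insert[OF assms] slot_sum_sum slot_sum_shift ..

definition tensor :: "(bool \<Rightarrow> ('r \<Rightarrow> nat) \<Rightarrow> real) \<Rightarrow> (bool \<times> 'r \<Rightarrow> nat) \<Rightarrow> real" where
  "tensor g \<alpha> = g False (slice False \<alpha>) * g True (slice True \<alpha>)"

text \<open>Since a! f^[a] is the a-th diagonal derivative of f, the factorial makes one more
  diagonal derivative exactly the step from a to \<open>Suc a\<close>.\<close>

definition diagonal_taylor :: "'r::finite rpoly \<Rightarrow> nat \<Rightarrow> ('r \<Rightarrow> nat) \<Rightarrow> real" where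
  "diagonal_taylor p a \<beta> = fact a * deriv_at_0 (derived p a) \<beta>"

lemma sum_diagonal_taylor_inc:
  "(\<Sum>i\<in>UNIV. diagonal_taylor p a (inc i \<beta>)) = diagonal_taylor p (Suc a) \<beta>"
proof -
  have "(\<Sum>i\<in>UNIV. diagonal_taylor p a (inc i \<beta>)) = fact a * (real (Suc a) * deriv_at_0 (derived p (Suc a)) \<beta>)"
    unfolding deriv_at_0_derived_Suc by (simp add: diagonal_taylor_def sum_distrib_left)
  then show ?thesis by (simp add: diagonal_taylor_def)
qed

lemma tensor_diagonal_taylor_step:
  "(\<Sum>u\<in>{s} \<times> UNIV. tensor (g(s := diagonal_taylor p a)) (inc u \<beta>)) =
    tensor (g(s := diagonal_taylor p (Suc a))) \<beta>"
proof -
  have "bij_betw (Pair s) UNIV ({s} \<times> UNIV)" by (auto simp: bij_betw_def inj_on_def)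
  then have "(\<Sum>u\<in>{s} \<times> UNIV. tensor (g(s := diagonal_taylor p a)) (inc u \<beta>)) =
      (\<Sum>i\<in>UNIV. tensor (g(s := diagonal_taylor p a)) (inc (s, i) \<beta>))"
    by (rule sum.reindex_bij_betw[symmetric])
  also have "\<dots> = tensor (g(s := diagonal_taylor p (Suc a))) \<beta>"
    by (cases s) (simp_all add: tensor_def slice_inc sum_diagonal_taylor_inc
        flip: sum_distrib_left sum_distrib_right)
  finally show ?thesis .
qed

lemma slot_sum_diagonal_slots:
  assumes "finite A" "finite S" "A \<inter> S = {}" "\<And>x. x \<in> A \<Longrightarrow> L x = {s} \<times> UNIV"
  shows "slot_sum L (tensor (g(s := diagonal_taylor p a))) (A \<union> S) \<alpha> =
    slot_sum L (tensor (g(s := diagonal_taylor p (a + card A)))) S \<alpha>"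
  using assms
proof (induction A arbitrary: a rule: finite_induct)
  case (insert x A)
  have "slot_sum L (tensor (g(s := diagonal_taylor p a))) (insert x (A \<union> S)) \<alpha> =
      slot_sum L (tensor (g(s := diagonal_taylor p (Suc a)))) (A \<union> S) \<alpha>"
    using insert by (subst slot_sum_insert_op) (auto simp: tensor_diagonal_taylor_step)
  also have "\<dots> = slot_sum L (tensor (g(s := diagonal_taylor p (Suc a + card A)))) S \<alpha>"
    by (rule insert.IH) (use insert.prems in auto)
  finally show ?case using insert.hyps by (simp add: fun_upd_def)
qed simp

lemma slice_zero [simp]: "slice s (\<lambda>_. 0) = (\<lambda>_. 0)"
  by (simp add: slice_def fun_eq_iff)

lemma coefficient_mult_0: "coefficient (p * q) 0 = coefficient p 0 * coefficient q 0"
proof -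
  let ?s = "\<lambda>f \<alpha>. Poly_Mapping.single \<alpha> (coefficient f \<alpha>)"
  have "coefficient ((\<Sum>\<alpha>\<in>monomials p. ?s p \<alpha>) * (\<Sum>\<beta>\<in>monomials q. ?s q \<beta>)) 0 =
    (\<Sum>\<alpha>\<in>monomials p. \<Sum>\<beta>\<in>monomials q. coefficient p \<alpha> * coefficient q \<beta> when \<alpha> + \<beta> = 0)"
    by (simp add: sum_product lookup_sum mult_single lookup_single)
  also have "\<dots> = (\<Sum>\<alpha>\<in>monomials p. \<Sum>\<beta>\<in>monomials q.
      (if \<alpha> = 0 then coefficient p 0 else 0) * (if \<beta> = 0 then coefficient q 0 else 0))"
  proof (intro sum.cong refl)
    fix \<alpha> \<beta> :: "'a monomial"
    have "\<alpha> + \<beta> = 0 \<longleftrightarrow> \<alpha> = 0 \<and> \<beta> = 0"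
      by (auto simp: poly_mapping_eq_iff fun_eq_iff lookup_add)
    then show "(coefficient p \<alpha> * coefficient q \<beta> when \<alpha> + \<beta> = 0) =
      (if \<alpha> = 0 then coefficient p 0 else 0) * (if \<beta> = 0 then coefficient q 0 else 0)"
      by (auto simp: when_def)
  qed
  also have "\<dots> = coefficient p 0 * coefficient q 0"
    by (simp add: in_keys_iff flip: sum_product)
  finally show ?thesis by (simp flip: poly_mapping_eq_sum_single)
qed

text \<open>A slot with (False, i) and (True, i) differentiates either copy and adds the results,
  which is the product rule for d_i on p q. The induction therefore varies p and q, and it ends with
  the constant terms.\<close>

lemma slot_sum_product_slots:
  assumes "finite S" "\<And>x. x \<in> S \<Longrightarrow> L x = {(False, \<tau> x), (True, \<tau> x)}"
  shows "slot_sum L (tensor (\<lambda>b. deriv_at_0 (if b then q else p))) S (\<lambda>_. 0) = deriv_at_0 (p * q) (type_count \<tau> S)"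
  using assms
proof (induction S arbitrary: p q rule: finite_induct)
  case empty
  have "type_count \<tau> {} = (\<lambda>_. 0)" by (simp add: type_count_def fun_eq_iff)
  then show ?case
    by (simp add: tensor_def coefficient_mult_0 flip: coefficient_0_eq_deriv_at_0)
next
  case (insert x S)
  have "(\<Sum>u\<in>L x. tensor (\<lambda>b. deriv_at_0 (if b then q else p)) (inc u \<beta>)) =
      (\<Sum>b\<in>UNIV. tensor (\<lambda>b'. deriv_at_0 (if b' then (if b then partial (\<tau> x) q else q)
        else (if b then p else partial (\<tau> x) p))) \<beta>)" for \<beta>
    using insert.prems[of x] by (simp add: tensor_def slice_inc UNIV_bool deriv_at_0_partial)
  then have "slot_sum L (tensor (\<lambda>b. deriv_at_0 (if b then q else p))) (insert x S) (\<lambda>_. 0) =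
      (\<Sum>b\<in>UNIV. slot_sum L (tensor (\<lambda>b'. deriv_at_0 (if b' then (if b then partial (\<tau> x) q else q)
        else (if b then p else partial (\<tau> x) p)))) S (\<lambda>_. 0))"
    by (simp only: slot_sum_insert_op[OF insert.hyps] slot_sum_sum)
  also have "\<dots> = deriv_at_0 (partial (\<tau> x) (p * q)) (type_count \<tau> S)"
    using insert.prems by (simp add: insert.IH UNIV_bool partial_mult)
      (simp add: deriv_at_0_def lookup_add algebra_simps)
  also have "\<dots> = deriv_at_0 (p * q) (type_count \<tau> (insert x S))"
    using insert.hyps by (simp add: deriv_at_0_partial type_count_insert)
  finally show ?case .
qed

lemma prod_bool_times:
  fixes g :: "bool \<times> 'r::finite \<Rightarrow> 'a::comm_monoid_mult"
  shows "(\<Prod>p\<in>UNIV. g p) = (\<Prod>i\<in>UNIV. g (False, i)) * (\<Prod>i\<in>UNIV. g (True, i))"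
proof -
  have "(\<Prod>p\<in>UNIV. g p) = (\<Prod>(s, i)\<in>UNIV \<times> UNIV. g (s, i))" by simp
  also have "\<dots> = (\<Prod>s\<in>UNIV. \<Prod>i\<in>UNIV. g (s, i))" by (rule prod.cartesian_product[symmetric])
  finally show ?thesis by (simp add: UNIV_bool)
qed

lemma factorial_weighted_double:
  "factorial_weighted (double (\<lambda>\<alpha>. coefficient p (Abs_poly_mapping \<alpha>))) = tensor (\<lambda>_. deriv_at_0 p)"
  by (auto simp: factorial_weighted_def double_def tensor_def deriv_at_0_def prod_bool_times slice_def fun_eq_iff)

section \<open>Unimodality from symmetry and log-concavity\<close>

lemma set_derivs_perm:
  assumes "finite E" "mset vs = mset ws"
  shows "set_derivs E vs c = set_derivs E ws c"
  using foldr_mset_eq[of "set_deriv E" vs ws] assms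
  by (simp add: set_derivs_def fun_eq_iff[of "_ \<circ> _"] set_deriv_commute)

lemma set_derivs_reindex:
  assumes flip: "\<And>x. x \<in> S \<Longrightarrow> flip x \<in> S" "\<And>x. x \<in> S \<Longrightarrow> flip (flip x) = x"
    and c: "\<And>T. T \<subseteq> S \<Longrightarrow> c (flip ` T) = c T"
    and "list_all2 (\<lambda>v v'. \<forall>i\<in>S. v i = v' (flip i)) vs vs'" "T \<subseteq> S"
  shows "set_derivs S vs c T = set_derivs S vs' c (flip ` T)"
  using assms(4,5)
proof (induction vs vs' arbitrary: T rule: list_all2_induct)
  case Nil
  then show ?case using c by simp
next
  case (Cons v vs v' vs')
  have inj: "inj_on flip S" using flip(2) by (metis inj_onI)
  have "flip ` S = S" using flip by force
  then have "S - flip ` T = flip ` (S - T)"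
    using inj_on_image_set_diff[OF inj, of S T] Cons.prems by auto
  then have "set_deriv S v' (set_derivs S vs' c) (flip ` T) =
      (\<Sum>i\<in>S - T. v' (flip i) * set_derivs S vs' c (insert (flip i) (flip ` T)))"
    unfolding set_deriv_def using inj by (simp add: sum.reindex inj_on_diff)
  also have "\<dots> = set_deriv S v (set_derivs S vs c) T"
    unfolding set_deriv_def using Cons by (intro sum.cong) auto
  finally show ?case by simp
qed

text \<open>For a positive sequence log-concavity says that consecutive ratios do not increase, so
  an increase at p forces strict increases at all earlier steps. But p + 1 mirrors to M - (p + 1) <=
  p, where the value must be the same.\<close>

lemma symmetric_log_concave_le:
  fixes v :: "nat \<Rightarrow> real"
  assumes pos: "\<And>a. a \<le> M \<Longrightarrow> v a > 0"
    and lc: "\<And>a. a + 2 \<le> M \<Longrightarrow> v (a + 2) * v a \<le> (v (a + 1))\<^sup>2"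
    and sym: "\<And>a. a \<le> M \<Longrightarrow> v a = v (M - a)"
    and p: "M \<le> 2 * p" "p < M"
  shows "v (p + 1) \<le> v p"
proof (rule ccontr)
  assume "\<not> ?thesis"
  then have less: "v p < v (p + 1)" by simp
  have incr: "v (p - j) < v (p - j + 1)" if "j \<le> p" for j
    using that
  proof (induction j)
    case (Suc j)
    define a where "a = p - Suc j"
    have a: "p - j = a + 1" "a + 2 \<le> M" using Suc.prems p by (auto simp: a_def)
    have IH: "v (a + 1) < v (a + 2)" using Suc a by (simp add: Suc_diff_le)
    have "v (a + 1) * v a < v (a + 2) * v a" using IH pos[of a] a by simp
    also have "\<dots> \<le> v (a + 1) * v (a + 1)" using lc[OF a(2)] by (simp add: power2_eq_square)
    finally have "v a < v (a + 1)" using pos[of "a + 1"] a by simp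
    then show ?case by (simp add: a_def)
  qed (use less in simp)
  have mono: "v i < v (p + 1)" if "i \<le> p" for i
    using that
  proof (induction "p - i" arbitrary: i)
    case 0
    then show ?case using less by simp
  next
    case (Suc k)
    have "v i < v (Suc i)" using incr[of "p - i"] Suc by simp
    also have "v (Suc i) < v (p + 1)" using Suc.hyps(1)[of "Suc i"] Suc.hyps(2) by simp
    finally show ?case .
  qed
  have "v (M - (p + 1)) < v (p + 1)" using p by (intro mono) simp
  then show False using sym[of "p + 1"] p by simp
qed

text \<open>G depends only on the number of slots of each kind in T, so mixed derivatives along the
  two indicator directions recover e: \<open>V 0 a b\<close> is (N!)^2 e(N - a, N - b). For t > 0
  the sequence V t a (M - a) is positive, log-concave and symmetric, and the claim is the limit of
  its comparison at a = N - m.\<close>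

lemma symmetric_alexandrov_fenchel_unimodal:
  fixes S0 S1 :: "'e set" and e :: "nat \<Rightarrow> nat \<Rightarrow> real"
  assumes fin: "finite S0" "finite S1" and disj: "S0 \<inter> S1 = {}" and card: "card S0 = N" "card S1 = N"
    and flip: "flip ` S0 = S1" "flip ` S1 = S0" "\<And>x. x \<in> S0 \<union> S1 \<Longrightarrow> flip (flip x) = x"
    and AF: "alexandrov_fenchel (S0 \<union> S1) G" and Gnn: "\<And>T. G T \<ge> 0"
    and G: "\<And>T. T \<subseteq> S0 \<union> S1 \<Longrightarrow> G T =
      fact (N - card (T \<inter> S0)) * fact (N - card (T \<inter> S1)) * e (N - card (T \<inter> S0)) (N - card (T \<inter> S1))"
    and esym: "\<And>a b. e a b = e b a"
    and mn: "1 \<le> m" "m \<le> n" "n + 1 \<le> N"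
  shows "e (m - 1) (n + 1) \<le> e m n"
proof -
  define S where "S = S0 \<union> S1"
  \<comment> \<open>At t = 0 these are the indicators of S0 and S1; for t > 0 both are strictly
    positive, and \<open>flip\<close> still interchanges them.\<close>
  define s where "s t x = (if x \<in> S0 then 1 else if x \<in> S1 then t else 0 :: real)" for t x
  define s' where "s' t x = (if x \<in> S1 then 1 else if x \<in> S0 then t else 0 :: real)" for t x
  define V where "V t a b = set_derivs S (replicate a (s t) @ replicate b (s' t)) G {}" for t a b
  \<comment> \<open>Of the 2 N slots, m + n stay differentiated in f, so M derivatives are left for
    G.\<close>
  define M where "M = 2 * N - (m + n)"
  have finS: "finite S" using fin by (simp add: S_def)
  have eval: "set_derivs S (replicate a (s 0) @ replicate b (s' 0)) G T =
      fact (N - card (T \<inter> S0)) * fact (N - card (T \<inter> S1)) * e (N - card (T \<inter> S0) - a) (N - card (T \<inter> S1) - b)"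
    if "T \<subseteq> S" "card (T \<inter> S0) + a \<le> N" "card (T \<inter> S1) + b \<le> N" for a b T
    using that
  proof (induction "a + b" arbitrary: a b T)
    case 0
    then show ?case using G by (simp add: S_def)
  next
    case (Suc k)
    have fT: "finite T" using Suc.prems finS finite_subset by blast
    have one: "N - x = Suc (N - Suc x)" if "Suc x \<le> N" for x using that by simp
    show ?case
    proof (cases a)
      case (Suc a')
      let ?F = "set_derivs S (replicate a' (s 0) @ replicate b (s' 0)) G"
      have "set_deriv S (s 0) ?F T = (\<Sum>i\<in>S0 - T. ?F (insert i T))"
        unfolding set_deriv_def using finS disj by (intro sum.mono_neutral_cong_right) (auto simp: s_def S_def)
      also have "\<dots> = (\<Sum>i\<in>S0 - T. fact (N - Suc (card (T \<inter> S0))) * fact (N - card (T \<inter> S1)) *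
          e (N - card (T \<inter> S0) - a) (N - card (T \<inter> S1) - b))"
      proof (rule sum.cong[OF refl])
        fix i assume i: "i \<in> S0 - T"
        then have "insert i T \<inter> S0 = insert i (T \<inter> S0)" "insert i T \<inter> S1 = T \<inter> S1" using disj by auto
        moreover have "card (insert i (T \<inter> S0)) = Suc (card (T \<inter> S0))" using i fT by simp
        ultimately show "?F (insert i T) = fact (N - Suc (card (T \<inter> S0))) * fact (N - card (T \<inter> S1)) *
          e (N - card (T \<inter> S0) - a) (N - card (T \<inter> S1) - b)"
          using Suc.hyps(1)[of a' b "insert i T"] Suc.hyps(2) Suc.prems i \<open>a = Suc a'\<close> by (simp add: S_def)
      qed
      also have "\<dots> = real (card (S0 - T)) * (fact (N - Suc (card (T \<inter> S0))) * fact (N - card (T \<inter> S1)) *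
          e (N - card (T \<inter> S0) - a) (N - card (T \<inter> S1) - b))" by simp
      also have "card (S0 - T) = N - card (T \<inter> S0)"
        using card fin by (simp add: card_Diff_subset_Int Int_commute)
      also have "real (N - card (T \<inter> S0)) * (fact (N - Suc (card (T \<inter> S0))) * fact (N - card (T \<inter> S1)) *
          e (N - card (T \<inter> S0) - a) (N - card (T \<inter> S1) - b)) =
          fact (N - card (T \<inter> S0)) * fact (N - card (T \<inter> S1)) *
          e (N - card (T \<inter> S0) - a) (N - card (T \<inter> S1) - b)"
      proof -
        have "(fact (N - card (T \<inter> S0)) :: real) = real (N - card (T \<inter> S0)) * fact (N - Suc (card (T \<inter> S0)))"
          using Suc.prems(2) \<open>a = Suc a'\<close> by (subst fact_reduce) auto
        then show ?thesis by simp
      qed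
      finally show ?thesis using \<open>a = Suc a'\<close> by simp
    next
      case 0
      then obtain b' where b': "b = Suc b'" using Suc.hyps(2) by (cases b) auto
      let ?F = "set_derivs S (replicate b' (s' 0)) G"
      have "set_deriv S (s' 0) ?F T = (\<Sum>i\<in>S1 - T. ?F (insert i T))"
        unfolding set_deriv_def using finS disj by (intro sum.mono_neutral_cong_right) (auto simp: s'_def S_def)
      also have "\<dots> = (\<Sum>i\<in>S1 - T. fact (N - card (T \<inter> S0)) * fact (N - Suc (card (T \<inter> S1))) *
          e (N - card (T \<inter> S0)) (N - card (T \<inter> S1) - b))"
      proof (rule sum.cong[OF refl])
        fix i assume i: "i \<in> S1 - T"
        then have "insert i T \<inter> S1 = insert i (T \<inter> S1)" "insert i T \<inter> S0 = T \<inter> S0" using disj by auto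
        moreover have "card (insert i (T \<inter> S1)) = Suc (card (T \<inter> S1))" using i fT by simp
        ultimately show "?F (insert i T) = fact (N - card (T \<inter> S0)) * fact (N - Suc (card (T \<inter> S1))) *
          e (N - card (T \<inter> S0)) (N - card (T \<inter> S1) - b)"
          using Suc.hyps(1)[of 0 b' "insert i T"] Suc.hyps(2) Suc.prems i b' 0 by (simp add: S_def)
      qed
      also have "\<dots> = real (card (S1 - T)) * (fact (N - card (T \<inter> S0)) * fact (N - Suc (card (T \<inter> S1))) *
          e (N - card (T \<inter> S0)) (N - card (T \<inter> S1) - b))" by simp
      also have "card (S1 - T) = N - card (T \<inter> S1)"
        using card fin by (simp add: card_Diff_subset_Int Int_commute)
      also have "real (N - card (T \<inter> S1)) * (fact (N - card (T \<inter> S0)) * fact (N - Suc (card (T \<inter> S1))) *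
          e (N - card (T \<inter> S0)) (N - card (T \<inter> S1) - b)) =
          fact (N - card (T \<inter> S0)) * fact (N - card (T \<inter> S1)) *
          e (N - card (T \<inter> S0)) (N - card (T \<inter> S1) - b)"
      proof -
        have "(fact (N - card (T \<inter> S1)) :: real) = real (N - card (T \<inter> S1)) * fact (N - Suc (card (T \<inter> S1)))"
          using Suc.prems(3) b' by (subst fact_reduce) auto
        then show ?thesis by simp
      qed
      finally show ?thesis using b' 0 by simp
    qed
  qed
  have V0: "V 0 a b = fact N * fact N * e (N - a) (N - b)" if "a \<le> N" "b \<le> N" for a b
    unfolding V_def using eval[of "{}" a b] that by simp
  have subs: "\<exists>A\<subseteq>X. card A = k" if "k \<le> card X" for k and X :: "'e set"
    by (rule obtain_subset_with_card_n[OF that]) blast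
  \<comment> \<open>A set of size M whose G-value is a positive multiple of e (m - 1) (n + 1). If
    the latter is positive, this single coefficient makes all perturbed mixed derivatives of order M
    positive; if not, the claim is clear from e m n >= 0.\<close>
  obtain A0 where A0: "A0 \<subseteq> S0" "card A0 = N - (m - 1)"
    using subs[of "N - (m - 1)" S0] card by auto
  obtain A1 where A1: "A1 \<subseteq> S1" "card A1 = N - (n + 1)"
    using subs[of "N - (n + 1)" S1] card by auto
  have int: "(A0 \<union> A1) \<inter> S0 = A0" "(A0 \<union> A1) \<inter> S1 = A1" using A0 A1 disj by auto
  have cardA: "card (A0 \<union> A1) = M"
    using A0 A1 fin disj mn finite_subset[OF A0(1)] finite_subset[OF A1(1)]
    by (subst card_Un_disjoint) (auto simp: M_def)
  have GA: "G (A0 \<union> A1) = fact (m - 1) * fact (n + 1) * e (m - 1) (n + 1)"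
  proof -
    have "N - (N - (m - 1)) = m - 1" "N - (N - (n + 1)) = n + 1" using mn by auto
    then show ?thesis using G[of "A0 \<union> A1"] A0 A1 unfolding int by auto
  qed
  have emn_nn: "e m n \<ge> 0"
  proof -
    obtain B0 where B0: "B0 \<subseteq> S0" "card B0 = N - m"
      using subs[of "N - m" S0] card by auto
    obtain B1 where B1: "B1 \<subseteq> S1" "card B1 = N - n"
      using subs[of "N - n" S1] card by auto
    have int: "(B0 \<union> B1) \<inter> S0 = B0" "(B0 \<union> B1) \<inter> S1 = B1" using B0 B1 disj by auto
    have "N - (N - m) = m" "N - (N - n) = n" using mn by auto
    then have "G (B0 \<union> B1) = fact m * fact n * e m n" using G[of "B0 \<union> B1"] B0 B1 unfolding int by auto
    then have "(fact m * fact n) * 0 \<le> (fact m * fact n) * e m n" using Gnn[of "B0 \<union> B1"] by simp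
    then show ?thesis by (rule mult_left_le_imp_le) simp
  qed
  show ?thesis
  proof (cases "e (m - 1) (n + 1) > 0")
    case False
    then show ?thesis using emn_nn by simp
  next
    case epos: True
    have ineq: "V t (N - m + 1) (N - n - 1) \<le> V t (N - m) (N - n)" if t: "t > 0" for t
    proof -
      define v where "v a = V t a (M - a)" for a
      have pos: "v a > 0" if "a \<le> M" for a
        unfolding v_def V_def using A0 A1 t that GA epos cardA
        by (intro set_derivs_pos[OF finS Gnn, of _ _ "A0 \<union> A1"]) (auto simp: s_def s'_def S_def)
      have lc: "v (a + 2) * v a \<le> (v (a + 1))\<^sup>2" if a: "a + 2 \<le> M" for a
      proof -
        define b where "b = M - a - 2"
        have b: "M - a = b + 2" "M - (a + 1) = b + 1" "M - (a + 2) = b" using a by (auto simp: b_def)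
        let ?vs = "replicate a (s t) @ replicate b (s' t)"
        have "set_derivs S (s t # s t # ?vs) G {} * set_derivs S (s' t # s' t # ?vs) G {} \<le>
          (set_derivs S (s t # s' t # ?vs) G {})\<^sup>2"
          using AF t by (intro alexandrov_fenchel_ineq[OF finS]) (auto simp: s_def s'_def S_def)
        moreover have "set_derivs S (s t # s t # ?vs) G = set_derivs S (replicate (a + 2) (s t) @ replicate b (s' t)) G"
          "set_derivs S (s' t # s' t # ?vs) G = set_derivs S (replicate a (s t) @ replicate (b + 2) (s' t)) G"
          "set_derivs S (s t # s' t # ?vs) G = set_derivs S (replicate (a + 1) (s t) @ replicate (b + 1) (s' t)) G"
          by (intro set_derivs_perm[OF finS]; simp)+
        ultimately show ?thesis by (simp only: v_def V_def b)
      qed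
      have sym: "v a = v (M - a)" if a: "a \<le> M" for a
      proof -
        have Gflip: "G (flip ` T) = G T" if T: "T \<subseteq> S" for T
        proof -
          have inj: "inj_on flip S" using flip(3) unfolding S_def by (metis inj_onI)
          have "flip ` T \<inter> S0 = flip ` (T \<inter> S1)" "flip ` T \<inter> S1 = flip ` (T \<inter> S0)"
            using T flip disj unfolding S_def by blast+
          moreover have "card (flip ` (T \<inter> S1)) = card (T \<inter> S1)" "card (flip ` (T \<inter> S0)) = card (T \<inter> S0)"
            using inj T by (intro card_image; auto intro: inj_on_subset)+
          moreover have "flip ` T \<subseteq> S" using T flip unfolding S_def by blast
          ultimately show ?thesis using G[of T] G[of "flip ` T"] T esym by (simp add: S_def)
        qed
        have "flip x \<in> S" if "x \<in> S" for x using that flip unfolding S_def by blast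
        moreover have "\<forall>i\<in>S. s t i = s' t (flip i)" "\<forall>i\<in>S. s' t i = s t (flip i)"
          using flip disj unfolding s_def s'_def S_def by auto
        ultimately have "set_derivs S (replicate a (s t) @ replicate (M - a) (s' t)) G {} =
          set_derivs S (replicate a (s' t) @ replicate (M - a) (s t)) G (flip ` {})"
          using flip(3) Gflip
          by (intro set_derivs_reindex) (auto simp: S_def intro!: list_all2_appendI simp: list_all2_conv_all_nth nth_append)
        also have "set_derivs S (replicate a (s' t) @ replicate (M - a) (s t)) G =
            set_derivs S (replicate (M - a) (s t) @ replicate a (s' t)) G"
          by (intro set_derivs_perm[OF finS]) simp
        finally show ?thesis using a by (simp add: v_def V_def)
      qed
      \<comment> \<open>The position p = N - m satisfies M <= 2 p because m <= n, and p < M because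
        n < N.\<close>
      have "v (N - m + 1) \<le> v (N - m)"
        by (rule symmetric_log_concave_le[where M = M, OF pos lc sym]) (use mn in \<open>auto simp: M_def\<close>)
      moreover have "M - (N - m + 1) = N - n - 1" "M - (N - m) = N - n" using mn by (auto simp: M_def)
      ultimately show ?thesis by (simp add: v_def)
    qed
    have lim: "((\<lambda>t. V t a b) \<longlongrightarrow> V 0 a b) (at_right 0)" for a b
    proof -
      have "continuous_on UNIV (\<lambda>t. s t i)" "continuous_on UNIV (\<lambda>t. s' t i)" for i
        unfolding s_def s'_def by (cases "i \<in> S0"; cases "i \<in> S1"; simp)+
      then have "continuous_on UNIV (\<lambda>t. set_derivs S (map (\<lambda>f. f t) (replicate a s @ replicate b s')) G {})"
        by (intro set_derivs_continuous) auto
      then have "continuous_on UNIV (\<lambda>t. V t a b)" by (simp add: V_def)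
      then show ?thesis by (simp add: continuous_on_eq_continuous_at continuous_at filterlim_at_split)
    qed
    have "V 0 (N - m + 1) (N - n - 1) \<le> V 0 (N - m) (N - n)"
      by (rule tendsto_le[OF _ lim lim])
        (simp, rule eventually_mono[OF eventually_at_right_less], rule ineq)
    moreover have "N - (N - m + 1) = m - 1" "N - (N - n - 1) = n + 1" "N - (N - m) = m" "N - (N - n) = n"
      using mn by auto
    ultimately have "fact N * fact N * e (m - 1) (n + 1) \<le> fact N * fact N * e m n"
      using V0[of "N - m + 1" "N - n - 1"] V0[of "N - m" "N - n"] mn by simp
    then show ?thesis by (simp add: mult_le_cancel_left_pos)
  qed
qed


section \<open>The coefficient inequality under full support\<close>

lemma slot_poly_nonneg: "(\<And>\<alpha>. \<phi> \<alpha> \<ge> 0) \<Longrightarrow> slot_poly E L \<phi> T \<ge> 0"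
  by (simp add: slot_poly_def slot_sum_def sum_nonneg)

text \<open>The slots in \<Gamma> stand for (e_i, e_i), with \<open>exponent \<gamma> i\<close> of
  them for each i, and extract \<gamma>! times the coefficient at \<gamma>. The slots in
  \<open>S False\<close> and \<open>S True\<close> are the diagonal derivatives of the two copies;
  differentiating a and b of them gives a! b! e(a, b), the shape required for unimodality.\<close>

lemma derived_coefficient_ineq_of_local_index:
  fixes p :: "'r::finite rpoly" and \<gamma> :: "'r monomial"
  defines "c \<equiv> \<lambda>\<alpha>. coefficient p (Abs_poly_mapping \<alpha>)"
  assumes cnn: "\<And>\<alpha>. c \<alpha> \<ge> 0"
    and supp: "\<And>\<alpha>. c \<alpha> \<noteq> 0 \<longleftrightarrow> (\<forall>i. \<alpha> i \<le> \<kappa> i) \<and> (\<Sum>i\<in>UNIV. \<alpha> i) = k"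
    and loc: "local_index c" and mn: "1 \<le> m" "m \<le> n"
  shows "coefficient (derived p (m - 1) * derived p (n + 1)) \<gamma> \<le> coefficient (derived p m * derived p n) \<gamma>"
proof -
  \<comment> \<open>The index n + 1 occurs in the inequality, so each copy needs n + 1 diagonal
    slots.\<close>
  define N where "N = n + 1"
  define \<phi> where "\<phi> = factorial_weighted (double c)"
  define \<Gamma> where "\<Gamma> = (Inl ` (SIGMA i:UNIV. {..<exponent \<gamma> i}) :: ('r \<times> nat + bool \<times> nat) set)"
  define S where "S s = (Inr ` ({s} \<times> {..<N}) :: ('r \<times> nat + bool \<times> nat) set)" for s
  define L :: "'r \<times> nat + bool \<times> nat \<Rightarrow> (bool \<times> 'r) set"
    where "L = case_sum (\<lambda>(i, _). {(False, i), (True, i)}) (\<lambda>(s, _). {s} \<times> UNIV)"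
  define \<tau> :: "'r \<times> nat + bool \<times> nat \<Rightarrow> 'r" where "\<tau> x = fst (projl x)" for x
  define flip :: "'r \<times> nat + bool \<times> nat \<Rightarrow> 'r \<times> nat + bool \<times> nat"
    where "flip = case_sum Inl (\<lambda>(s, j). Inr (\<not> s, j))"
  define E where "E = \<Gamma> \<union> (S False \<union> S True)"
  define e where "e a b = deriv_at_0 (derived p a * derived p b) (exponent \<gamma>)" for a b
  have fin: "finite \<Gamma>" "finite (S s)" "finite E" for s
    by (auto simp: \<Gamma>_def S_def E_def)
  have disj: "S False \<inter> S True = {}" "\<Gamma> \<inter> S s = {}" for s by (auto simp: S_def \<Gamma>_def)
  have LS: "L x = {s} \<times> UNIV" if "x \<in> S s" for x s using that by (auto simp: L_def S_def)
  have cardS: "card (S s) = N" for s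
    by (simp add: S_def card_image inj_on_def card_cartesian_product)
  have \<phi>_nonneg: "\<phi> \<alpha> \<ge> 0" for \<alpha>
    using cnn by (simp add: \<phi>_def factorial_weighted_def double_def prod_nonneg)
  have \<phi>: "\<phi> = tensor (\<lambda>_. diagonal_taylor p 0)"
    unfolding \<phi>_def c_def factorial_weighted_double
    by (simp add: diagonal_taylor_def[abs_def] deriv_at_0_derived_0)
  have deg: "(\<Sum>u\<in>UNIV. \<alpha> u) = 2 * k" if "double c \<alpha> \<noteq> 0" for \<alpha>
  proof -
    have "c (slice False \<alpha>) \<noteq> 0" "c (slice True \<alpha>) \<noteq> 0" using that by (auto simp: double_def)
    then show ?thesis unfolding supp by (simp add: sum_bool_times slice_def)
  qed
  have base: "alexandrov_fenchel F (slot_poly F (\<lambda>x. {\<sigma> x}) \<phi>)" if "finite F"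
    for F :: "('r \<times> nat + bool \<times> nat) set" and \<sigma>
    unfolding \<phi>_def
    by (rule alexandrov_fenchel_if_locally_hyperbolic[OF that locally_hyperbolic_singleton_slots[OF that _ deg]])
      (use cnn supp loc in \<open>auto intro!: exchange_support_double[OF supp] local_index_double simp: double_def\<close>)
  have "alexandrov_fenchel E (slot_poly E L \<phi>)"
  proof (rule alexandrov_fenchel_slot_poly[OF _ base fin(3)])
    show "infinite (UNIV :: ('r \<times> nat + bool \<times> nat) set)" by (simp add: finite_prod)
    show "L x \<noteq> {}" if "x \<in> E" for x by (auto simp: L_def split: sum.split)
  qed
  \<comment> \<open>Only sets T avoiding \<Gamma> are kept, so every slot of \<Gamma> stays
    differentiated.\<close>
  then have AF: "alexandrov_fenchel (S False \<union> S True) (slot_poly E L \<phi>)"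
    by (rule alexandrov_fenchel_restrict[OF fin(3), where ws = "[]", rotated]) (auto simp: E_def)
  have G: "slot_poly E L \<phi> T = fact (N - card (T \<inter> S False)) * fact (N - card (T \<inter> S True)) *
      e (N - card (T \<inter> S False)) (N - card (T \<inter> S True))"
    if T: "T \<subseteq> S False \<union> S True" for T
  proof -
    have cd: "card (S s - T) = N - card (T \<inter> S s)" for s
      using fin(2)[of s] cardS by (simp add: card_Diff_subset_Int Int_commute)
    have TE: "T \<subseteq> E" using T by (auto simp: E_def)
    have ET: "E - T = (S False - T) \<union> ((S True - T) \<union> \<Gamma>)" using T disj(2) by (auto simp: E_def)
    let ?g = "\<lambda>a b. (\<lambda>s. if s then diagonal_taylor p b else diagonal_taylor p a)"
    have upd: "(?g a b)(False := diagonal_taylor p x) = ?g x b" "(?g a b)(True := diagonal_taylor p x) = ?g a x" for a b x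
      by (auto simp: fun_eq_iff)
    have "slot_poly E L \<phi> T = slot_sum L (tensor (?g 0 0)) ((S False - T) \<union> ((S True - T) \<union> \<Gamma>)) (\<lambda>_. 0)"
      using TE by (simp add: slot_poly_def ET \<phi>)
    also have "\<dots> = slot_sum L (tensor (?g (card (S False - T)) 0)) ((S True - T) \<union> \<Gamma>) (\<lambda>_. 0)"
    proof -
      have "slot_sum L (tensor ((?g 0 0)(False := diagonal_taylor p 0))) ((S False - T) \<union> ((S True - T) \<union> \<Gamma>)) (\<lambda>_. 0) =
        slot_sum L (tensor ((?g 0 0)(False := diagonal_taylor p (0 + card (S False - T))))) ((S True - T) \<union> \<Gamma>) (\<lambda>_. 0)"
        by (rule slot_sum_diagonal_slots) (use fin disj LS in auto)
      then show ?thesis unfolding upd add_0 .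
    qed
    also have "\<dots> = slot_sum L (tensor (?g (card (S False - T)) (card (S True - T)))) \<Gamma> (\<lambda>_. 0)"
    proof -
      have "slot_sum L (tensor ((?g (card (S False - T)) 0)(True := diagonal_taylor p 0))) ((S True - T) \<union> \<Gamma>) (\<lambda>_. 0) =
        slot_sum L (tensor ((?g (card (S False - T)) 0)(True := diagonal_taylor p (0 + card (S True - T))))) \<Gamma> (\<lambda>_. 0)"
        by (rule slot_sum_diagonal_slots) (use fin disj LS in auto)
      then show ?thesis unfolding upd add_0 .
    qed
    also have "tensor (?g a b) = (\<lambda>\<alpha>. (fact a * fact b) * tensor (\<lambda>s. deriv_at_0 (if s then derived p b else derived p a)) \<alpha>)" for a b
      by (simp add: tensor_def diagonal_taylor_def fun_eq_iff)
    also have "slot_sum L (\<lambda>\<alpha>. (fact a * fact b) * tensor (\<lambda>s. deriv_at_0 (if s then derived p b else derived p a)) \<alpha>) \<Gamma> (\<lambda>_. 0)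
      = fact a * fact b * deriv_at_0 (derived p a * derived p b) (type_count \<tau> \<Gamma>)" for a b
      unfolding slot_sum_scale
      by (subst slot_sum_product_slots[OF fin(1)]) (auto simp: L_def \<tau>_def \<Gamma>_def)
    also have "type_count \<tau> \<Gamma> = exponent \<gamma>"
    proof
      fix i
      have "{x \<in> \<Gamma>. \<tau> x = i} = (\<lambda>j. Inl (i, j)) ` {..<exponent \<gamma> i}" by (auto simp: \<Gamma>_def \<tau>_def)
      then show "type_count \<tau> \<Gamma> i = exponent \<gamma> i"
        by (simp add: type_count_def card_image inj_on_def)
    qed
    finally show ?thesis by (simp add: cd e_def)
  qed
  have "e (m - 1) (n + 1) \<le> e m n"
  proof (rule symmetric_alexandrov_fenchel_unimodal[OF fin(2) fin(2) disj(1) cardS cardS _ _ _ AF _ G])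
    show "flip ` S False = S True" "flip ` S True = S False"
      by (force simp: flip_def S_def)+
    show "flip (flip x) = x" for x by (auto simp: flip_def split: sum.split)
    show "slot_poly E L \<phi> T \<ge> 0" for T by (rule slot_poly_nonneg[OF \<phi>_nonneg])
    show "e a b = e b a" for a b by (simp add: e_def mult.commute)
  qed (use mn in \<open>auto simp: N_def\<close>)
  then have "(\<Prod>i\<in>UNIV. fact (exponent \<gamma> i)) * coefficient (derived p (m - 1) * derived p (n + 1)) \<gamma> \<le>
      (\<Prod>i\<in>UNIV. fact (exponent \<gamma> i)) * coefficient (derived p m * derived p n) \<gamma>"
    by (simp add: e_def deriv_at_0_def lookup_inverse)
  then show ?thesis by (rule mult_left_le_imp_le) (simp add: prod_pos)
qed

section \<open>Passage to the limit\<close>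

definition monomial_taylor :: "'v::finite monomial \<Rightarrow> nat \<Rightarrow> 'v rpoly" where
  "monomial_taylor \<alpha> a = coeff (\<Prod>i\<in>UNIV. [:Var i, 1:] ^ exponent \<alpha> i) a"

lemma derived_eq_sum:
  assumes "finite B" "monomials f \<subseteq> B"
  shows "derived f a = (\<Sum>\<alpha>\<in>B. Const (coefficient f \<alpha>) * monomial_taylor \<alpha> a)"
proof -
  have "derived f a = (\<Sum>\<alpha>\<in>monomials f. Const (coefficient f \<alpha>) * monomial_taylor \<alpha> a)"
    by (simp add: derived_def diagonal_shift_def monomial_taylor_def coeff_sum)
  also have "\<dots> = (\<Sum>\<alpha>\<in>B. Const (coefficient f \<alpha>) * monomial_taylor \<alpha> a)"
    using assms by (intro sum.mono_neutral_left) (auto simp: in_keys_iff Const_def)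
  finally show ?thesis .
qed

text \<open>Over a fixed finite set B of exponents \<open>derived\<close> is linear in the
  coefficients, so each coefficient of the product is a finite bilinear expression in them.\<close>

lemma tendsto_coefficient_derived_mult:
  fixes f :: "'v::finite rpoly"
  assumes B: "finite B" "monomials f \<subseteq> B" "\<And>t. monomials (F t) \<subseteq> B"
    and lim: "\<And>\<alpha>. ((\<lambda>t. coefficient (F t) \<alpha>) \<longlongrightarrow> coefficient f \<alpha>) H"
  shows "((\<lambda>t. coefficient (derived (F t) a * derived (F t) b) \<gamma>) \<longlongrightarrow>
    coefficient (derived f a * derived f b) \<gamma>) H"
proof -
  have eq: "coefficient (derived g a * derived g b) \<gamma> =
      (\<Sum>\<alpha>\<in>B. \<Sum>\<beta>\<in>B. coefficient g \<alpha> * (coefficient g \<beta> *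
        coefficient (monomial_taylor \<alpha> a * monomial_taylor \<beta> b) \<gamma>))"
    if "monomials g \<subseteq> B" for g :: "'v rpoly"
  proof -
    have "derived g a * derived g b = (\<Sum>\<alpha>\<in>B. \<Sum>\<beta>\<in>B. Const (coefficient g \<alpha>) *
        (Const (coefficient g \<beta>) * (monomial_taylor \<alpha> a * monomial_taylor \<beta> b)))"
      unfolding derived_eq_sum[OF B(1) that] sum_product by (simp add: mult_ac)
    then show ?thesis by (simp add: lookup_sum coefficient_Const_mult)
  qed
  show ?thesis
    unfolding eq[OF B(2)] eq[OF B(3)] by (intro tendsto_intros lim)
qed

theorem corollary1p13:
  fixes f :: "'r::finite rpoly" and m n :: nat
  assumes "dually_lorentzian f"
    and "1 \<le> m" and "m \<le> n"
  shows "monomial_positive (derived f m * derived f n - derived f (m - 1) * derived f (n + 1))"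
proof (cases "f = 0")
  case True
  then have "derived f a = 0" for a by (simp add: derived_def diagonal_shift_def)
  then show ?thesis by (simp add: monomial_positive_def)
next
  case False
  obtain k \<kappa> d where hom: "homogeneous k f" and \<kappa>: "degree_bounded \<kappa> f" and lor: "lorentzian_of_degree d (dual \<kappa> f)"
    using assms(1) by (auto simp: dually_lorentzian_def lorentzian_def)
  obtain C :: "real \<Rightarrow> ('r \<Rightarrow> nat) \<Rightarrow> real" where
    Cnn: "\<And>t \<alpha>. t > 0 \<Longrightarrow> C t \<alpha> \<ge> 0" and
    Csupp: "\<And>t \<alpha>. t > 0 \<Longrightarrow> C t \<alpha> \<noteq> 0 \<longleftrightarrow> (\<forall>i. \<alpha> i \<le> exponent \<kappa> i) \<and> (\<Sum>i\<in>UNIV. \<alpha> i) = k" and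
    Cloc: "\<And>t. t > 0 \<Longrightarrow> local_index (C t)" and
    Clim: "\<And>\<alpha>. ((\<lambda>t. C t (exponent \<alpha>)) \<longlongrightarrow> coefficient f \<alpha>) (at_right 0)"
    using dually_lorentzian_approximation[OF False hom \<kappa> lor] by blast
  \<comment> \<open>The approximants can have monomials that f lacks; the exponents below \<kappa>
    form one finite set that contains the monomials of f and of all approximants.\<close>
  define B where "B = Abs_poly_mapping ` {\<alpha>. \<forall>i. \<alpha> i \<le> exponent \<kappa> i}"
  have "{\<alpha>. \<forall>i. \<alpha> i \<le> exponent \<kappa> i} = PiE UNIV (\<lambda>i. {..exponent \<kappa> i})" by auto
  then have finB: "finite B" unfolding B_def by (simp add: finite_PiE)
  have memB: "\<alpha> \<in> B \<longleftrightarrow> (\<forall>i. exponent \<alpha> i \<le> exponent \<kappa> i)" for \<alpha>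
    unfolding B_def by (auto simp: image_iff intro: exI[of _ "exponent \<alpha>"] simp: lookup_inverse)
  define F where "F t = (\<Sum>\<alpha>\<in>B. Poly_Mapping.single \<alpha> (C t (exponent \<alpha>)))" for t
  have F: "coefficient (F t) \<alpha> = (if \<alpha> \<in> B then C t (exponent \<alpha>) else 0)" for t \<alpha>
    using finB by (simp add: F_def lookup_sum lookup_single when_def)
  have FC: "(\<lambda>\<alpha>. coefficient (F t) (Abs_poly_mapping \<alpha>)) = C t" if "t > 0" for t
    using Csupp[OF that] by (auto simp: F memB fun_eq_iff)
  have lim: "((\<lambda>t. coefficient (F t) \<alpha>) \<longlongrightarrow> coefficient f \<alpha>) (at_right 0)" for \<alpha>
  proof (cases "\<alpha> \<in> B")
    case True
    then show ?thesis using Clim by (simp add: F)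
  next
    case False
    then have "\<alpha> \<notin> monomials f" using \<kappa> by (auto simp: memB degree_bounded_def)
    then show ?thesis using False by (simp add: F in_keys_iff)
  qed
  show ?thesis
    unfolding monomial_positive_def
  proof
    fix \<gamma>
    have ineq: "coefficient (derived (F t) (m - 1) * derived (F t) (n + 1)) \<gamma> \<le>
        coefficient (derived (F t) m * derived (F t) n) \<gamma>" if t: "t > 0" for t
    proof -
      have FCp: "coefficient (F t) (Abs_poly_mapping \<alpha>) = C t \<alpha>" for \<alpha>
        using fun_cong[OF FC[OF t], of \<alpha>] by simp
      show ?thesis
        by (rule derived_coefficient_ineq_of_local_index[of "F t" "exponent \<kappa>" k])
          (simp_all only: FC[OF t] FCp Cnn[OF t] Csupp[OF t] Cloc[OF t] assms(2,3))
    qed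
    have limit: "((\<lambda>t. coefficient (derived (F t) a * derived (F t) b) \<gamma>) \<longlongrightarrow>
        coefficient (derived f a * derived f b) \<gamma>) (at_right 0)" for a b
      by (rule tendsto_coefficient_derived_mult[OF finB _ _ lim])
        (use \<kappa> F in \<open>auto simp: memB degree_bounded_def in_keys_iff split: if_splits\<close>)
    have "coefficient (derived f (m - 1) * derived f (n + 1)) \<gamma> \<le> coefficient (derived f m * derived f n) \<gamma>"
      by (rule tendsto_le[OF _ limit limit])
        (simp, rule eventually_mono[OF eventually_at_right_less], rule ineq)
    then show "coefficient (derived f m * derived f n - derived f (m - 1) * derived f (n + 1)) \<gamma> \<ge> 0"
      by (simp add: lookup_minus)
  qed
qed

end
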